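(* Let $N,k$ be integers with $N>k\ge 2$, let $m\in\mathbb{N}$ ($m\ge 1$) be the integer with $k=2m$ or $k=2m+1$, let $p=\frac{N}{k}$, $R>0$ and $a\ge 1$. Put $$K=\begin{cases}\left(\frac{N-k}{kN}\prod_{j=1}^m 2j\,(N-2j)\right)^p & \text{if } k=2m,\\[4pt] \left(\frac{N-k}{N}\prod_{j=1}^m 2j\,(N-2j)\right)^p & \text{if } k=2m+1.\end{cases}$$ Then the inequality $$K\int_{B_R}\frac{|u|^p}{|x|^N\left(\log\frac{aR}{|x|}\right)^p}\,dx\le\int_{B_R}|\nabla^k u|^p\,dx$$ holds for any $u\in W_{0,{\rm rad}}^{k,p}(B_R)$. Moreover, the optimal (largest possible) constant in this inequality on $W_{0,{\rm rad}}^{k,p}(B_R)$ is $K$, which is independent of $a\ge1$, and it is not attained (equality holds for no $u\in W_{0,{\rm rad}}^{k,p}(B_R)\setminus\{0\}$).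
   Context: $B_R\subset\mathbb{R}^N$ is the open ball of radius $R$ centered at $0$. For $k=2m$ put $\nabla^k u=\Delta^m u$, and for $k=2m+1$ put $\nabla^k u=\nabla\Delta^m u$; $|u|_{k,p}=\|\nabla^k u\|_{L^p(B_R)}$. $W_0^{k,p}(B_R)$ is the completion of $C_c^\infty(B_R)$ with respect to $|\cdot|_{k,p}$, and $W_{0,{\rm rad}}^{k,p}(B_R)$ is its subspace of radial functions. *)

theory Defs
  imports "HOL-Analysis.Analysis"
begin

definition pderiv_at :: "'n::finite \<Rightarrow> (real ^ 'n \<Rightarrow> real) \<Rightarrow> real ^ 'n \<Rightarrow> real" where
  "pderiv_at i f x = frechet_derivative f (at x) (axis i 1)"

(* Infinite differentiability: all iterated partial derivatives (of every order, in every
   order of differentiation) exist and are Frechet differentiable, hence continuous. *)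
definition smooth :: "(real ^ 'n::finite \<Rightarrow> real) \<Rightarrow> bool" where
  "smooth f \<longleftrightarrow> (\<forall>is. foldr pderiv_at is f differentiable_on UNIV)"

definition gradient :: "(real ^ 'n::finite \<Rightarrow> real) \<Rightarrow> real ^ 'n \<Rightarrow> real ^ 'n" where
  "gradient f x = (\<chi> i. pderiv_at i f x)"

definition laplacian :: "(real ^ 'n::finite \<Rightarrow> real) \<Rightarrow> real ^ 'n \<Rightarrow> real" where
  "laplacian f x = (\<Sum>i\<in>UNIV. pderiv_at i (pderiv_at i f) x)"

(* The k-th order gradient is scalar for even k and vector valued for odd k.  Both are put into
   one type by filling the unused component with 0; the norm of a pair (s, v) is
   sqrt (s^2 + |v|^2), so the norm of nabla k f x is the intended one in both cases. *)
definition nabla :: "nat \<Rightarrow> (real ^ 'n::finite \<Rightarrow> real) \<Rightarrow> real ^ 'n \<Rightarrow> real \<times> (real ^ 'n)" where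
  "nabla k f x =
     (if even k then ((laplacian ^^ (k div 2)) f x, 0)
      else (0, gradient ((laplacian ^^ (k div 2)) f) x))"

definition test_functions :: "real \<Rightarrow> (real ^ 'n::finite \<Rightarrow> real) set" where
  "test_functions R =
     {f. smooth f \<and> compact (closure {x. f x \<noteq> 0}) \<and> closure {x. f x \<noteq> 0} \<subseteq> ball 0 R}"

(* The p-th power of the L^p norm, as an extended nonnegative real. *)
definition Lp_energy ::
    "real \<Rightarrow> real \<Rightarrow> (real ^ 'n::finite \<Rightarrow> 'b::real_normed_vector) \<Rightarrow> ennreal" where
  "Lp_energy p R g = (\<integral>\<^sup>+ x. ennreal (norm (g x) powr p) \<partial>lebesgue_on (ball 0 R))"

definition Lp_converges :: "real \<Rightarrow> real \<Rightarrow> (nat \<Rightarrow> real ^ 'n::finite \<Rightarrow> 'b::euclidean_space) \<Rightarrow>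
    (real ^ 'n \<Rightarrow> 'b) \<Rightarrow> bool" where
  "Lp_converges p R f g \<longleftrightarrow>
     g \<in> borel_measurable (lebesgue_on (ball 0 R)) \<and>
     (\<lambda>n. Lp_energy p R (\<lambda>x. f n x - g x)) \<longlonglongrightarrow> 0"

(* The completion of the test functions under the norm |nabla k f|_{L^p}, realised by functions
   on the ball.  A sequence that is Cauchy for this norm has a limit g of its k-th gradients in
   L^p (completeness of L^p), and by the Poincare inequality the sequence itself has a limit u
   in L^p.  The element of the completion that the sequence represents is identified with u,
   and g is its k-th gradient; g is determined almost everywhere by u, being the weak k-th
   gradient of u. *)
definition has_W0_nabla :: "nat \<Rightarrow> real \<Rightarrow> real \<Rightarrow> (real ^ 'n::finite \<Rightarrow> real) \<Rightarrow>
    (real ^ 'n \<Rightarrow> real \<times> (real ^ 'n)) \<Rightarrow> bool" where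
  "has_W0_nabla k p R u g \<longleftrightarrow>
     (\<exists>\<phi>. (\<forall>n. \<phi> n \<in> test_functions R) \<and>
          Lp_converges p R \<phi> u \<and> Lp_converges p R (\<lambda>n. nabla k (\<phi> n)) g)"

definition W0 :: "nat \<Rightarrow> real \<Rightarrow> real \<Rightarrow> (real ^ 'n::finite \<Rightarrow> real) set" where
  "W0 k p R = {u. \<exists>g. has_W0_nabla k p R u g}"

(* Radial up to a null set, since elements of W0 matter only up to null sets. *)
definition W0_rad :: "nat \<Rightarrow> real \<Rightarrow> real \<Rightarrow> (real ^ 'n::finite \<Rightarrow> real) set" where
  "W0_rad k p R =
     {u \<in> W0 k p R. \<exists>v :: real \<Rightarrow> real. AE x in lebesgue_on (ball 0 R). u x = v (norm x)}"

definition log_weight_integral ::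
    "real \<Rightarrow> real \<Rightarrow> real \<Rightarrow> (real ^ 'n::finite \<Rightarrow> real) \<Rightarrow> ennreal" where
  "log_weight_integral p a R u =
     (\<integral>\<^sup>+ x. ennreal (\<bar>u x\<bar> powr p / (norm x ^ CARD('n) * ln (a * R / norm x) powr p))
        \<partial>lebesgue_on (ball 0 R))"

definition rellich_const :: "nat \<Rightarrow> nat \<Rightarrow> nat \<Rightarrow> real \<Rightarrow> real" where
  "rellich_const N k m p =
     (if k = 2 * m
      then ((real N - real k) / (real k * real N)
              * (\<Prod>j=1..m. 2 * real j * (real N - 2 * real j))) powr p
      else ((real N - real k) / real N
              * (\<Prod>j=1..m. 2 * real j * (real N - 2 * real j))) powr p)"

end

theory Submission
  imports Defs "HOL-Real_Asymp.Real_Asymp" "HOL-Computational_Algebra.Polynomial"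
begin

text \<open>The radial part of \<open>u\<close> is recovered from the radial part of its \<open>k\<close>-th gradient by
  applying alternately \<open>f \<mapsto> r\<^sup>1\<^sup>-\<^sup>n \<integral>\<^sub>0\<^sup>r s\<^sup>n\<^sup>-\<^sup>1 f(s) ds\<close> (inverting the divergence) and
  \<open>f \<mapsto> \<integral>\<^sub>r\<^sup>R f(s) ds\<close> (inverting the gradient).  Each of these \<open>k\<close> steps satisfies a sharp one-dimensional
  Hardy inequality, proved by Schur's test with a power weight; the last one is the critical
  inequality with logarithmic weight, and the product of the constants is \<open>K\<close>.
  The approximating test functions need not be radial, so the representation is obtained by
  integrating by parts against even polynomials in \<open>|x|\<close>, whose integrals determine a radial
  function by Weierstrass' theorem.  On a bounded ball one of the Hardy steps is strict, so that
  equality never holds.  Optimality is seen from \<open>u(x) = \<psi>(2\<epsilon> log(R/|x|))\<close>: as \<open>\<epsilon> \<longrightarrow> 0\<close> only the first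
  derivative of \<open>\<psi>\<close> survives and the quotient tends to that of the one-dimensional Hardy
  inequality, for which \<open>\<psi>(t) = t powr (1 - 1/p) * \<chi>(\<eta> ln t)\<close> with \<open>\<eta> \<longrightarrow> 0\<close> is optimal.\<close>

section \<open>Powers of extended nonnegative reals and the Schur test\<close>

text \<open>The exponents dictate the shape of the proof. Undoing the derivative of order j takes
  the weight r^(j p - 1) to r^((j-1) p - 1). Since k p = N, the weight of order k is r^(N-1), the
  radial volume element, so the chain starts at the energy of the k-th gradient. It ends at order 1,
  where the constant j - 1 of the power-weight Hardy inequality degenerates to 0, and this forces
  the logarithm. The weak k-th gradient is not known to be radial and no pointwise derivatives of u
  are at hand, so no ordinary differential equation is solved. Instead the gradient is replaced by
  the spherical averages of the positive and negative parts of its radial component, and |u| is only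
  dominated by the iterated operators. Since all kernels are nonnegative, everything runs in
  extended nonnegative integrals, where Tonelli's theorem needs no integrability; signed identities
  are rewritten as equalities of sums. A larger a only weakens the left side of the inequality, and
  in the test functions a appears as a shift by 2 \<epsilon> ln a that disappears in the limit,
  whence one constant for all a >= 1.\<close>

text \<open>The base is extended because densities and iterated kernel integrals may be infinite at
  single radii; sending infinity to infinity keeps \<open>epow\<close> monotone for every p >=
  0.\<close>

definition epow :: "ennreal \<Rightarrow> real \<Rightarrow> ennreal" where
  "epow x p = (if x = \<infinity> then \<infinity> else ennreal (enn2real x powr p))"

lemma epow_ennreal: "0 \<le> a \<Longrightarrow> epow (ennreal a) p = ennreal (a powr p)"
  by (simp add: epow_def)

lemma epow_mono: "x \<le> y \<Longrightarrow> 0 \<le> p \<Longrightarrow> epow x p \<le> epow y p"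
  by (cases x; cases y) (auto simp: epow_def top_unique intro!: powr_mono2)

lemma epow_measurable [measurable]:
  assumes [measurable]: "f \<in> borel_measurable M"
  shows "(\<lambda>x. epow (f x) p) \<in> borel_measurable M"
proof -
  have "Measurable.pred M (\<lambda>x. f x = \<infinity>)"
    unfolding pred_def by measurable
  then show ?thesis unfolding epow_def by measurable
qed

text \<open>The graph of the p-th power lies above its tangent at c, with equality for x = c. With c
  free, this replaces Hoelder's inequality below.\<close>

lemma Young_scaled:
  fixes x c p :: real
  assumes "0 \<le> x" "0 < c" "1 < p"
  shows "x \<le> x powr p * c powr (1 - p) / p + (1 - 1/p) * c"
proof -
  define q where "q = p / (p - 1)"
  have q: "q > 1" "1/p + 1/q = 1" "1/q = 1 - 1/p" using assms by (auto simp: q_def field_simps)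
  have "(x * c powr (-(1/q))) * c powr (1/q) \<le> (x * c powr (-(1/q))) powr p / p + (c powr (1/q)) powr q / q"
    using assms q by (intro Youngs_inequality) auto
  also have "(x * c powr (-(1/q))) * c powr (1/q) = x"
    using assms by (simp flip: powr_add)
  also have "(x * c powr (-(1/q))) powr p = x powr p * c powr (1 - p)"
  proof -
    have "- (1/q) * p = 1 - p" using assms q(3) by (simp add: field_simps)
    then show ?thesis using assms by (simp add: powr_mult powr_powr)
  qed
  also have "(c powr (1/q)) powr q / q = (1 - 1/p) * c"
  proof -
    have "(1/q) * q = 1" "inverse q = 1/q" using q(1) by (simp_all add: divide_inverse)
    then show ?thesis using assms(2) unfolding q(3)[symmetric] by (simp add: powr_powr)
  qed
  finally show ?thesis .
qed

text \<open>Hoelder's inequality for the factorisation of \<open>k\<close> into powers of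
  \<open>k * w\<close> and \<open>k * w powr (1 - p)\<close>, in a form that allows infinite values
  of \<open>f\<close>. Young's inequality with c = b w(s) is integrated over s, and b is
  optimised.\<close>

lemma weighted_Jensen:
  fixes f :: "'a \<Rightarrow> ennreal" and k w :: "'a \<Rightarrow> real"
  assumes [measurable]: "f \<in> borel_measurable M" "k \<in> borel_measurable M" "w \<in> borel_measurable M"
    and p: "1 < p" and A: "0 < A" and k0: "\<And>s. 0 \<le> k s" and w0: "\<And>s. 0 < k s \<Longrightarrow> 0 < w s"
    and kw: "(\<integral>\<^sup>+s. ennreal (k s * w s) \<partial>M) \<le> ennreal A"
  shows "epow (\<integral>\<^sup>+s. f s * ennreal (k s) \<partial>M) p
      \<le> ennreal (A powr (p - 1)) * (\<integral>\<^sup>+s. epow (f s) p * ennreal (k s * w s powr (1 - p)) \<partial>M)"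
proof -
  define I where "I = (\<integral>\<^sup>+s. f s * ennreal (k s) \<partial>M)"
  define J where "J = (\<integral>\<^sup>+s. epow (f s) p * ennreal (k s * w s powr (1 - p)) \<partial>M)"
  \<comment> \<open>A strictly positive bound J' stands in for J, which may be 0 and would give b =
    0; an epsilon removes the slack at the end.\<close>
  have main: "epow I p \<le> ennreal (A powr (p - 1) * J')" if "J \<le> ennreal J'" "0 < J'" for J'
  proof -
    \<comment> \<open>The minimiser of b^(1-p) J'/p + (1 - 1/p) b A over b > 0; there the sum equals
      A b.\<close>
    define b where "b = (J'/A) powr (1/p)"
    have b0: "0 < b" using that A by (simp add: b_def)
    have pt: "f s * ennreal (k s) \<le> ennreal (b powr (1-p) / p) * (epow (f s) p * ennreal (k s * w s powr (1 - p)))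
        + ennreal ((1 - 1/p) * b) * ennreal (k s * w s)" for s
    proof (cases "k s = 0")
      case False
      then have ks: "0 < k s" "0 < w s" using k0[of s] w0[of s] by auto
      show ?thesis
      proof (cases "f s")
        case (real x)
        have "x * k s \<le> (x powr p * (b * w s) powr (1 - p) / p + (1 - 1/p) * (b * w s)) * k s"
          using Young_scaled[of x "b * w s" p] real ks b0 p by (intro mult_right_mono) auto
        also have "\<dots> = (b powr (1-p) / p) * (x powr p * (k s * w s powr (1 - p))) + ((1 - 1/p) * b) * (k s * w s)"
          using b0 ks by (simp add: powr_mult algebra_simps)
        finally have le: "x * k s \<le> \<dots>" .
        have "f s * ennreal (k s) = ennreal (x * k s)" using real ks by (simp add: ennreal_mult)
        also have "\<dots> \<le> ennreal ((b powr (1-p) / p) * (x powr p * (k s * w s powr (1 - p))) + ((1 - 1/p) * b) * (k s * w s))"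
          using le by (rule ennreal_leI)
        also have "\<dots> = ennreal (b powr (1-p) / p) * (epow (f s) p * ennreal (k s * w s powr (1 - p)))
            + ennreal ((1 - 1/p) * b) * ennreal (k s * w s)"
          unfolding epow_ennreal[OF real(1)] real(2) using real ks b0 p
          by (subst ennreal_plus) (simp_all add: epow_ennreal flip: ennreal_mult)
        finally show ?thesis .
      next
        case top
        have pos: "0 < k s * w s powr (1 - p)" "0 < b powr (1-p) / p" using ks b0 p by auto
        have t: "ennreal c * (epow top p * ennreal d) = top" if "0 < c" "0 < d" for c d
          using that by (simp add: epow_def)
        show ?thesis unfolding top t[OF pos(2) pos(1)] by simp
      qed
    qed simp
    have "I \<le> (\<integral>\<^sup>+s. ennreal (b powr (1-p) / p) * (epow (f s) p * ennreal (k s * w s powr (1 - p)))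
        + ennreal ((1 - 1/p) * b) * ennreal (k s * w s) \<partial>M)"
      unfolding I_def by (intro nn_integral_mono pt)
    also have "\<dots> = ennreal (b powr (1-p) / p) * J + ennreal ((1 - 1/p) * b) * (\<integral>\<^sup>+s. ennreal (k s * w s) \<partial>M)"
      by (simp add: nn_integral_add nn_integral_cmult J_def)
    also have "\<dots> \<le> ennreal (b powr (1-p) / p) * ennreal J' + ennreal ((1 - 1/p) * b) * ennreal A"
      using that kw by (intro add_mono mult_left_mono) auto
    also have "\<dots> = ennreal (b powr (1-p) / p * J' + (1 - 1/p) * b * A)"
    proof -
      have nn: "0 \<le> b powr (1-p) / p" "0 \<le> (1 - 1/p) * b" using p b0 by auto
      show ?thesis
        using that A by (simp only: ennreal_mult[OF nn(1)] ennreal_mult[OF nn(2)] ennreal_plus mult_nonneg_nonneg nn less_imp_le)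
    qed
    also have "b powr (1-p) / p * J' + (1 - 1/p) * b * A = A * b"
    proof -
      have "b powr (1-p) * J' = A * b"
      proof -
        have "b powr (1 - p) = b * b powr (-p)" using b0 by (simp add: powr_diff powr_minus field_simps)
        moreover have "b powr (-p) = A / J'"
          using that A p by (simp add: b_def powr_powr powr_minus field_simps)
        ultimately show ?thesis using that by simp
      qed
      then show ?thesis using p by (simp add: field_simps)
    qed
    finally have "epow I p \<le> epow (ennreal (A * b)) p" using p by (intro epow_mono) auto
    also have "\<dots> = ennreal ((A * b) powr p)" using A b0 by (intro epow_ennreal) auto
    also have "(A * b) powr p = A powr (p - 1) * J'"
      using A that p b0 by (simp add: powr_mult b_def powr_powr powr_divide powr_diff)
    finally show ?thesis .
  qed
  have "epow I p \<le> ennreal (A powr (p - 1)) * J"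
  proof (cases J)
    case (real j)
    show ?thesis
    proof (rule ennreal_le_epsilon)
      fix e :: real assume e: "0 < e"
      define d where "d = e / A powr (p - 1)"
      have d: "d > 0" using e A by (simp add: d_def)
      have "epow I p \<le> ennreal (A powr (p - 1) * (j + d))"
        using real d by (intro main) auto
      also have "A powr (p - 1) * (j + d) = A powr (p - 1) * j + e" using A by (simp add: d_def field_simps)
      finally show "epow I p \<le> ennreal (A powr (p - 1)) * J + ennreal e"
        using real e by (simp add: ennreal_mult ennreal_plus)
    qed
  next
    case top
    then show ?thesis using A by (simp add: ennreal_mult_top)
  qed
  then show ?thesis unfolding I_def J_def .
qed

text \<open>Open intervals and one-sided limits admit integrands that blow up at an endpoint. The
  inequality between the limits is recorded as well, because \<open>ennreal\<close> would truncate a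
  negative difference.\<close>

lemma nn_integral_FTC_open:
  fixes f F :: "real \<Rightarrow> real"
  assumes "a < b"
    and F: "\<And>x. a < x \<Longrightarrow> x < b \<Longrightarrow> (F has_real_derivative f x) (at x)"
    and f: "\<And>x. a < x \<Longrightarrow> x < b \<Longrightarrow> isCont f x"
    and f0: "\<And>x. a < x \<Longrightarrow> x < b \<Longrightarrow> 0 \<le> f x"
    and A: "(F \<longlongrightarrow> A) (at_right a)" and B: "(F \<longlongrightarrow> B) (at_left b)"
  shows "(\<integral>\<^sup>+x. ennreal (f x) * indicator {a<..<b} x \<partial>lborel) = ennreal (B - A)"
    and "A \<le> B"
proof -
  have A': "((F \<circ> real_of_ereal) \<longlongrightarrow> A) (at_right (ereal a))"
    and B': "((F \<circ> real_of_ereal) \<longlongrightarrow> B) (at_left (ereal b))"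
    using A B by (simp_all add: ereal_tendsto_simps)
  have 1: "set_integrable lborel (einterval (ereal a) (ereal b)) f"
    and 2: "(LBINT x=ereal a..ereal b. f x) = B - A"
    by (rule interval_integral_FTC_nonneg[of "ereal a" "ereal b" F f A B];
        use assms A' B' in simp)+
  have e: "einterval (ereal a) (ereal b) = {a<..<b}" by (auto simp: einterval_def)
  have int: "integrable lborel (\<lambda>x. indicator {a<..<b} x * f x)"
    using 1 by (simp add: e set_integrable_def)
  have val: "(\<integral>x. indicator {a<..<b} x * f x \<partial>lborel) = B - A"
    using 2 \<open>a < b\<close> by (simp add: interval_lebesgue_integral_def e set_lebesgue_integral_def)
  have "(\<integral>\<^sup>+x. ennreal (f x) * indicator {a<..<b} x \<partial>lborel) = (\<integral>\<^sup>+x. ennreal (indicator {a<..<b} x * f x) \<partial>lborel)"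
    by (intro nn_integral_cong) (auto simp: indicator_def)
  also have "\<dots> = ennreal (B - A)"
    using int val f0 by (subst nn_integral_eq_integral) (auto simp: indicator_def)
  finally show "(\<integral>\<^sup>+x. ennreal (f x) * indicator {a<..<b} x \<partial>lborel) = ennreal (B - A)" .
  have "0 \<le> (\<integral>x. indicator {a<..<b} x * f x \<partial>lborel)"
    using f0 by (intro Bochner_Integration.integral_nonneg) (auto simp: indicator_def)
  then show "A \<le> B" using val by simp
qed

definition kernel_op :: "(real \<Rightarrow> real \<Rightarrow> real) \<Rightarrow> (real \<Rightarrow> ennreal) \<Rightarrow> real \<Rightarrow> ennreal" where
  "kernel_op K f r = (\<integral>\<^sup>+s. f s * ennreal (K r s) \<partial>lborel)"

lemma kernel_op_measurable [measurable]:
  assumes [measurable]: "case_prod K \<in> borel_measurable (borel \<Otimes>\<^sub>M borel)" "f \<in> borel_measurable borel"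
  shows "kernel_op K f \<in> borel_measurable borel"
  unfolding kernel_op_def by measurable

text \<open>Tonelli's theorem; the hypothesis \<open>adj\<close> makes \<open>K'\<close> the
  transpose of \<open>K\<close> for the pairing with weight \<open>v\<close>.\<close>

lemma kernel_op_adjoint:
  assumes [measurable]: "case_prod K \<in> borel_measurable (borel \<Otimes>\<^sub>M borel)"
      "case_prod K' \<in> borel_measurable (borel \<Otimes>\<^sub>M borel)"
      "f \<in> borel_measurable borel" "h \<in> borel_measurable borel" "v \<in> borel_measurable borel"
    and adj: "\<And>r s. ennreal (K r s) * v r = ennreal (K' s r) * v s"
  shows "(\<integral>\<^sup>+r. kernel_op K f r * h r * v r \<partial>lborel) = (\<integral>\<^sup>+s. f s * kernel_op K' h s * v s \<partial>lborel)"
proof -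
  have "(\<integral>\<^sup>+r. kernel_op K f r * h r * v r \<partial>lborel)
      = (\<integral>\<^sup>+r. (\<integral>\<^sup>+s. f s * ennreal (K r s) * (h r * v r) \<partial>lborel) \<partial>lborel)"
    unfolding kernel_op_def by (intro nn_integral_cong, subst nn_integral_multc) (auto simp: mult.assoc)
  also have "\<dots> = (\<integral>\<^sup>+s. (\<integral>\<^sup>+r. f s * ennreal (K r s) * (h r * v r) \<partial>lborel) \<partial>lborel)"
    by (rule lborel_pair.Fubini') measurable
  also have "\<dots> = (\<integral>\<^sup>+s. (\<integral>\<^sup>+r. (f s * v s) * (h r * ennreal (K' s r)) \<partial>lborel) \<partial>lborel)"
  proof (intro nn_integral_cong)
    fix s r :: real
    have "f s * ennreal (K r s) * (h r * v r) = f s * h r * (ennreal (K r s) * v r)" by (simp add: mult_ac)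
    also have "\<dots> = (f s * v s) * (h r * ennreal (K' s r))" by (subst adj) (simp add: mult_ac)
    finally show "f s * ennreal (K r s) * (h r * v r) = (f s * v s) * (h r * ennreal (K' s r))" .
  qed
  also have "\<dots> = (\<integral>\<^sup>+s. f s * kernel_op K' h s * v s \<partial>lborel)"
    unfolding kernel_op_def by (intro nn_integral_cong, subst nn_integral_cmult) (auto simp: mult_ac)
  finally show ?thesis .
qed

text \<open>Schur's test: \<open>w\<close> is a trial function, \<open>A\<close> bounds its image
  under the kernel, and \<open>D\<close> collects what remains after the integrals are exchanged.
  \<open>D\<close> is a function and not a constant times a weight, so that the boundary loss of the
  flux step stays visible.\<close>

lemma Schur_estimate:
  fixes K :: "real \<Rightarrow> real \<Rightarrow> real"
  assumes K [measurable]: "case_prod K \<in> borel_measurable (borel \<Otimes>\<^sub>M borel)"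
    and [measurable]: "f \<in> borel_measurable borel" "w \<in> borel_measurable borel"
      "v \<in> borel_measurable borel" "A \<in> borel_measurable borel"
    and p: "1 < p" and K0: "\<And>r s. 0 \<le> K r s" and w0: "\<And>r s. 0 < K r s \<Longrightarrow> 0 < w s"
    and v0: "\<And>r. 0 \<le> v r" and A0: "\<And>r. v r \<noteq> 0 \<Longrightarrow> 0 < A r"
    and Kw: "\<And>r. v r \<noteq> 0 \<Longrightarrow> (\<integral>\<^sup>+s. ennreal (K r s * w s) \<partial>lborel) \<le> ennreal (A r)"
    and D: "\<And>s. epow (f s) p * ennreal (w s powr (1 - p)) * (\<integral>\<^sup>+r. ennreal (v r * A r powr (p - 1) * K r s) \<partial>lborel)
              \<le> epow (f s) p * ennreal (D s)"
  shows "(\<integral>\<^sup>+r. epow (kernel_op K f r) p * ennreal (v r) \<partial>lborel) \<le> (\<integral>\<^sup>+s. epow (f s) p * ennreal (D s) \<partial>lborel)"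
proof -
  have Kr[measurable]: "K r \<in> borel_measurable borel" for r
    by measurable
  have "(\<integral>\<^sup>+r. epow (kernel_op K f r) p * ennreal (v r) \<partial>lborel)
     \<le> (\<integral>\<^sup>+r. (ennreal (A r powr (p - 1)) * (\<integral>\<^sup>+s. epow (f s) p * ennreal (K r s * w s powr (1 - p)) \<partial>lborel)) * ennreal (v r) \<partial>lborel)"
  proof (intro nn_integral_mono)
    fix r :: real
    show "epow (kernel_op K f r) p * ennreal (v r)
      \<le> (ennreal (A r powr (p - 1)) * (\<integral>\<^sup>+s. epow (f s) p * ennreal (K r s * w s powr (1 - p)) \<partial>lborel)) * ennreal (v r)"
    proof (cases "v r = 0")
      case False
      then show ?thesis unfolding kernel_op_def
        using weighted_Jensen[of f lborel "K r" w p "A r"] p A0 K0 w0 Kw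
        by (intro mult_right_mono) auto
    qed simp
  qed
  also have "\<dots> = (\<integral>\<^sup>+r. (\<integral>\<^sup>+s. epow (f s) p * ennreal (w s powr (1 - p)) * ennreal (v r * A r powr (p - 1) * K r s) \<partial>lborel) \<partial>lborel)"
  proof (intro nn_integral_cong)
    fix r :: real
    have "(ennreal (A r powr (p - 1)) * (\<integral>\<^sup>+s. epow (f s) p * ennreal (K r s * w s powr (1 - p)) \<partial>lborel)) * ennreal (v r)
       = (\<integral>\<^sup>+s. (ennreal (A r powr (p - 1)) * (epow (f s) p * ennreal (K r s * w s powr (1 - p)))) * ennreal (v r) \<partial>lborel)"
      by (simp add: nn_integral_multc nn_integral_cmult)
    also have "\<dots> = (\<integral>\<^sup>+s. epow (f s) p * ennreal (w s powr (1 - p)) * ennreal (v r * A r powr (p - 1) * K r s) \<partial>lborel)"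
      using v0[of r] K0[of r] by (intro nn_integral_cong) (simp add: ennreal_mult mult_ac)
    finally show "(ennreal (A r powr (p - 1)) * (\<integral>\<^sup>+s. epow (f s) p * ennreal (K r s * w s powr (1 - p)) \<partial>lborel)) * ennreal (v r)
      = (\<integral>\<^sup>+s. epow (f s) p * ennreal (w s powr (1 - p)) * ennreal (v r * A r powr (p - 1) * K r s) \<partial>lborel)" .
  qed
  also have "\<dots> = (\<integral>\<^sup>+s. (\<integral>\<^sup>+r. epow (f s) p * ennreal (w s powr (1 - p)) * ennreal (v r * A r powr (p - 1) * K r s) \<partial>lborel) \<partial>lborel)"
    by (rule lborel_pair.Fubini') measurable
  also have "\<dots> = (\<integral>\<^sup>+s. epow (f s) p * ennreal (w s powr (1 - p)) * (\<integral>\<^sup>+r. ennreal (v r * A r powr (p - 1) * K r s) \<partial>lborel) \<partial>lborel)"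
    by (intro nn_integral_cong nn_integral_cmult) measurable
  also have "\<dots> \<le> (\<integral>\<^sup>+s. epow (f s) p * ennreal (D s) \<partial>lborel)"
    by (intro nn_integral_mono D)
  finally show ?thesis .
qed

section \<open>One-dimensional Hardy inequalities\<close>

lemma powr_divide_minus: "(x / y) powr a = x powr a * y powr (- a)" for x y :: real
  by (metis divide_inverse powr_divide powr_minus)

lemma nn_integral_powr:
  fixes a b c :: real
  assumes "0 \<le> a" "a < b" "c \<noteq> 0" "0 < a \<or> 0 < c"
  shows "(\<integral>\<^sup>+r. ennreal (r powr (c - 1)) * indicator {a<..<b} r \<partial>lborel) = ennreal ((b powr c - a powr c) / c)"
proof -
  have "(\<integral>\<^sup>+r. ennreal (r powr (c - 1)) * indicator {a<..<b} r \<partial>lborel) = ennreal (b powr c / c - a powr c / c)"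
  proof (rule nn_integral_FTC_open)
    fix x assume x: "a < x" "x < b"
    then have "0 < x" using assms by auto
    then show "((\<lambda>x. x powr c / c) has_real_derivative x powr (c - 1)) (at x)"
      using assms by (auto intro!: derivative_eq_intros)
    show "isCont (\<lambda>r. r powr (c - 1)) x"
      using \<open>0 < x\<close> by (intro continuous_intros) auto
  next
    show "((\<lambda>x. x powr c / c) \<longlongrightarrow> a powr c / c) (at_right a)"
      using assms by (intro tendsto_intros tendsto_powr')
        (auto simp: eventually_at_filter intro!: exI[of _ "UNIV"] always_eventually)
    show "((\<lambda>x. x powr c / c) \<longlongrightarrow> b powr c / c) (at_left b)"
      using assms by (intro tendsto_intros) auto
  qed (use assms in auto)
  then show ?thesis by (simp add: diff_divide_distrib)
qed

definition tail_kernel :: "real \<Rightarrow> real \<Rightarrow> real \<Rightarrow> real" where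
  "tail_kernel R r s = (if 0 < r \<and> r < s \<and> s < R then 1 else 0)"

definition flux_kernel :: "real \<Rightarrow> real \<Rightarrow> real \<Rightarrow> real \<Rightarrow> real" where
  "flux_kernel n R r s = (if 0 < s \<and> s < r \<and> r < R then (s / r) powr (n - 1) else 0)"

definition power_weight :: "real \<Rightarrow> real \<Rightarrow> real \<Rightarrow> real" where
  "power_weight R a r = (if 0 < r \<and> r < R then r powr a else 0)"

text \<open>The weight of the theorem for a = 1, multiplied by the factor r^(N-1) of polar
  coordinates.\<close>

definition log_weight :: "real \<Rightarrow> real \<Rightarrow> real \<Rightarrow> real" where
  "log_weight R p r = (if 0 < r \<and> r < R then 1 / r * ln (R / r) powr (- p) else 0)"

lemma kernel_measurable [measurable]:
  "case_prod (tail_kernel R) \<in> borel_measurable (borel \<Otimes>\<^sub>M borel)"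
  "case_prod (flux_kernel n R) \<in> borel_measurable (borel \<Otimes>\<^sub>M borel)"
  "power_weight R a \<in> borel_measurable borel"
  "log_weight R a \<in> borel_measurable borel"
  unfolding tail_kernel_def flux_kernel_def power_weight_def log_weight_def by measurable

text \<open>The trial function s^(-j) is the formal extremal: its p-th power times s^(j p - 1) is
  1/s, which just fails to be integrable, and on the half-line the tail operator maps it to
  r^(1-j)/(j-1). Discarding the endpoint term R^(1-j) leaves the clean constant.\<close>

lemma Hardy_tail_step:
  fixes f :: "real \<Rightarrow> ennreal"
  assumes [measurable]: "f \<in> borel_measurable borel" and p: "1 < p" and j: "1 < j"
  shows "(\<integral>\<^sup>+r. epow (kernel_op (tail_kernel R) f r) p * ennreal (power_weight R ((j - 1) * p - 1) r) \<partial>lborel)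
    \<le> (\<integral>\<^sup>+s. epow (f s) p * ennreal (power_weight R (j * p - 1) s / (j - 1) powr p) \<partial>lborel)"
proof (rule Schur_estimate[where w = "\<lambda>s. s powr (- j)" and A = "\<lambda>r. r powr (1 - j) / (j - 1)"])
  fix r assume "power_weight R ((j - 1) * p - 1) r \<noteq> 0"
  then have r: "0 < r" "r < R" by (auto simp: power_weight_def split: if_splits)
  show "0 < r powr (1 - j) / (j - 1)" using r j by auto
  have "(\<integral>\<^sup>+s. ennreal (tail_kernel R r s * s powr - j) \<partial>lborel)
    = (\<integral>\<^sup>+s. ennreal (s powr ((1 - j) - 1)) * indicator {r<..<R} s \<partial>lborel)"
    using r by (intro nn_integral_cong) (auto simp: tail_kernel_def indicator_def)
  also have "\<dots> = ennreal ((R powr (1 - j) - r powr (1 - j)) / (1 - j))"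
    using r j by (intro nn_integral_powr) auto
  also have "\<dots> \<le> ennreal (r powr (1 - j) / (j - 1))"
  proof (rule ennreal_leI)
    have "(R powr (1 - j) - r powr (1 - j)) / (1 - j) = (r powr (1 - j) - R powr (1 - j)) / (j - 1)"
      using j by (simp add: field_simps)
    also have "\<dots> \<le> r powr (1 - j) / (j - 1)" using j by (intro divide_right_mono) auto
    finally show "(R powr (1 - j) - r powr (1 - j)) / (1 - j) \<le> r powr (1 - j) / (j - 1)" .
  qed
  finally show "(\<integral>\<^sup>+s. ennreal (tail_kernel R r s * s powr - j) \<partial>lborel) \<le> ennreal (r powr (1 - j) / (j - 1))" .
next
  fix s
  show "epow (f s) p * ennreal ((s powr - j) powr (1 - p)) *
         (\<integral>\<^sup>+ r. ennreal (power_weight R ((j - 1) * p - 1) r * (r powr (1 - j) / (j - 1)) powr (p - 1) * tail_kernel R r s) \<partial>lborel)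
         \<le> epow (f s) p * ennreal (power_weight R (j * p - 1) s / (j - 1) powr p)"
  proof (cases "0 < s \<and> s < R")
    case True
    have "(\<integral>\<^sup>+ r. ennreal (power_weight R ((j - 1) * p - 1) r * (r powr (1 - j) / (j - 1)) powr (p - 1) * tail_kernel R r s) \<partial>lborel)
       = (\<integral>\<^sup>+ r. ennreal ((j - 1) powr (1 - p)) * (ennreal (r powr ((j - 1) - 1)) * indicator {0<..<s} r) \<partial>lborel)"
    proof (intro nn_integral_cong)
      fix r :: real
      have "r powr ((j - 1) * p - 1) * (r powr (1 - j) / (j - 1)) powr (p - 1) = (j - 1) powr (1 - p) * r powr ((j - 1) - 1)"
        if "0 < r"
      proof -
        have "r powr ((j - 1) * p - 1) * (r powr (1 - j)) powr (p - 1) = r powr ((j - 1) - 1)"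
          using that by (simp add: powr_powr algebra_simps flip: powr_add)
        then show ?thesis using j that by (simp add: powr_divide_minus)
      qed
      then show "ennreal (power_weight R ((j - 1) * p - 1) r * (r powr (1 - j) / (j - 1)) powr (p - 1) * tail_kernel R r s)
        = ennreal ((j - 1) powr (1 - p)) * (ennreal (r powr ((j - 1) - 1)) * indicator {0<..<s} r)"
        using True by (auto simp: power_weight_def tail_kernel_def indicator_def simp flip: ennreal_mult)
    qed
    also have "\<dots> = ennreal ((j - 1) powr (1 - p)) * ennreal ((s powr (j - 1) - 0 powr (j - 1)) / (j - 1))"
      using True j by (subst nn_integral_cmult, measurable) (subst nn_integral_powr, auto)
    also have "ennreal ((s powr - j) powr (1 - p)) * \<dots> = ennreal (power_weight R (j * p - 1) s / (j - 1) powr p)"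
    proof -
      have "(s powr - j) powr (1 - p) * s powr (j - 1) = s powr (j * p - 1)"
        using True by (simp add: powr_powr algebra_simps flip: powr_add)
      moreover have "(j - 1) powr (1 - p) = (j - 1) / (j - 1) powr p" using j by (simp add: powr_diff)
      ultimately show ?thesis using True j by (simp add: power_weight_def flip: ennreal_mult)
    qed
    finally show ?thesis by (simp add: mult.assoc)
  next
    case False
    then have "tail_kernel R r s = 0" for r by (auto simp: tail_kernel_def)
    then show ?thesis by simp
  qed
qed (use p in \<open>auto simp: tail_kernel_def power_weight_def split: if_splits\<close>)

text \<open>Same trial function as in the tail step. Here the integral over s from 0 to r is exact,
  and it is the integral over r from s to R that is cut off; the resulting factor 1 - (s/R)^(n-j) is
  retained because strictness rests on it.\<close>

lemma Hardy_flux_step: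
  fixes f :: "real \<Rightarrow> ennreal"
  assumes [measurable]: "f \<in> borel_measurable borel" and p: "1 < p" and j: "j < n"
  shows "(\<integral>\<^sup>+r. epow (kernel_op (flux_kernel n R) f r) p * ennreal (power_weight R ((j - 1) * p - 1) r) \<partial>lborel)
    \<le> (\<integral>\<^sup>+s. epow (f s) p * ennreal (power_weight R (j * p - 1) s * (1 - (s / R) powr (n - j)) / (n - j) powr p) \<partial>lborel)"
proof (rule Schur_estimate[where w = "\<lambda>s. s powr (- j)" and A = "\<lambda>r. r powr (1 - j) / (n - j)"])
  fix r assume "power_weight R ((j - 1) * p - 1) r \<noteq> 0"
  then have r: "0 < r" "r < R" by (auto simp: power_weight_def split: if_splits)
  show "0 < r powr (1 - j) / (n - j)" using r j by auto
  have "(\<integral>\<^sup>+s. ennreal (flux_kernel n R r s * s powr - j) \<partial>lborel)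
    = (\<integral>\<^sup>+s. ennreal (r powr (1 - n)) * (ennreal (s powr ((n - j) - 1)) * indicator {0<..<r} s) \<partial>lborel)"
  proof (intro nn_integral_cong)
    fix s
    have "(s / r) powr (n - 1) * s powr - j = r powr (1 - n) * s powr ((n - j) - 1)" if "0 < s"
      using that r by (simp add: powr_divide_minus mult_ac flip: powr_add) (simp add: powr_add[symmetric] algebra_simps)
    then show "ennreal (flux_kernel n R r s * s powr - j) = ennreal (r powr (1 - n)) * (ennreal (s powr ((n - j) - 1)) * indicator {0<..<r} s)"
      using r by (auto simp: flux_kernel_def indicator_def simp flip: ennreal_mult)
  qed
  also have "\<dots> = ennreal (r powr (1 - n)) * ennreal ((r powr (n - j) - 0 powr (n - j)) / (n - j))"
    using r j by (subst nn_integral_cmult, measurable) (subst nn_integral_powr, auto)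
  also have "\<dots> = ennreal (r powr (1 - j) / (n - j))"
    using r j by (simp flip: ennreal_mult powr_add)
  finally show "(\<integral>\<^sup>+s. ennreal (flux_kernel n R r s * s powr - j) \<partial>lborel) \<le> ennreal (r powr (1 - j) / (n - j))"
    by simp
next
  fix s
  show "epow (f s) p * ennreal ((s powr - j) powr (1 - p)) *
         (\<integral>\<^sup>+ r. ennreal (power_weight R ((j - 1) * p - 1) r * (r powr (1 - j) / (n - j)) powr (p - 1) * flux_kernel n R r s) \<partial>lborel)
         \<le> epow (f s) p * ennreal (power_weight R (j * p - 1) s * (1 - (s / R) powr (n - j)) / (n - j) powr p)"
  proof (cases "0 < s \<and> s < R")
    case True
    have "(\<integral>\<^sup>+ r. ennreal (power_weight R ((j - 1) * p - 1) r * (r powr (1 - j) / (n - j)) powr (p - 1) * flux_kernel n R r s) \<partial>lborel)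
       = (\<integral>\<^sup>+ r. ennreal ((n - j) powr (1 - p) * s powr (n - 1)) * (ennreal (r powr ((j - n) - 1)) * indicator {s<..<R} r) \<partial>lborel)"
    proof (intro nn_integral_cong)
      fix r :: real
      have "r powr ((j - 1) * p - 1) * (r powr (1 - j) / (n - j)) powr (p - 1) * (s / r) powr (n - 1)
          = (n - j) powr (1 - p) * s powr (n - 1) * r powr ((j - n) - 1)"
        if "0 < r"
      proof -
        have "r powr ((j - 1) * p - 1) * (r powr (1 - j)) powr (p - 1) * r powr (1 - n) = r powr ((j - n) - 1)"
          using that by (simp add: powr_powr algebra_simps flip: powr_add)
        moreover have "(s / r) powr (n - 1) = s powr (n - 1) * r powr (1 - n)"
          using that True j by (simp add: powr_divide_minus)
        moreover have "(r powr (1 - j) / (n - j)) powr (p - 1) = (r powr (1 - j)) powr (p - 1) * (n - j) powr (1 - p)"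
          using that True j by (simp add: powr_divide_minus)
        ultimately show ?thesis by (simp add: mult_ac)
      qed
      then show "ennreal (power_weight R ((j - 1) * p - 1) r * (r powr (1 - j) / (n - j)) powr (p - 1) * flux_kernel n R r s)
        = ennreal ((n - j) powr (1 - p) * s powr (n - 1)) * (ennreal (r powr ((j - n) - 1)) * indicator {s<..<R} r)"
        using True by (auto simp: power_weight_def flux_kernel_def indicator_def simp flip: ennreal_mult)
    qed
    also have "\<dots> = ennreal ((n - j) powr (1 - p) * s powr (n - 1)) * ennreal ((R powr (j - n) - s powr (j - n)) / (j - n))"
      using True j by (subst nn_integral_cmult, measurable) (subst nn_integral_powr, auto)
    also have "ennreal ((s powr - j) powr (1 - p)) * \<dots> = ennreal (power_weight R (j * p - 1) s * (1 - (s / R) powr (n - j)) / (n - j) powr p)"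
    proof -
      have "(s powr - j) powr (1 - p) * s powr (n - 1) * s powr (j - n) = s powr (j * p - 1)"
        using True by (simp add: powr_powr algebra_simps flip: powr_add)
      moreover have "R powr (j - n) = s powr (j - n) * (s / R) powr (n - j)"
        using True by (simp add: powr_divide powr_diff field_simps)
      moreover have "(n - j) powr (1 - p) = (n - j) / (n - j) powr p" using j by (simp add: powr_diff)
      moreover have "(R powr (j - n) - s powr (j - n)) / (j - n) \<ge> 0"
        using True j by (intro divide_nonpos_nonpos) (auto intro!: powr_mono2')
      moreover have "(R powr (j - n) - s powr (j - n)) / (j - n) = s powr (j - n) * (1 - (s / R) powr (n - j)) / (n - j)"
      proof -
        have "j - n \<noteq> 0" "n - j \<noteq> 0" using j by auto
        then show ?thesis unfolding calculation(2) by (simp add: divide_simps) (simp add: algebra_simps)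
      qed
      ultimately have "(s powr - j) powr (1 - p) * ((n - j) powr (1 - p) * s powr (n - 1) * ((R powr (j - n) - s powr (j - n)) / (j - n)))
          = s powr (j * p - 1) * (1 - (s / R) powr (n - j)) / (n - j) powr p"
        and "(R powr (j - n) - s powr (j - n)) / (j - n) \<ge> 0"
        using j by simp_all
      then show ?thesis using True
        by (simp add: power_weight_def del: times_divide_eq_right times_divide_eq_left flip: ennreal_mult)
    qed
    finally show ?thesis by (simp add: mult.assoc)
  next
    case False
    then have "flux_kernel n R r s = 0" for r by (auto simp: flux_kernel_def)
    then show ?thesis by simp
  qed
qed (use p in \<open>auto simp: flux_kernel_def power_weight_def split: if_splits\<close>)

text \<open>At order 1 the trial function 1/s fails, since the integral over r would diverge at 0.
  The correction by ln(R/s)^(-1/p) repairs this: in the variable t = ln(R/s) it is the trial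
  function t^(-1/p) of the classical Hardy inequality on the half-line.\<close>

lemma Hardy_log_step:
  fixes f :: "real \<Rightarrow> ennreal"
  assumes [measurable]: "f \<in> borel_measurable borel" and p: "1 < p"
  shows "(\<integral>\<^sup>+r. epow (kernel_op (tail_kernel R) f r) p * ennreal (log_weight R p r) \<partial>lborel)
    \<le> (\<integral>\<^sup>+s. epow (f s) p * ennreal (power_weight R (p - 1) s / (1 - 1 / p) powr p) \<partial>lborel)"
proof (rule Schur_estimate[where w = "\<lambda>s. 1 / s * ln (R / s) powr (- (1 / p))" and A = "\<lambda>r. ln (R / r) powr (1 - 1 / p) / (1 - 1 / p)"])
  have c: "0 < 1 - 1 / p" using p by simp
  have dln: "((\<lambda>s. ln (R / s) powr e) has_real_derivative - (e * ln (R / s) powr (e - 1) / s)) (at s)"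
    if "0 < s" "s < R" for s e
    using that by (auto intro!: derivative_eq_intros simp: field_simps)
  have lim: "((\<lambda>s. ln (R / s) powr - e / e) \<longlongrightarrow> 0) (at_right 0)" if "0 < e" "0 < R" for e R :: real
    using that by real_asymp
  have alg: "- (- e * a / r) / e = 1 / r * a" if "0 < e" for e a r :: real
    using that by simp
  have cont: "isCont (\<lambda>s. 1 / s * ln (R / s) powr e) s" if "0 < s" "s < R" for s e
    using that by (intro continuous_intros) auto
  {
    fix r assume "log_weight R p r \<noteq> 0"
    then have r: "0 < r" "r < R" by (auto simp: log_weight_def split: if_splits)
    then have "0 < ln (R / r)" by simp
    then show "0 < ln (R / r) powr (1 - 1 / p) / (1 - 1 / p)" using c by simp
    have "(\<integral>\<^sup>+s. ennreal (tail_kernel R r s * (1 / s * ln (R / s) powr (- (1 / p)))) \<partial>lborel)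
      = (\<integral>\<^sup>+s. ennreal (1 / s * ln (R / s) powr (- (1 / p))) * indicator {r<..<R} s \<partial>lborel)"
      using r by (intro nn_integral_cong) (auto simp: tail_kernel_def indicator_def)
    also have "\<dots> = ennreal (0 - (- (ln (R / r) powr (1 - 1 / p) / (1 - 1 / p))))"
    proof (rule nn_integral_FTC_open)
      fix s assume "r < s" "s < R"
      then show "((\<lambda>s. - (ln (R / s) powr (1 - 1 / p) / (1 - 1 / p))) has_real_derivative 1 / s * ln (R / s) powr (- (1 / p))) (at s)"
        using dln[of s "1 - 1 / p"] c r
        by (auto intro!: derivative_eq_intros)
    next
      have "((\<lambda>s. - (ln (R / s) powr (1 - 1 / p) / (1 - 1 / p))) \<longlongrightarrow> - (ln (R / R) powr (1 - 1 / p) / (1 - 1 / p))) (at_left R)"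
        using r c by (intro tendsto_intros tendsto_powr')
         (auto intro!: tendsto_eq_intros eventually_at_leftI[of 0] simp: field_simps)
      then show "((\<lambda>s. - (ln (R / s) powr (1 - 1 / p) / (1 - 1 / p))) \<longlongrightarrow> 0) (at_left R)" using r by simp
      show "((\<lambda>s. - (ln (R / s) powr (1 - 1 / p) / (1 - 1 / p))) \<longlongrightarrow> - (ln (R / r) powr (1 - 1 / p) / (1 - 1 / p))) (at_right r)"
        using r c by (intro tendsto_intros) auto
    qed (use r cont in auto)
    finally show "(\<integral>\<^sup>+s. ennreal (tail_kernel R r s * (1 / s * ln (R / s) powr (- (1 / p)))) \<partial>lborel)
      \<le> ennreal (ln (R / r) powr (1 - 1 / p) / (1 - 1 / p))" by simp
  }
  fix s
  show "epow (f s) p * ennreal ((1 / s * ln (R / s) powr (- (1 / p))) powr (1 - p)) *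
         (\<integral>\<^sup>+ r. ennreal (log_weight R p r * (ln (R / r) powr (1 - 1 / p) / (1 - 1 / p)) powr (p - 1) * tail_kernel R r s) \<partial>lborel)
         \<le> epow (f s) p * ennreal (power_weight R (p - 1) s / (1 - 1 / p) powr p)"
  proof (cases "0 < s \<and> s < R")
    case True
    then have ls: "0 < ln (R / s)" by simp
    have "(\<integral>\<^sup>+ r. ennreal (log_weight R p r * (ln (R / r) powr (1 - 1 / p) / (1 - 1 / p)) powr (p - 1) * tail_kernel R r s) \<partial>lborel)
       = (\<integral>\<^sup>+ r. ennreal ((1 - 1 / p) powr (1 - p)) * (ennreal (1 / r * ln (R / r) powr (- (1 - 1 / p) - 1)) * indicator {0<..<s} r) \<partial>lborel)"
    proof (intro nn_integral_cong)
      fix r :: real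
      have "1 / r * ln (R / r) powr (- p) * (ln (R / r) powr (1 - 1 / p) / (1 - 1 / p)) powr (p - 1)
          = (1 - 1 / p) powr (1 - p) * (1 / r * ln (R / r) powr (- (1 - 1 / p) - 1))"
        if "0 < r" "r < s"
      proof -
        have l: "0 < ln (R / r)" using that True by simp
        have "- p + (1 - 1 / p) * (p - 1) = - (1 - 1 / p) - 1" using p by (simp add: field_simps)
        then have "ln (R / r) powr (- p) * (ln (R / r) powr (1 - 1 / p)) powr (p - 1) = ln (R / r) powr (- (1 - 1 / p) - 1)"
          using l by (simp only: powr_powr flip: powr_add)
        moreover have "(ln (R / r) powr (1 - 1 / p) / (1 - 1 / p)) powr (p - 1) = (ln (R / r) powr (1 - 1 / p)) powr (p - 1) * (1 - 1 / p) powr (1 - p)"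
        proof -
          show ?thesis using c l powr_divide_minus[of _ "1 - 1 / p" "p - 1"] by simp
        qed
        ultimately show ?thesis by (simp add: mult_ac)
      qed
      then show "ennreal (log_weight R p r * (ln (R / r) powr (1 - 1 / p) / (1 - 1 / p)) powr (p - 1) * tail_kernel R r s)
        = ennreal ((1 - 1 / p) powr (1 - p)) * (ennreal (1 / r * ln (R / r) powr (- (1 - 1 / p) - 1)) * indicator {0<..<s} r)"
        using True by (auto simp: log_weight_def tail_kernel_def indicator_def simp flip: ennreal_mult)
    qed
    also have "\<dots> = ennreal ((1 - 1 / p) powr (1 - p)) *
        (\<integral>\<^sup>+ r. (ennreal (1 / r * ln (R / r) powr (- (1 - 1 / p) - 1)) * indicator {0<..<s} r) \<partial>lborel)"
      by (intro nn_integral_cmult) measurable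
    also have "(\<integral>\<^sup>+ r. (ennreal (1 / r * ln (R / r) powr (- (1 - 1 / p) - 1)) * indicator {0<..<s} r) \<partial>lborel)
        = ennreal (ln (R / s) powr (- (1 - 1 / p)) / (1 - 1 / p) - 0)"
    proof (rule nn_integral_FTC_open)
      fix r assume r: "0 < r" "r < s"
      then show "((\<lambda>s. ln (R / s) powr (- (1 - 1 / p)) / (1 - 1 / p)) has_real_derivative 1 / r * ln (R / r) powr (- (1 - 1 / p) - 1)) (at r)"
        using DERIV_cdivide[OF dln[of r "- (1 - 1 / p)"], of "1 - 1 / p"] c True
          alg[of "1 - 1 / p" "ln (R / r) powr (- (1 - 1 / p) - 1)" r] by (auto simp del: divide_divide_eq_left minus_diff_eq)
    next
      have "0 < R" using True by simp
      show "((\<lambda>s. ln (R / s) powr (- (1 - 1 / p)) / (1 - 1 / p)) \<longlongrightarrow> 0) (at_right 0)"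
        using lim[OF c \<open>0 < R\<close>] .
      show "((\<lambda>s. ln (R / s) powr (- (1 - 1 / p)) / (1 - 1 / p)) \<longlongrightarrow> ln (R / s) powr (- (1 - 1 / p)) / (1 - 1 / p)) (at_left s)"
        using True ls c by (intro tendsto_intros) auto
    qed (use True cont in auto)
    also have "ennreal ((1 / s * ln (R / s) powr (- (1 / p))) powr (1 - p)) *
        (ennreal ((1 - 1 / p) powr (1 - p)) * ennreal (ln (R / s) powr (- (1 - 1 / p)) / (1 - 1 / p) - 0))
       = ennreal (power_weight R (p - 1) s / (1 - 1 / p) powr p)"
    proof -
      have "(1 / s * ln (R / s) powr (- (1 / p))) powr (1 - p) = s powr (p - 1) * ln (R / s) powr (1 - 1 / p)"
      proof -
        have "(1 / s) powr (1 - p) = s powr (p - 1)" using True by (simp add: powr_divide powr_diff)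
        moreover have "(ln (R / s) powr (- (1 / p))) powr (1 - p) = ln (R / s) powr (1 - 1 / p)"
        proof -
          have "- (1 / p) * (1 - p) = 1 - 1 / p" using p by (simp add: field_simps)
          then show ?thesis by (simp only: powr_powr)
        qed
        ultimately show ?thesis using True ls by (subst powr_mult) auto
      qed
      moreover have "ln (R / s) powr (1 - 1 / p) * ln (R / s) powr (- (1 - 1 / p)) = 1"
        using ls by (simp flip: powr_add)
      moreover have "(1 - 1 / p) powr (1 - p) = (1 - 1 / p) / (1 - 1 / p) powr p" using c by (simp add: powr_diff)
      ultimately show ?thesis using True c by (simp add: power_weight_def mult_ac flip: ennreal_mult)
    qed
    finally show ?thesis by (simp add: mult.assoc)
  next
    case False
    then have "tail_kernel R r s = 0" for r by (auto simp: tail_kernel_def)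
    then show ?thesis by simp
  qed
qed (use p in \<open>auto simp: tail_kernel_def log_weight_def split: if_splits\<close>)

section \<open>Composition of the Hardy steps\<close>

text \<open>The index is the order of the derivative being undone: even orders come from a
  divergence and are inverted by the flux, odd orders from a gradient and are inverted by the
  tail.\<close>

definition step_op :: "real \<Rightarrow> real \<Rightarrow> nat \<Rightarrow> (real \<Rightarrow> ennreal) \<Rightarrow> real \<Rightarrow> ennreal" where
  "step_op n R j = kernel_op (if even j then flux_kernel n R else tail_kernel R)"

text \<open>The highest order is undone first, so \<open>chain n R k\<close> leads from the k-th
  gradient back to the function. Inductions over k therefore keep the argument arbitrary.\<close>

fun chain :: "real \<Rightarrow> real \<Rightarrow> nat \<Rightarrow> (real \<Rightarrow> ennreal) \<Rightarrow> real \<Rightarrow> ennreal" where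
  "chain n R 0 f = f"
| "chain n R (Suc j) f = chain n R j (step_op n R (Suc j) f)"

lemma step_op_measurable [measurable]:
  "f \<in> borel_measurable borel \<Longrightarrow> step_op n R j f \<in> borel_measurable borel"
  by (simp add: step_op_def)

lemma chain_measurable [measurable]:
  "f \<in> borel_measurable borel \<Longrightarrow> chain n R j f \<in> borel_measurable borel"
  by (induction j arbitrary: f) simp_all

definition power_energy :: "real \<Rightarrow> real \<Rightarrow> nat \<Rightarrow> (real \<Rightarrow> ennreal) \<Rightarrow> ennreal" where
  "power_energy p R j f = (\<integral>\<^sup>+s. epow (f s) p * ennreal (power_weight R (real j * p - 1) s) \<partial>lborel)"

definition log_energy :: "real \<Rightarrow> real \<Rightarrow> (real \<Rightarrow> ennreal) \<Rightarrow> ennreal" where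
  "log_energy p R f = (\<integral>\<^sup>+r. epow (f r) p * ennreal (log_weight R p r) \<partial>lborel)"

definition step_const :: "real \<Rightarrow> nat \<Rightarrow> real" where
  "step_const n j = (if even j then n - real j else real j - 1)"

text \<open>The step of order 1 is the logarithmic one and contributes 1 - 1/p, hence the product
  over the other steps starts at 2. The p-th power is the constant K, by
  \<open>rellich_const_eq\<close>.\<close>

definition Hardy_const :: "real \<Rightarrow> real \<Rightarrow> nat \<Rightarrow> real" where
  "Hardy_const n p k = (1 - 1 / p) * (\<Prod>j=2..k. step_const n j)"

lemma power_energy_step:
  assumes [measurable]: "f \<in> borel_measurable borel" and p: "1 < p" and k: "1 \<le> k" "real (Suc k) < n" "0 < R"
  shows "power_energy p R k (step_op n R (Suc k) f)
    \<le> ennreal (1 / step_const n (Suc k) powr p) * power_energy p R (Suc k) f"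
proof (cases "even (Suc k)")
  case True
  have "power_energy p R k (step_op n R (Suc k) f)
    \<le> (\<integral>\<^sup>+s. epow (f s) p * ennreal (power_weight R (real (Suc k) * p - 1) s * (1 - (s / R) powr (n - real (Suc k))) / (n - real (Suc k)) powr p) \<partial>lborel)"
    using Hardy_flux_step[of f p "real (Suc k)" n R] True p k by (simp add: power_energy_def step_op_def)
  also have "\<dots> \<le> (\<integral>\<^sup>+s. ennreal (1 / step_const n (Suc k) powr p) * (epow (f s) p * ennreal (power_weight R (real (Suc k) * p - 1) s)) \<partial>lborel)"
  proof (intro nn_integral_mono)
    fix s :: real
    have "power_weight R (real (Suc k) * p - 1) s * (1 - (s / R) powr (n - real (Suc k))) / (n - real (Suc k)) powr p
       \<le> power_weight R (real (Suc k) * p - 1) s * 1 / (n - real (Suc k)) powr p"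
      by (intro divide_right_mono mult_left_mono) (auto simp: power_weight_def)
    then have "ennreal (power_weight R (real (Suc k) * p - 1) s * (1 - (s / R) powr (n - real (Suc k))) / (n - real (Suc k)) powr p)
      \<le> ennreal (1 / step_const n (Suc k) powr p) * ennreal (power_weight R (real (Suc k) * p - 1) s)"
      using True by (subst ennreal_mult[symmetric]) (auto simp: step_const_def power_weight_def intro!: ennreal_leI)
    from mult_left_mono[OF this, of "epow (f s) p"]
    show "epow (f s) p * ennreal (power_weight R (real (Suc k) * p - 1) s * (1 - (s / R) powr (n - real (Suc k))) / (n - real (Suc k)) powr p)
      \<le> ennreal (1 / step_const n (Suc k) powr p) * (epow (f s) p * ennreal (power_weight R (real (Suc k) * p - 1) s))"
      by (simp add: mult.left_commute)
  qed
  finally show ?thesis by (simp add: nn_integral_cmult power_energy_def)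
next
  case False
  have "power_energy p R k (step_op n R (Suc k) f)
    \<le> (\<integral>\<^sup>+s. epow (f s) p * ennreal (power_weight R (real (Suc k) * p - 1) s / (real (Suc k) - 1) powr p) \<partial>lborel)"
    using Hardy_tail_step[of f p "real (Suc k)" R] False p k by (simp add: power_energy_def step_op_def)
  also have "\<dots> = (\<integral>\<^sup>+s. ennreal (1 / step_const n (Suc k) powr p) * (epow (f s) p * ennreal (power_weight R (real (Suc k) * p - 1) s)) \<partial>lborel)"
  proof (intro nn_integral_cong)
    fix s :: real
    have "ennreal (power_weight R (real (Suc k) * p - 1) s / (real (Suc k) - 1) powr p)
      = ennreal (1 / step_const n (Suc k) powr p) * ennreal (power_weight R (real (Suc k) * p - 1) s)"
      using False by (subst ennreal_mult[symmetric]) (auto simp: step_const_def power_weight_def)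
    then show "epow (f s) p * ennreal (power_weight R (real (Suc k) * p - 1) s / (real (Suc k) - 1) powr p)
      = ennreal (1 / step_const n (Suc k) powr p) * (epow (f s) p * ennreal (power_weight R (real (Suc k) * p - 1) s))"
      by (simp add: mult_ac)
  qed
  finally show ?thesis by (simp add: nn_integral_cmult power_energy_def)
qed

text \<open>The strict inequality comes from the flux step at order 2: on a bounded interval its
  constant is only approached, by the factor \<open>1 - (s / R) powr (n - 2)\<close>.\<close>

lemma power_energy_step_strict:
  assumes [measurable]: "f \<in> borel_measurable borel" and p: "1 < p" and n: "2 < n" "0 < R"
    and fin: "power_energy p R 2 f < \<infinity>" "power_energy p R 2 f \<noteq> 0"
  shows "power_energy p R 1 (step_op n R 2 f) < ennreal (1 / step_const n 2 powr p) * power_energy p R 2 f"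
proof -
  define a where "a s = epow (f s) p * ennreal (power_weight R (2 * p - 1) s * (1 - (s / R) powr (n - 2)) / (n - 2) powr p)" for s
  define b where "b s = epow (f s) p * ennreal (power_weight R (2 * p - 1) s / (n - 2) powr p)" for s
  have [measurable]: "a \<in> borel_measurable lborel" "b \<in> borel_measurable lborel"
    unfolding a_def b_def by measurable
  have B: "(\<integral>\<^sup>+s. b s \<partial>lborel) = ennreal (1 / step_const n 2 powr p) * power_energy p R 2 f"
    unfolding power_energy_def
    by (subst nn_integral_cmult[symmetric], measurable)
       (auto simp: b_def step_const_def power_weight_def mult_ac divide_inverse ennreal_mult intro!: nn_integral_cong)
  have le: "a s \<le> b s" for s
  proof -
    have "power_weight R (2 * p - 1) s * (1 - (s / R) powr (n - 2)) / (n - 2) powr p \<le> power_weight R (2 * p - 1) s * 1 / (n - 2) powr p"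
      by (intro divide_right_mono mult_left_mono) (auto simp: power_weight_def)
    then show ?thesis unfolding a_def b_def by (intro mult_left_mono ennreal_leI) auto
  qed
  have finB: "(\<integral>\<^sup>+s. b s \<partial>lborel) < \<infinity>" unfolding B using fin by (simp add: ennreal_mult_less_top)
  have "(\<integral>\<^sup>+s. a s \<partial>lborel) < (\<integral>\<^sup>+s. b s \<partial>lborel)"
  proof (rule nn_integral_less)
    show "(\<integral>\<^sup>+s. a s \<partial>lborel) \<noteq> \<infinity>"
      using nn_integral_mono[of lborel a b] le finB by (metis infinity_ennreal_def leD)
    show "\<not> (AE s in lborel. b s \<le> a s)"
    proof
      assume "AE s in lborel. b s \<le> a s"
      moreover have "AE s in lborel. b s < \<infinity>"
        using finB nn_integral_PInf_AE[of b lborel] by (auto simp: less_top)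
      \<comment> \<open>Where \<open>b s\<close> is finite and nonzero, the factor 1 - (s/R)^(n-2)
        is strictly below 1 and \<open>a s < b s\<close>; so \<open>b s \<le> a s\<close> leaves
        only \<open>b s = 0\<close>.\<close>
      ultimately have "AE s in lborel. b s = 0"
      proof eventually_elim
        case (elim s)
        show ?case
        proof (rule ccontr)
          assume b0: "b s \<noteq> 0"
          then have s: "0 < s" "s < R" and f0: "epow (f s) p \<noteq> 0" by (auto simp: b_def power_weight_def split: if_splits)
          have f1: "epow (f s) p \<noteq> \<infinity>" using elim b0 by (auto simp: b_def ennreal_mult_eq_top_iff)
          then obtain e where e: "epow (f s) p = ennreal e" "0 < e"
            using f0 by (cases "epow (f s) p") (auto simp: less_le)
          have "0 < (s / R) powr (n - 2)" using s by simp
          then have "power_weight R (2 * p - 1) s * (1 - (s / R) powr (n - 2)) / (n - 2) powr p < power_weight R (2 * p - 1) s * 1 / (n - 2) powr p"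
            using s n by (intro divide_strict_right_mono mult_strict_left_mono) (auto simp: power_weight_def)
          from mult_strict_left_mono[OF this e(2)] have "a s < b s" using e s n
            by (auto simp: a_def b_def power_weight_def ennreal_mult[symmetric] powr_le1 intro!: ennreal_lessI)
          then show False using elim by auto
        qed
      qed
      then have "(\<integral>\<^sup>+s. b s \<partial>lborel) = 0" by (subst nn_integral_0_iff_AE) auto
      then show False using fin n unfolding B by (auto simp: step_const_def)
    qed
  qed (use le in auto)
  moreover have "power_energy p R 1 (step_op n R 2 f) \<le> (\<integral>\<^sup>+s. a s \<partial>lborel)"
    using Hardy_flux_step[of f p 2 n R] p n by (simp add: power_energy_def step_op_def a_def)
  ultimately show ?thesis unfolding B by simp
qed

lemma step_const_pos: "2 \<le> j \<Longrightarrow> real j < n \<Longrightarrow> 0 < step_const n j"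
  by (auto simp: step_const_def)

lemma Hardy_const_pos: "1 < p \<Longrightarrow> real k < n \<Longrightarrow> 0 < Hardy_const n p k"
  unfolding Hardy_const_def by (intro mult_pos_pos prod_pos) (auto intro!: step_const_pos)

lemma Hardy_const_Suc:
  "1 \<le> k \<Longrightarrow> Hardy_const n p (Suc k) = Hardy_const n p k * step_const n (Suc k)"
  by (simp add: Hardy_const_def)

lemma log_energy_chain:
  assumes "f \<in> borel_measurable borel" "1 < p" "1 \<le> k" "real k < n" "0 < R"
  shows "log_energy p R (chain n R k f) \<le> ennreal (1 / Hardy_const n p k powr p) * power_energy p R k f"
  using assms(3,1,4)
proof (induction k arbitrary: f rule: dec_induct)
  case base
  note [measurable] = base(1)
  have "log_energy p R (chain n R 1 f) \<le> (\<integral>\<^sup>+s. epow (f s) p * ennreal (power_weight R (p - 1) s / (1 - 1 / p) powr p) \<partial>lborel)"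
    using Hardy_log_step[of f p R] assms by (simp add: log_energy_def step_op_def)
  also have "\<dots> = ennreal (1 / Hardy_const n p 1 powr p) * power_energy p R 1 f"
    unfolding power_energy_def
    by (subst nn_integral_cmult[symmetric], measurable)
       (auto simp: Hardy_const_def power_weight_def mult_ac divide_inverse ennreal_mult intro!: nn_integral_cong)
  finally show ?case .
next
  case (step k)
  have "log_energy p R (chain n R (Suc k) f) \<le> ennreal (1 / Hardy_const n p k powr p) * power_energy p R k (step_op n R (Suc k) f)"
    using step by simp
  also have "\<dots> \<le> ennreal (1 / Hardy_const n p k powr p) * (ennreal (1 / step_const n (Suc k) powr p) * power_energy p R (Suc k) f)"
    using step assms by (intro mult_left_mono power_energy_step) auto
  also have "\<dots> = ennreal (1 / Hardy_const n p (Suc k) powr p) * power_energy p R (Suc k) f"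
    using step Hardy_const_pos[of p k n] step_const_pos[of "Suc k" n] assms
    by (simp add: Hardy_const_Suc powr_mult mult.assoc[symmetric] flip: ennreal_mult)
  finally show ?case .
qed

text \<open>The strict step is the one of order 2, reached after the higher orders have been
  estimated. An intermediate energy may vanish although the top one does not; then the left side is
  0 and the right side positive. Otherwise the induction hypothesis applies.\<close>

lemma log_energy_chain_strict:
  assumes "f \<in> borel_measurable borel" "1 < p" "2 \<le> k" "real k < n" "0 < R"
    and "power_energy p R k f < \<infinity>" "power_energy p R k f \<noteq> 0"
  shows "log_energy p R (chain n R k f) < ennreal (1 / Hardy_const n p k powr p) * power_energy p R k f"
  using assms(3,1,4,6,7)
proof (induction k arbitrary: f rule: dec_induct)
  case base
  have "log_energy p R (chain n R 2 f) = log_energy p R (chain n R 1 (step_op n R 2 f))"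
    by (simp add: numeral_2_eq_2)
  also have "\<dots> \<le> ennreal (1 / Hardy_const n p 1 powr p) * power_energy p R 1 (step_op n R 2 f)"
    using base assms by (intro log_energy_chain) auto
  also have "\<dots> < ennreal (1 / Hardy_const n p 1 powr p) * (ennreal (1 / step_const n 2 powr p) * power_energy p R 2 f)"
    using base assms Hardy_const_pos[of p 1 n] by (intro ennreal_mult_strict_left_mono power_energy_step_strict) auto
  also have "\<dots> = ennreal (1 / Hardy_const n p 2 powr p) * power_energy p R 2 f"
    using base Hardy_const_pos[of p 1 n] step_const_pos[of 2 n] assms Hardy_const_Suc[of 1 n p]
    by (simp add: numeral_2_eq_2 powr_mult mult.assoc[symmetric] flip: ennreal_mult)
  finally show ?case .
next
  case (step k)
  let ?f = "step_op n R (Suc k) f"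
  have le: "power_energy p R k ?f \<le> ennreal (1 / step_const n (Suc k) powr p) * power_energy p R (Suc k) f"
    using step assms by (intro power_energy_step) auto
  have eq: "ennreal (1 / Hardy_const n p k powr p) * (ennreal (1 / step_const n (Suc k) powr p) * power_energy p R (Suc k) f)
    = ennreal (1 / Hardy_const n p (Suc k) powr p) * power_energy p R (Suc k) f"
    using step Hardy_const_pos[of p k n] step_const_pos[of "Suc k" n] assms
    by (simp add: Hardy_const_Suc powr_mult mult.assoc[symmetric] flip: ennreal_mult)
  have fin: "power_energy p R k ?f < \<infinity>"
    using le step by (auto simp: ennreal_mult_less_top intro: le_less_trans)
  show ?case
  proof (cases "power_energy p R k ?f = 0")
    case True
    have "log_energy p R (chain n R (Suc k) f) \<le> ennreal (1 / Hardy_const n p k powr p) * power_energy p R k ?f"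
      using step assms log_energy_chain[of ?f p k n R] by simp
    also have "\<dots> = 0" using True by simp
    also have "0 < ennreal (1 / Hardy_const n p (Suc k) powr p) * power_energy p R (Suc k) f"
      using step Hardy_const_pos[of p "Suc k" n] assms by (auto simp: zero_less_iff_neq_zero)
    finally show ?thesis .
  next
    case False
    then have "log_energy p R (chain n R (Suc k) f) < ennreal (1 / Hardy_const n p k powr p) * power_energy p R k ?f"
      using step fin by simp
    also have "\<dots> \<le> ennreal (1 / Hardy_const n p k powr p) * (ennreal (1 / step_const n (Suc k) powr p) * power_energy p R (Suc k) f)"
      using le by (intro mult_left_mono) auto
    finally show ?thesis unfolding eq .
  qed
qed

section \<open>Smooth functions and integration by parts\<close>

lemma pderiv_at_eq: "(f has_derivative f') (at x) \<Longrightarrow> pderiv_at i f x = f' (axis i 1)"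
  unfolding pderiv_at_def using frechet_derivative_at by metis

lemma smooth_differentiable: "smooth f \<Longrightarrow> f differentiable (at x)"
  unfolding smooth_def by (metis UNIV_I differentiable_on_def foldr.simps(1) id_apply)

lemma smooth_pderiv_at: assumes "smooth f" shows "smooth (pderiv_at i f)"
proof -
  have "foldr pderiv_at is (pderiv_at i f) = foldr pderiv_at (is @ [i]) f" for "is" by simp
  then show ?thesis using assms unfolding smooth_def by metis
qed

lemma smooth_continuous: "smooth f \<Longrightarrow> continuous_on UNIV f"
  by (meson continuous_at_imp_continuous_on differentiable_imp_continuous_within smooth_differentiable)

text \<open>Smoothness is reduced to exhibiting an invariant class, so that lists of derivatives
  need not be handled again.\<close>

lemma smooth_coinduct:
  assumes "f \<in> S" and "\<And>f i. f \<in> S \<Longrightarrow> pderiv_at i f \<in> S"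
    and "\<And>f x. f \<in> S \<Longrightarrow> f differentiable (at x)"
  shows "smooth f"
proof -
  have "foldr pderiv_at is f \<in> S" for "is" by (induction "is") (use assms in auto)
  then show ?thesis unfolding smooth_def differentiable_on_def
    using assms(3) differentiable_at_withinI by blast
qed

lemma pderiv_at_add:
  assumes "f differentiable (at x)" "g differentiable (at x)"
  shows "pderiv_at i (\<lambda>x. f x + g x) x = pderiv_at i f x + pderiv_at i g x"
proof -
  obtain f' g' where "(f has_derivative f') (at x)" "(g has_derivative g') (at x)"
    using assms unfolding differentiable_def by blast
  then show ?thesis using pderiv_at_eq[of f f' x i] pderiv_at_eq[of g g' x i]
      pderiv_at_eq[OF has_derivative_add[of f f' "at x" g g'], of i] by simp
qed

lemma pderiv_at_mult:
  assumes "f differentiable (at x)" "g differentiable (at x)"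
  shows "pderiv_at i (\<lambda>x. f x * g x) x = f x * pderiv_at i g x + pderiv_at i f x * g x"
proof -
  obtain f' g' where "(f has_derivative f') (at x)" "(g has_derivative g') (at x)"
    using assms unfolding differentiable_def by blast
  then show ?thesis using pderiv_at_eq[of f f' x i] pderiv_at_eq[of g g' x i]
      pderiv_at_eq[OF has_derivative_mult[of f f' x UNIV g g'], of i] by simp
qed

lemma smooth_add:
  fixes f g :: "real ^ 'n \<Rightarrow> real"
  assumes "smooth f" "smooth g"
  shows "smooth (\<lambda>x. f x + g x)"
proof (rule smooth_coinduct[where S = "{\<lambda>x. f x + g x | f g. smooth f \<and> smooth g}"])
  fix h :: "real ^ 'n \<Rightarrow> real" and i :: 'n assume "h \<in> {\<lambda>x. f x + g x | f g. smooth f \<and> smooth g}"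
  then obtain f g where h: "h = (\<lambda>x. f x + g x)" "smooth f" "smooth g" by blast
  then have "pderiv_at i h = (\<lambda>x. pderiv_at i f x + pderiv_at i g x)"
    using pderiv_at_add smooth_differentiable by blast
  then show "pderiv_at i h \<in> {\<lambda>x. f x + g x | f g. smooth f \<and> smooth g}"
    using h smooth_pderiv_at by blast
qed (use assms smooth_differentiable in \<open>auto intro!: differentiable_add\<close>)

lemma smooth_zero: "smooth (\<lambda>x. 0)"
  by (rule smooth_coinduct[where S = "{\<lambda>x. 0}"]) (auto simp: pderiv_at_def)

lemma smooth_sum: "finite A \<Longrightarrow> (\<And>a. a \<in> A \<Longrightarrow> smooth (f a)) \<Longrightarrow> smooth (\<lambda>x. \<Sum>a\<in>A. f a x)"
  by (induction A rule: finite_induct) (auto intro: smooth_zero smooth_add)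

lemma smooth_laplacian: "smooth f \<Longrightarrow> smooth (laplacian f)"
  unfolding laplacian_def[abs_def] by (intro smooth_sum smooth_pderiv_at) auto

lemma test_functions_iff:
  "f \<in> test_functions R \<longleftrightarrow> smooth f \<and> (\<exists>r<R. \<forall>x. r < norm x \<longrightarrow> f x = 0)"
proof
  assume f: "f \<in> test_functions R"
  show "smooth f \<and> (\<exists>r<R. \<forall>x. r < norm x \<longrightarrow> f x = 0)"
  \<comment> \<open>The radius will be the largest norm on the support, which exists only if the
    support is nonempty.\<close>
  proof (cases "closure {x. f x \<noteq> 0} = {}")
    case True
    then have "f x = 0" for x by (metis closure_eq_empty empty_iff mem_Collect_eq)
    then show ?thesis using f by (auto simp: test_functions_def intro: exI[of _ "R - 1"])
  next
    case False
    then obtain z where z: "z \<in> closure {x. f x \<noteq> 0}" "\<And>y. y \<in> closure {x. f x \<noteq> 0} \<Longrightarrow> norm y \<le> norm z"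
      using f continuous_attains_sup[of "closure {x. f x \<noteq> 0}" norm]
      by (auto simp: test_functions_def intro: continuous_on_norm_id)
    have "f x = 0" if "norm z < norm x" for x
      using z(2)[of x] that closure_subset[of "{x. f x \<noteq> 0}"] by force
    moreover have "norm z < R" using f z(1) by (auto simp: test_functions_def)
    ultimately show ?thesis using f by (auto simp: test_functions_def)
  qed
next
  assume "smooth f \<and> (\<exists>r<R. \<forall>x. r < norm x \<longrightarrow> f x = 0)"
  then obtain r where r: "smooth f" "r < R" "\<And>x. r < norm x \<Longrightarrow> f x = 0" by blast
  then have "{x. f x \<noteq> 0} \<subseteq> cball 0 r" by (force simp: not_less[symmetric])
  then have c: "closure {x. f x \<noteq> 0} \<subseteq> cball 0 r" by (intro closure_minimal) auto
  then have "compact (closure {x. f x \<noteq> 0})"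
    by (metis bounded_cball bounded_subset closed_closure compact_eq_bounded_closed)
  then show "f \<in> test_functions R" using r c by (auto simp: test_functions_def)
qed

lemma pderiv_at_eq_0:
  assumes "\<And>x. r < norm x \<Longrightarrow> f x = 0" "r < norm x"
  shows "pderiv_at i f x = 0"
proof -
  have "open {x :: real ^ 'a. r < norm x}" by (intro open_Collect_less continuous_intros)
  then have "(f has_derivative (\<lambda>_. 0)) (at x)"
    using has_derivative_transform_within_open[of "\<lambda>_. 0" "\<lambda>_. 0" x UNIV "{x. r < norm x}" f] assms by auto
  then show ?thesis using pderiv_at_eq by metis
qed

lemma test_functions_pderiv_at: "f \<in> test_functions R \<Longrightarrow> pderiv_at i f \<in> test_functions R"
  unfolding test_functions_iff using smooth_pderiv_at pderiv_at_eq_0 by metis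

lemma test_functions_laplacian:
  fixes f :: "real ^ 'n \<Rightarrow> real"
  shows "f \<in> test_functions R \<Longrightarrow> laplacian f \<in> test_functions R"
  unfolding test_functions_iff laplacian_def[abs_def]
proof (elim conjE exE, intro conjI exI allI impI)
  fix r and x :: "real ^ 'n" assume f: "smooth f" "r < R" "\<forall>x. r < norm x \<longrightarrow> f x = 0"
  show "smooth (\<lambda>x. \<Sum>i\<in>UNIV. pderiv_at i (pderiv_at i f) x)"
    using smooth_laplacian[OF f(1)] by (simp add: laplacian_def[abs_def])
  assume "r < norm x"
  then show "(\<Sum>i\<in>UNIV. pderiv_at i (pderiv_at i f) x) = 0"
    using f by (intro sum.neutral ballI pderiv_at_eq_0) auto
qed

lemma test_functions_laplacian_power: "f \<in> test_functions R \<Longrightarrow> (laplacian ^^ m) f \<in> test_functions R"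
  by (induction m) (auto intro: test_functions_laplacian)

lemma test_functions_smooth: "f \<in> test_functions R \<Longrightarrow> smooth f"
  by (simp add: test_functions_def)

lemma continuous_nabla:
  assumes "f \<in> test_functions R"
  shows "continuous_on UNIV (nabla k f)"
proof -
  have *: "smooth ((laplacian ^^ (k div 2)) f)"
    using assms test_functions_laplacian_power test_functions_smooth by blast
  show ?thesis
    unfolding nabla_def[abs_def] gradient_def[abs_def]
    using smooth_continuous[OF *] smooth_continuous[OF smooth_pderiv_at[OF *]]
    by (cases "even k") (auto intro!: continuous_intros)
qed

lemma nabla_eq_0:
  assumes "f \<in> test_functions R"
  obtains r where "r < R" "\<And>x. r < norm x \<Longrightarrow> nabla k f x = 0"
proof -
  have "(laplacian ^^ (k div 2)) f \<in> test_functions R"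
    using assms test_functions_laplacian_power by blast
  then obtain r where r: "r < R" "\<And>x. r < norm x \<Longrightarrow> (laplacian ^^ (k div 2)) f x = 0"
    unfolding test_functions_iff by blast
  have "nabla k f x = 0" if "r < norm x" for x
    using r(2)[OF that] pderiv_at_eq_0[OF r(2) that] by (simp add: nabla_def gradient_def zero_vec_def zero_prod_def)
  then show ?thesis using r(1) that by blast
qed

lemma integrable_continuous_compact_support:
  fixes f :: "real ^ 'n \<Rightarrow> real"
  assumes "continuous_on UNIV f" "\<And>x. r < norm x \<Longrightarrow> f x = 0"
  shows "integrable lborel f"
proof -
  have "integrable lborel (\<lambda>x. indicator (cball 0 r) x *\<^sub>R f x)"
    using assms by (intro borel_integrable_compact) (auto intro: continuous_on_subset)
  also have "(\<lambda>x. indicator (cball 0 r) x *\<^sub>R f x) = f"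
    using assms(2) by (force simp: indicator_def not_le)
  finally show ?thesis .
qed

text \<open>Difference quotients in a coordinate direction integrate to zero by translation invariance
  and converge dominatedly to the partial derivative.\<close>

lemma integral_pderiv_at_eq_0:
  fixes F :: "real ^ 'n \<Rightarrow> real"
  assumes diff: "\<And>x. F differentiable (at x)" and cont: "continuous_on UNIV (pderiv_at i F)"
    and supp: "\<And>x. r < norm x \<Longrightarrow> F x = 0"
  shows "(LINT x|lborel. pderiv_at i F x) = 0"
proof -
  let ?e = "axis i 1 :: real ^ 'n"
  have contF: "continuous_on UNIV F"
    by (meson continuous_at_imp_continuous_on differentiable_imp_continuous_within diff)
  have intF: "integrable lborel F" by (rule integrable_continuous_compact_support[OF contF supp])
  have line: "((\<lambda>t. F (x + t *\<^sub>R ?e)) has_real_derivative pderiv_at i F (x + t *\<^sub>R ?e)) (at t)" for x t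
  proof -
    obtain F' where F': "(F has_derivative F') (at (x + t *\<^sub>R ?e))" using diff unfolding differentiable_def by blast
    then interpret bounded_linear F' by (rule has_derivative_bounded_linear)
    have "((\<lambda>t. F (x + t *\<^sub>R ?e)) has_derivative (\<lambda>h. F' (h *\<^sub>R ?e))) (at t)"
      by (rule has_derivative_compose[of "\<lambda>t. x + t *\<^sub>R ?e" "\<lambda>h. h *\<^sub>R ?e" t UNIV F F', OF _ F']) (auto intro!: derivative_eq_intros)
    then show ?thesis unfolding has_field_derivative_def
      using pderiv_at_eq[OF F', of i] scaleR by (simp add: mult.commute[of _ "F' ?e"])
  qed
  have "\<exists>M. \<forall>x\<in>cball 0 r. norm (pderiv_at i F x) \<le> M"
    using cont by (intro compact_continuous_image[THEN compact_imp_bounded, THEN bounded_iff[THEN iffD1], simplified])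
       (auto intro: continuous_on_subset)
  then obtain M0 where M0: "\<And>x. norm x \<le> r \<Longrightarrow> \<bar>pderiv_at i F x\<bar> \<le> M0"
    by (metis mem_cball_0 real_norm_def)
  define M where "M = max M0 0"
  have M: "\<bar>pderiv_at i F x\<bar> \<le> M" for x
    using M0[of x] pderiv_at_eq_0[of r F x i] supp by (cases "norm x \<le> r") (auto simp: M_def)
  define D where "D n x = real (Suc n) * (F (x + (1 / real (Suc n)) *\<^sub>R ?e) - F x)" for n x
  have shift: "integrable lborel (\<lambda>x. F (x + c))" "(LINT x|lborel. F (x + c)) = (LINT x|lborel. F x)" for c
  proof -
    have [measurable]: "F \<in> borel_measurable borel" using contF by (rule borel_measurable_continuous_onI)
    have "integrable (distr lborel borel ((+) c)) F" using intF by (simp add: lborel_distr_plus)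
    then show "integrable lborel (\<lambda>x. F (x + c))" by (subst (asm) integrable_distr_eq) (auto simp: add.commute)
    have "(LINT x|lborel. F x) = (LINT x|distr lborel borel ((+) c). F x)" by (simp add: lborel_distr_plus)
    also have "\<dots> = (LINT x|lborel. F (x + c))" by (subst integral_distr) (auto simp: add.commute)
    finally show "(LINT x|lborel. F (x + c)) = (LINT x|lborel. F x)" by simp
  qed
  have zero: "(LINT x|lborel. D n x) = 0" for n
    unfolding D_def using shift intF by simp
  have "(\<lambda>n. LINT x|lborel. D n x) \<longlonglongrightarrow> (LINT x|lborel. pderiv_at i F x)"
  \<comment> \<open>The radius of the dominating ball grows by 1 because the step lengths 1/(n+1)
    are at most 1; inside it the mean value theorem bounds the quotient by \<open>M\<close>.\<close>
  proof (rule integral_dominated_convergence[where w = "\<lambda>x. M * indicator (cball 0 (r + 1)) x"])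
    show "integrable lborel (\<lambda>x :: real ^ 'n. M * indicator (cball 0 (r + 1)) x)"
      by (intro integrable_mult_right integrable_real_indicator) (use emeasure_lborel_cball_finite in auto)
    show "AE x in lborel. (\<lambda>n. D n x) \<longlonglongrightarrow> pderiv_at i F x"
    proof (intro AE_I2)
      fix x
      have "((\<lambda>h. (F (x + h *\<^sub>R ?e) - F x) / h) \<longlongrightarrow> pderiv_at i F x) (at 0)"
        using line[of x 0] by (simp add: DERIV_def)
      moreover have "filterlim (\<lambda>n. 1 / real (Suc n)) (at 0) sequentially"
        by (intro filterlim_atI LIMSEQ_Suc[OF lim_1_over_n]) auto
      ultimately have "(\<lambda>n. (F (x + (1 / real (Suc n)) *\<^sub>R ?e) - F x) / (1 / real (Suc n))) \<longlonglongrightarrow> pderiv_at i F x"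
        by (rule filterlim_compose)
      then show "(\<lambda>n. D n x) \<longlonglongrightarrow> pderiv_at i F x" by (simp add: D_def mult.commute)
    qed
    show "AE x in lborel. norm (D n x) \<le> M * indicator (cball 0 (r + 1)) x" for n
    proof (intro AE_I2)
      fix x :: "real ^ 'n"
      let ?h = "1 / real (Suc n)"
      show "norm (D n x) \<le> M * indicator (cball 0 (r + 1)) x"
      proof (cases "norm x \<le> r + 1")
        case True
        have "\<exists>t. 0 < t \<and> t < ?h \<and> F (x + ?h *\<^sub>R ?e) - F (x + 0 *\<^sub>R ?e) = (?h - 0) * pderiv_at i F (x + t *\<^sub>R ?e)"
          by (rule MVT2) (use line in auto)
        then obtain t where "F (x + ?h *\<^sub>R ?e) - F x = ?h * pderiv_at i F (x + t *\<^sub>R ?e)" by auto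
        then have "D n x = pderiv_at i F (x + t *\<^sub>R ?e)" by (simp add: D_def field_simps)
        then show ?thesis using M True by simp
      next
        case False
        have "norm x \<le> norm (x + ?h *\<^sub>R ?e) + norm (?h *\<^sub>R ?e)"
          by (metis add_diff_cancel_right' norm_triangle_ineq4)
        also have "norm (?h *\<^sub>R ?e) \<le> 1" by (simp add: norm_axis_1)
        finally have "r < norm (x + ?h *\<^sub>R ?e)" "r < norm x" using False by auto
        then show ?thesis using supp False by (simp add: D_def)
      qed
    qed
    have [measurable]: "F \<in> borel_measurable borel" "pderiv_at i F \<in> borel_measurable borel"
      using contF cont by (auto intro: borel_measurable_continuous_onI)
    show "pderiv_at i F \<in> borel_measurable lborel" by measurable
    show "D n \<in> borel_measurable lborel" for n unfolding D_def by measurable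
  qed
  then show ?thesis unfolding zero using LIMSEQ_unique tendsto_const by blast
qed

text \<open>Compact support of \<open>f\<close> alone removes the boundary terms, so
  \<open>g\<close> may be a polynomial: the derivative of the product has integral 0.\<close>

lemma integral_by_parts_pderiv_at:
  fixes f g :: "real ^ 'n \<Rightarrow> real"
  assumes f: "f \<in> test_functions R" and g: "\<And>x. g differentiable (at x)" and dg: "continuous_on UNIV (pderiv_at i g)"
  shows "(LINT x|lborel. f x * pderiv_at i g x) = - (LINT x|lborel. pderiv_at i f x * g x)"
    and "integrable lborel (\<lambda>x. f x * pderiv_at i g x)"
    and "integrable lborel (\<lambda>x. pderiv_at i f x * g x)"
proof -
  obtain r where r: "\<And>x. r < norm x \<Longrightarrow> f x = 0" using f unfolding test_functions_iff by blast
  have cont: "continuous_on UNIV f" "continuous_on UNIV (pderiv_at i f)" "continuous_on UNIV g"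
    using smooth_continuous[OF test_functions_smooth[OF f]] g
      smooth_continuous[OF smooth_pderiv_at[OF test_functions_smooth[OF f]]]
    by (auto simp: continuous_at_imp_continuous_on differentiable_imp_continuous_within)
  show 1: "integrable lborel (\<lambda>x. f x * pderiv_at i g x)"
    by (rule integrable_continuous_compact_support[where r = r]) (use cont dg r in \<open>auto intro!: continuous_intros\<close>)
  show 2: "integrable lborel (\<lambda>x. pderiv_at i f x * g x)"
    by (rule integrable_continuous_compact_support[where r = r])
      (use cont dg r pderiv_at_eq_0[OF r] in \<open>auto intro!: continuous_intros\<close>)
  have eq: "pderiv_at i (\<lambda>x. f x * g x) x = f x * pderiv_at i g x + pderiv_at i f x * g x" for x
    by (rule pderiv_at_mult[OF smooth_differentiable[OF test_functions_smooth[OF f]] g])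
  have "(LINT x|lborel. pderiv_at i (\<lambda>x. f x * g x) x) = 0"
  proof (rule integral_pderiv_at_eq_0[where r = r])
    show "(\<lambda>x. f x * g x) differentiable at x" for x
      by (intro differentiable_mult g smooth_differentiable[OF test_functions_smooth[OF f]])
    show "continuous_on UNIV (pderiv_at i (\<lambda>x. f x * g x))"
      unfolding eq[abs_def] by (intro continuous_intros cont dg)
  qed (use r in auto)
  then show "(LINT x|lborel. f x * pderiv_at i g x) = - (LINT x|lborel. pderiv_at i f x * g x)"
    unfolding eq using 1 2 by simp
qed

section \<open>Integration by parts against radial polynomial fields\<close>

text \<open>Radial functions are written through the inner product of x with itself and not through
  the norm, because it is smooth at the origin and no case distinction is needed there.\<close>

lemma radial_has_derivative:
  fixes h :: "real \<Rightarrow> real" and x :: "real ^ 'n"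
  assumes "(h has_real_derivative d) (at (x \<bullet> x))"
  shows "((\<lambda>x. h (x \<bullet> x)) has_derivative (\<lambda>v. d * (2 * (x \<bullet> v)))) (at x)"
proof -
  have "((\<lambda>x. x \<bullet> x) has_derivative (\<lambda>v. 2 * (x \<bullet> v))) (at x)"
    by (auto intro!: derivative_eq_intros simp: inner_commute)
  from has_derivative_compose[OF this assms[unfolded has_field_derivative_def]]
  show ?thesis .
qed

lemma pderiv_at_radial:
  fixes h :: "real \<Rightarrow> real" and x :: "real ^ 'n"
  assumes "(h has_real_derivative d) (at (x \<bullet> x))"
  shows "pderiv_at i (\<lambda>x. h (x \<bullet> x)) x = 2 * x $ i * d"
  using pderiv_at_eq[OF radial_has_derivative[OF assms], of i] by (simp add: inner_axis)

lemma coordinate_has_derivative: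
  "((\<lambda>x :: real ^ 'n. x $ i) has_derivative (\<lambda>v. v $ i)) (at x)"
  by (rule bounded_linear_imp_has_derivative) (rule bounded_linear_vec_nth)

lemma pderiv_at_coordinate: "pderiv_at j (\<lambda>x :: real ^ 'n. x $ i) x = (if i = j then 1 else 0)"
  by (subst pderiv_at_eq[OF coordinate_has_derivative]) (simp add: axis_def)

text \<open>The test field paired with \<open>nabla j\<close>: scalar or vector according to the
  parity of j, with polynomial components and hence smooth at the origin.\<close>

definition radial_field :: "nat \<Rightarrow> real poly \<Rightarrow> real ^ 'n \<Rightarrow> real \<times> (real ^ 'n)" where
  "radial_field j b x = (if even j then (poly b (x \<bullet> x), 0) else (0, poly b (x \<bullet> x) *\<^sub>R x))"

lemma differentiable_radial_poly: "(\<lambda>x :: real ^ 'n. poly b (x \<bullet> x)) differentiable (at x)"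
  using radial_has_derivative[OF poly_DERIV] unfolding differentiable_def by blast

text \<open>The hypothesis on \<open>b\<close> says that the field b(|x|^2) x has divergence
  q(|x|^2), so one integration by parts replaces the scalar by its gradient, at the price of a
  sign.\<close>

lemma nabla_flux:
  fixes f :: "real ^ 'n \<Rightarrow> real"
  assumes f: "f \<in> test_functions R" and "even j"
    and b: "of_nat CARD('n) * b + [:0, 2:] * pderiv b = q"
  shows "(LINT x|lborel. nabla j f x \<bullet> radial_field j q x)
    = - (LINT x|lborel. nabla (Suc j) f x \<bullet> radial_field (Suc j) b x)"
proof -
  let ?f = "(laplacian ^^ (j div 2)) f"
  have tf: "?f \<in> test_functions R" using f by (rule test_functions_laplacian_power)
  have deriv: "pderiv_at i (\<lambda>x :: real ^ 'n. x $ i * poly b (x \<bullet> x)) x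
      = poly b (x \<bullet> x) + 2 * (x $ i)\<^sup>2 * poly (pderiv b) (x \<bullet> x)" for i x
    by (subst pderiv_at_mult)
       (auto simp: pderiv_at_radial[OF poly_DERIV] pderiv_at_coordinate differentiable_radial_poly power2_eq_square
          intro: differentiableI[OF coordinate_has_derivative])
  have ibp: "(LINT x|lborel. ?f x * pderiv_at i (\<lambda>x. x $ i * poly b (x \<bullet> x)) x)
       = - (LINT x|lborel. pderiv_at i ?f x * (x $ i * poly b (x \<bullet> x)))"
      "integrable lborel (\<lambda>x. ?f x * pderiv_at i (\<lambda>x. x $ i * poly b (x \<bullet> x)) x)"
      "integrable lborel (\<lambda>x. pderiv_at i ?f x * (x $ i * poly b (x \<bullet> x)))" for i
  proof -
    have "(\<lambda>x :: real ^ 'n. x $ i * poly b (x \<bullet> x)) differentiable at x" for x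
      by (intro differentiable_mult differentiable_radial_poly differentiableI[OF coordinate_has_derivative])
    moreover have "continuous_on UNIV (pderiv_at i (\<lambda>x :: real ^ 'n. x $ i * poly b (x \<bullet> x)))"
      unfolding deriv[abs_def] by (intro continuous_intros)
    ultimately show "(LINT x|lborel. ?f x * pderiv_at i (\<lambda>x. x $ i * poly b (x \<bullet> x)) x)
       = - (LINT x|lborel. pderiv_at i ?f x * (x $ i * poly b (x \<bullet> x)))"
      "integrable lborel (\<lambda>x. ?f x * pderiv_at i (\<lambda>x. x $ i * poly b (x \<bullet> x)) x)"
      "integrable lborel (\<lambda>x. pderiv_at i ?f x * (x $ i * poly b (x \<bullet> x)))"
      using integral_by_parts_pderiv_at[OF tf, of "\<lambda>x. x $ i * poly b (x \<bullet> x)" i] by auto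
  qed
  have "(LINT x|lborel. nabla j f x \<bullet> radial_field j q x)
      = (LINT x|lborel. (\<Sum>i\<in>UNIV. ?f x * pderiv_at i (\<lambda>x. x $ i * poly b (x \<bullet> x)) x))"
  proof (rule Bochner_Integration.integral_cong[OF refl])
    fix x :: "real ^ 'n"
    have "poly q (x \<bullet> x) = real CARD('n) * poly b (x \<bullet> x) + 2 * (x \<bullet> x) * poly (pderiv b) (x \<bullet> x)"
      unfolding b[symmetric] by simp
    also have "\<dots> = (\<Sum>i\<in>UNIV. poly b (x \<bullet> x) + 2 * (x $ i)\<^sup>2 * poly (pderiv b) (x \<bullet> x))"
      by (simp add: sum.distrib inner_vec_def power2_eq_square sum_distrib_left sum_distrib_right)
    finally show "nabla j f x \<bullet> radial_field j q x = (\<Sum>i\<in>UNIV. ?f x * pderiv_at i (\<lambda>x. x $ i * poly b (x \<bullet> x)) x)"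
      using \<open>even j\<close> by (simp add: nabla_def radial_field_def deriv sum_distrib_left)
  qed
  also have "\<dots> = (\<Sum>i\<in>UNIV. LINT x|lborel. ?f x * pderiv_at i (\<lambda>x. x $ i * poly b (x \<bullet> x)) x)"
    by (rule Bochner_Integration.integral_sum) (rule ibp)
  also have "\<dots> = - (\<Sum>i\<in>UNIV. LINT x|lborel. pderiv_at i ?f x * (x $ i * poly b (x \<bullet> x)))"
    by (simp add: ibp(1) sum_negf)
  also have "(\<Sum>i\<in>UNIV. LINT x|lborel. pderiv_at i ?f x * (x $ i * poly b (x \<bullet> x)))
      = (LINT x|lborel. (\<Sum>i\<in>UNIV. pderiv_at i ?f x * (x $ i * poly b (x \<bullet> x))))"
    by (rule Bochner_Integration.integral_sum[symmetric]) (rule ibp)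
  also have "\<dots> = (LINT x|lborel. nabla (Suc j) f x \<bullet> radial_field (Suc j) b x)"
    using \<open>even j\<close> by (intro Bochner_Integration.integral_cong[OF refl])
      (simp add: nabla_def radial_field_def gradient_def inner_vec_def mult_ac)
  finally show ?thesis .
qed

text \<open>The hypothesis on \<open>b\<close> says that b(|x|^2) has gradient -q(|x|^2) x. The
  minus sign cancels the one from integrating by parts; it also makes b decreasing where q is
  nonnegative, hence nonnegative up to R^2 once b vanishes there.\<close>

lemma nabla_tail:
  fixes f :: "real ^ 'n \<Rightarrow> real"
  assumes f: "f \<in> test_functions R" and "odd j" and b: "pderiv b = smult (- 1 / 2) q"
  shows "(LINT x|lborel. nabla j f x \<bullet> radial_field j q x)
    = (LINT x|lborel. nabla (Suc j) f x \<bullet> radial_field (Suc j) b x)"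
proof -
  let ?f = "(laplacian ^^ (j div 2)) f"
  have tf: "?f \<in> test_functions R" using f by (rule test_functions_laplacian_power)
  have dtf: "pderiv_at i ?f \<in> test_functions R" for i using tf by (rule test_functions_pderiv_at)
  have deriv: "pderiv_at i (\<lambda>x :: real ^ 'n. poly b (x \<bullet> x)) x = - (x $ i * poly q (x \<bullet> x))" for i x
    by (simp add: pderiv_at_radial[OF poly_DERIV] b)
  have ibp: "(LINT x|lborel. pderiv_at i ?f x * pderiv_at i (\<lambda>x. poly b (x \<bullet> x)) x)
       = - (LINT x|lborel. pderiv_at i (pderiv_at i ?f) x * poly b (x \<bullet> x))"
      "integrable lborel (\<lambda>x. pderiv_at i ?f x * pderiv_at i (\<lambda>x. poly b (x \<bullet> x)) x)"
      "integrable lborel (\<lambda>x. pderiv_at i (pderiv_at i ?f) x * poly b (x \<bullet> x))" for i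
    using integral_by_parts_pderiv_at[OF dtf differentiable_radial_poly, of i b i, unfolded deriv[abs_def]]
    by (simp_all add: deriv[abs_def] continuous_intros)
  have "(LINT x|lborel. nabla j f x \<bullet> radial_field j q x)
      = (LINT x|lborel. - (\<Sum>i\<in>UNIV. pderiv_at i ?f x * pderiv_at i (\<lambda>x. poly b (x \<bullet> x)) x))"
    using \<open>odd j\<close> unfolding deriv by (intro Bochner_Integration.integral_cong[OF refl])
      (simp add: nabla_def radial_field_def gradient_def inner_vec_def[of "vec_lambda g" for g] sum_negf sum_distrib_left mult_ac)
  also have "\<dots> = - (\<Sum>i\<in>UNIV. LINT x|lborel. pderiv_at i ?f x * pderiv_at i (\<lambda>x. poly b (x \<bullet> x)) x)"
    by (subst Bochner_Integration.integral_minus, subst Bochner_Integration.integral_sum) (auto intro: ibp)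
  also have "\<dots> = (\<Sum>i\<in>UNIV. LINT x|lborel. pderiv_at i (pderiv_at i ?f) x * poly b (x \<bullet> x))"
    by (simp add: ibp(1) sum_negf)
  also have "\<dots> = (LINT x|lborel. (\<Sum>i\<in>UNIV. pderiv_at i (pderiv_at i ?f) x * poly b (x \<bullet> x)))"
    by (rule Bochner_Integration.integral_sum[symmetric]) (rule ibp)
  also have "\<dots> = (LINT x|lborel. nabla (Suc j) f x \<bullet> radial_field (Suc j) b x)"
    using \<open>odd j\<close> by (intro Bochner_Integration.integral_cong[OF refl])
      (simp add: nabla_def radial_field_def laplacian_def sum_distrib_right)
  finally show ?thesis .
qed

section \<open>Radial polynomials and polar coordinates\<close>

text \<open>The operator is diagonal on monomials: y^i has eigenvalue n + 2 i, which is nonzero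
  because n > 0.\<close>

lemma ex_poly_flux:
  assumes "0 < n"
  shows "\<exists>b :: real poly. of_nat n * b + [:0, 2:] * pderiv b = q"
proof -
  define b where "b = (\<Sum>i\<le>degree q. monom (coeff q i / (real n + 2 * real i)) i)"
  have cb: "coeff b i = coeff q i / (real n + 2 * real i)" for i
    by (simp add: b_def coeff_sum coeff_eq_0)
  have "coeff (of_nat n * b + [:0, 2:] * pderiv b) i = coeff q i" for i
  proof -
    have "coeff (of_nat n * b) i = real n * coeff b i" by (simp add: of_nat_poly)
    moreover have "coeff ([:0, 2:] * pderiv b) i = 2 * real i * coeff b i"
      by (cases i) (simp_all add: coeff_pderiv)
    ultimately have "coeff (of_nat n * b + [:0, 2:] * pderiv b) i = (real n + 2 * real i) * coeff b i"
      by (simp add: algebra_simps)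
    also have "\<dots> = coeff q i" using assms by (simp add: cb add_pos_nonneg less_imp_neq[symmetric])
    finally show ?thesis .
  qed
  then show ?thesis by (intro exI poly_eqI)
qed

lemma ex_poly_primitive:
  fixes q :: "real poly"
  shows "\<exists>b. pderiv b = q \<and> poly b y = 0"
proof -
  define b where "b = (\<Sum>i\<le>degree q. monom (coeff q i / (real i + 1)) (Suc i))"
  have "pderiv b = q"
  proof (rule poly_eqI)
    fix i
    have "coeff b (Suc i) = coeff q i / (real i + 1)"
      by (simp add: b_def coeff_sum coeff_eq_0)
    then show "coeff (pderiv b) i = coeff q i" by (simp add: coeff_pderiv add.commute)
  qed
  then have "pderiv (b - [:poly b y:]) = q \<and> poly (b - [:poly b y:]) y = 0"
    by (simp add: pderiv_diff pderiv_pCons)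
  then show ?thesis by blast
qed

section \<open>Adjoint operators on polynomial profiles\<close>

text \<open>The component of \<open>radial_field j b\<close> along the radial direction as a
  function of the radius, see \<open>radial_field_eq\<close>.\<close>

definition profile :: "nat \<Rightarrow> real poly \<Rightarrow> real \<Rightarrow> real" where
  "profile j b r = (if even j then poly b (r\<^sup>2) else r * poly b (r\<^sup>2))"

text \<open>The adjoint of \<open>step_op\<close> for the pairing with weight r^(n-1). Flux and tail
  are adjoint to each other, which is why the parities are swapped.\<close>

definition adj_op :: "real \<Rightarrow> real \<Rightarrow> nat \<Rightarrow> (real \<Rightarrow> ennreal) \<Rightarrow> real \<Rightarrow> ennreal" where
  "adj_op n R j = kernel_op (if even j then tail_kernel R else flux_kernel n R)"

text \<open>As the adjoint of \<open>chain\<close>, it applies the steps in increasing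
  order.\<close>

fun cochain :: "real \<Rightarrow> real \<Rightarrow> nat \<Rightarrow> (real \<Rightarrow> ennreal) \<Rightarrow> real \<Rightarrow> ennreal" where
  "cochain n R 0 h = h"
| "cochain n R (Suc j) h = adj_op n R (Suc j) (cochain n R j h)"

lemma adj_op_measurable [measurable]:
  "f \<in> borel_measurable borel \<Longrightarrow> adj_op n R j f \<in> borel_measurable borel"
  by (simp add: adj_op_def)

lemma cochain_measurable [measurable]:
  "h \<in> borel_measurable borel \<Longrightarrow> cochain n R j h \<in> borel_measurable borel"
  by (induction j) simp_all

lemma flux_kernel_adjoint:
  "ennreal (flux_kernel n R r s) * ennreal (power_weight R (n - 1) r)
    = ennreal (tail_kernel R s r) * ennreal (power_weight R (n - 1) s)"
  by (auto simp: flux_kernel_def tail_kernel_def power_weight_def powr_divide simp flip: ennreal_mult)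

lemma step_op_adjoint:
  assumes [measurable]: "f \<in> borel_measurable borel" "h \<in> borel_measurable borel"
  shows "(\<integral>\<^sup>+r. step_op n R j f r * h r * ennreal (power_weight R (n - 1) r) \<partial>lborel)
    = (\<integral>\<^sup>+r. f r * adj_op n R j h r * ennreal (power_weight R (n - 1) r) \<partial>lborel)"
proof (cases "even j")
  case True
  then show ?thesis unfolding step_op_def adj_op_def
    by (simp only: if_True, intro kernel_op_adjoint) (use flux_kernel_adjoint in auto)
next
  case False
  then show ?thesis unfolding step_op_def adj_op_def
    by (simp only: if_False, intro kernel_op_adjoint) (use flux_kernel_adjoint in auto)
qed

lemma chain_adjoint:
  assumes "f \<in> borel_measurable borel" and [measurable]: "h \<in> borel_measurable borel"
  shows "(\<integral>\<^sup>+r. chain n R k f r * h r * ennreal (power_weight R (n - 1) r) \<partial>lborel)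
    = (\<integral>\<^sup>+r. f r * cochain n R k h r * ennreal (power_weight R (n - 1) r) \<partial>lborel)"
  using assms(1)
proof (induction k arbitrary: f)
  case (Suc k)
  note [measurable] = Suc.prems
  show ?case using Suc.IH[of "step_op n R (Suc k) f"] by (simp add: step_op_adjoint)
qed simp

text \<open>s^n b(s^2) is a primitive of s^(n-1) q(s^2) with limit 0 at 0. Nonnegativity is carried
  along since \<open>ennreal\<close> loses the sign; it comes from the second part of
  \<open>nn_integral_FTC_open\<close>.\<close>

lemma adj_op_profile_flux:
  fixes n :: nat
  assumes "even j" "0 < r" "r < R" "0 < n"
    and F: "\<And>s. 0 < s \<Longrightarrow> s < R \<Longrightarrow> 0 \<le> profile j q s \<and> F s = ennreal (profile j q s)"
    and b: "of_nat n * b + [:0, 2:] * pderiv b = q"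
  shows "0 \<le> profile (Suc j) b r \<and> adj_op n R (Suc j) F r = ennreal (profile (Suc j) b r)"
proof -
  define f where "f s = (s / r) powr (real n - 1) * poly q (s\<^sup>2)" for s
  define G where "G s = r powr (1 - real n) * (s powr real n * poly b (s\<^sup>2))" for s
  have pq: "poly q y = real n * poly b y + 2 * y * poly (pderiv b) y" for y
    unfolding b[symmetric] by simp
  have deriv: "(G has_real_derivative f s) (at s)" if "0 < s" "s < r" for s
  proof -
    have "((\<lambda>s. poly b (s\<^sup>2)) has_real_derivative poly (pderiv b) (s\<^sup>2) * (2 * s)) (at s)"
      by (rule DERIV_chain2[OF poly_DERIV]) (auto intro!: derivative_eq_intros)
    then have "(G has_real_derivative r powr (1 - real n) * (real n * s powr (real n - 1) * poly b (s\<^sup>2)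
        + s powr real n * (poly (pderiv b) (s\<^sup>2) * (2 * s)))) (at s)"
      unfolding G_def using that by (auto intro!: derivative_eq_intros)
    moreover have "s powr real n = s powr (real n - 1) * s" using that by (simp add: powr_diff)
    moreover have "(s / r) powr (real n - 1) = r powr (1 - real n) * s powr (real n - 1)"
      using that by (simp add: powr_divide_minus)
    ultimately show ?thesis unfolding f_def pq by (simp add: algebra_simps power2_eq_square)
  qed
  have f0: "0 \<le> f s" if "0 < s" "s < r" for s
    using F[of s] that assms by (auto simp: f_def profile_def)
  have cont: "isCont f s" if "0 < s" "s < r" for s
    unfolding f_def using that by (intro continuous_intros) auto
  have A: "(G \<longlongrightarrow> 0) (at_right 0)"
  proof -
    have "((\<lambda>s. r powr (1 - real n) * (s powr real n * poly b (s\<^sup>2))) \<longlongrightarrow> r powr (1 - real n) * (0 powr real n * poly b (0\<^sup>2))) (at_right 0)"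
      using \<open>0 < n\<close> by (intro tendsto_intros tendsto_powr')
        (auto simp: eventually_at_filter intro!: always_eventually)
    then show ?thesis by (simp add: G_def[abs_def])
  qed
  have B: "(G \<longlongrightarrow> profile (Suc j) b r) (at_left r)"
  proof -
    have "(G \<longlongrightarrow> G r) (at_left r)" unfolding G_def using assms by (intro tendsto_intros) auto
    also have "G r = profile (Suc j) b r"
      using assms by (simp add: G_def profile_def powr_diff)
    finally show ?thesis .
  qed
  note ftc = nn_integral_FTC_open[OF \<open>0 < r\<close> deriv cont f0 A B]
  have "adj_op n R (Suc j) F r = (\<integral>\<^sup>+s. ennreal (f s) * indicator {0<..<r} s \<partial>lborel)"
    unfolding adj_op_def kernel_op_def using assms F
    by (intro nn_integral_cong) (auto simp: flux_kernel_def indicator_def f_def profile_def mult.commute simp flip: ennreal_mult)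
  then show ?thesis using ftc by simp
qed

text \<open>-b(s^2) is a primitive of s q(s^2) that vanishes at R; this endpoint condition is what
  selects the constant of integration in b.\<close>

lemma adj_op_profile_tail:
  assumes "odd j" "0 < r" "r < R"
    and F: "\<And>s. 0 < s \<Longrightarrow> s < R \<Longrightarrow> 0 \<le> profile j q s \<and> F s = ennreal (profile j q s)"
    and b: "pderiv b = smult (- 1 / 2) q" "poly b (R\<^sup>2) = 0"
  shows "0 \<le> profile (Suc j) b r \<and> adj_op n R (Suc j) F r = ennreal (profile (Suc j) b r)"
proof -
  have deriv: "((\<lambda>s. - poly b (s\<^sup>2)) has_real_derivative s * poly q (s\<^sup>2)) (at s)" for s
  proof -
    have "((\<lambda>s. - poly b (s\<^sup>2)) has_real_derivative - (poly (pderiv b) (s\<^sup>2) * (2 * s))) (at s)"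
      by (intro DERIV_minus DERIV_chain2[OF poly_DERIV]) (auto intro!: derivative_eq_intros)
    then show ?thesis by (simp add: b mult.commute)
  qed
  have B: "((\<lambda>s. - poly b (s\<^sup>2)) \<longlongrightarrow> 0) (at_left R)"
  proof -
    have "((\<lambda>s. - poly b (s\<^sup>2)) \<longlongrightarrow> - poly b (R\<^sup>2)) (at_left R)" by (intro tendsto_intros)
    then show ?thesis by (simp add: b)
  qed
  have A: "((\<lambda>s. - poly b (s\<^sup>2)) \<longlongrightarrow> - poly b (r\<^sup>2)) (at_right r)" by (intro tendsto_intros)
  have ftc: "(\<integral>\<^sup>+s. ennreal (s * poly q (s\<^sup>2)) * indicator {r<..<R} s \<partial>lborel) = ennreal (0 - - poly b (r\<^sup>2))"
    "- poly b (r\<^sup>2) \<le> 0"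
    by (rule nn_integral_FTC_open[OF \<open>r < R\<close> deriv _ _ A B]; use assms F in \<open>auto simp: profile_def intro!: continuous_intros\<close>)+
  have "adj_op n R (Suc j) F r = (\<integral>\<^sup>+s. ennreal (s * poly q (s\<^sup>2)) * indicator {r<..<R} s \<partial>lborel)"
    unfolding adj_op_def kernel_op_def using assms F
    by (intro nn_integral_cong) (auto simp: tail_kernel_def indicator_def profile_def)
  then show ?thesis using ftc \<open>odd j\<close> by (simp add: profile_def)
qed

text \<open>One polynomial \<open>b\<close> serves two purposes: it is what the iterated adjoint
  operators make of r^(2i), and it gives the field against which the k-th gradient reproduces the
  moment of f. Each flux step contributes a sign and the tail steps none, whence the
  exponent.\<close>

lemma moment_duality:
  fixes R :: real
  assumes "0 < R"
  shows "\<exists>b. (\<forall>r. 0 < r \<longrightarrow> r < R \<longrightarrow> 0 \<le> profile k b r \<and> cochain CARD('n) R k (\<lambda>r. ennreal (r ^ (2 * i))) r = ennreal (profile k b r))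
    \<and> (\<forall>f \<in> test_functions R. (LINT x|lborel. f x * norm (x :: real ^ 'n) ^ (2 * i))
         = (-1) ^ (Suc k div 2) * (LINT x|lborel. nabla k f x \<bullet> radial_field k b x))"
proof (induction k)
  case 0
  show ?case
    by (rule exI[of _ "monom 1 i"])
       (auto simp: profile_def poly_monom nabla_def radial_field_def power_mult power2_norm_eq_inner[symmetric])
next
  case (Suc k)
  then obtain q where q: "\<And>r. 0 < r \<Longrightarrow> r < R \<Longrightarrow> 0 \<le> profile k q r \<and> cochain CARD('n) R k (\<lambda>r. ennreal (r ^ (2 * i))) r = ennreal (profile k q r)"
    and ibp: "\<And>f. f \<in> test_functions R \<Longrightarrow> (LINT x|lborel. f x * norm (x :: real ^ 'n) ^ (2 * i))
         = (-1) ^ (Suc k div 2) * (LINT x|lborel. nabla k f x \<bullet> radial_field k q x)" by auto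
  show ?case
  proof (cases "even k")
    case True
    obtain b where b: "of_nat CARD('n) * b + [:0, 2:] * pderiv b = q" using ex_poly_flux[of "CARD('n)" q] by auto
    have "(-1 :: real) ^ (Suc (Suc k) div 2) = - ((-1) ^ (Suc k div 2))"
      using True by (auto elim!: evenE)
    then show ?thesis
      using adj_op_profile_flux[OF True _ _ _ q b] ibp nabla_flux[OF _ True b] by (intro exI[of _ b]) auto
  next
    case False
    obtain b where b: "pderiv b = smult (- 1 / 2) q" "poly b (R\<^sup>2) = 0"
      using ex_poly_primitive by blast
    have "(-1 :: real) ^ (Suc (Suc k) div 2) = ((-1) ^ (Suc k div 2))"
      using False by (auto elim!: oddE)
    then show ?thesis
      using adj_op_profile_tail[OF False _ _ q b] ibp nabla_tail[OF _ False b(1)] by (intro exI[of _ b]) auto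
  qed
qed

section \<open>The ball in polar coordinates\<close>

definition sphere_area :: "nat \<Rightarrow> real" where
  "sphere_area n = real n * unit_ball_vol (real n)"

lemma sphere_area_pos: "0 < n \<Longrightarrow> 0 < sphere_area n"
  by (simp add: sphere_area_def)

abbreviation radial_measure :: "nat \<Rightarrow> real \<Rightarrow> real measure" where
  "radial_measure n R \<equiv> density lborel (\<lambda>r. ennreal (sphere_area n * power_weight R (real n - 1) r))"

lemma norm_measurable_ball [measurable]:
  "norm \<in> borel_measurable (lebesgue_on (ball 0 R))"
  by (intro continuous_imp_measurable_on_sets_lebesgue continuous_on_norm_id) auto

text \<open>Finite measures on the line are determined by the half-lines {a<..}; the preimages under
  the norm are spherical shells, whose volume is a difference of n-th powers.\<close>

lemma distr_norm_ball:
  assumes "0 < R"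
  shows "distr (lebesgue_on (ball (0 :: real ^ 'n) R)) borel norm = radial_measure CARD('n) R"
proof (rule measure_eqI_lessThan)
  let ?n = "CARD('n)" and ?v = "unit_ball_vol (real CARD('n))"
  fix a :: real
  \<comment> \<open>For negative a the preimage is the whole ball, so a is replaced by 0.\<close>
  define a' where "a' = max a 0"
  have S: "{x. a < norm x} \<inter> ball (0 :: real ^ 'n) R \<in> sets borel"
    by (intro sets.Int borel_open open_Collect_less continuous_intros) auto
  have "emeasure (distr (lebesgue_on (ball (0 :: real ^ 'n) R)) borel norm) {a<..}
      = emeasure (lebesgue_on (ball 0 R)) ({x. a < norm x} \<inter> ball (0 :: real ^ 'n) R)"
    by (subst emeasure_distr) (auto simp: space_restrict_space vimage_def Int_def)
  also have "\<dots> = emeasure lebesgue ({x. a < norm x} \<inter> ball (0 :: real ^ 'n) R)"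
    by (intro emeasure_restrict_space) auto
  also have "\<dots> = emeasure lborel ({x. a < norm x} \<inter> ball (0 :: real ^ 'n) R)"
    using S by (simp add: emeasure_completion)
  also have "\<dots> = ennreal (?v * max 0 (R ^ ?n - a' ^ ?n))"
  proof (cases "a < 0")
    case True
    then have "{x. a < norm x} \<inter> ball (0 :: real ^ 'n) R = ball 0 R" by (auto intro: less_le_trans)
    then show ?thesis using True assms by (simp add: a'_def emeasure_ball)
  next
    case False
    show ?thesis
    proof (cases "a < R")
      case True
      have "{x. a < norm x} \<inter> ball (0 :: real ^ 'n) R = ball 0 R - cball 0 a" by auto
      also have "emeasure lborel \<dots> = emeasure lborel (ball (0 :: real ^ 'n) R) - emeasure lborel (cball (0 :: real ^ 'n) a)"
        using True False emeasure_lborel_cball_finite[of "0 :: real ^ 'n" a]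
        by (intro emeasure_Diff) auto
      also have "\<dots> = ennreal (?v * R ^ ?n - ?v * a ^ ?n)"
        using True False by (simp add: emeasure_ball emeasure_cball ennreal_minus)
      also have "?v * R ^ ?n - ?v * a ^ ?n = ?v * max 0 (R ^ ?n - a' ^ ?n)"
        using True False power_mono[of a R ?n] by (simp add: a'_def algebra_simps)
      finally show ?thesis .
    next
      case False2: False
      then have "{x. a < norm x} \<inter> ball (0 :: real ^ 'n) R = {}" by auto
      moreover have "R ^ ?n \<le> a ^ ?n" using False2 assms by (intro power_mono) auto
      ultimately show ?thesis using False by (simp add: a'_def)
    qed
  qed
  finally have L: "emeasure (distr (lebesgue_on (ball (0 :: real ^ 'n) R)) borel norm) {a<..}
      = ennreal (?v * max 0 (R ^ ?n - a' ^ ?n))" .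
  then show "emeasure (distr (lebesgue_on (ball (0 :: real ^ 'n) R)) borel norm) {a<..} < \<infinity>" by simp
  have "emeasure (radial_measure ?n R) {a<..} = (\<integral>\<^sup>+r. ennreal (sphere_area ?n) * (ennreal (r powr (real ?n - 1)) * indicator {a'<..<R} r) \<partial>lborel)"
    by (subst emeasure_density) (auto intro!: nn_integral_cong simp: a'_def power_weight_def indicator_def ennreal_mult sphere_area_def)
  also have "\<dots> = ennreal (sphere_area ?n) * (\<integral>\<^sup>+r. (ennreal (r powr (real ?n - 1)) * indicator {a'<..<R} r) \<partial>lborel)"
    by (rule nn_integral_cmult) measurable
  also have "\<dots> = ennreal (?v * max 0 (R ^ ?n - a' ^ ?n))"
  proof (cases "a' < R")
    case True
    have "(\<integral>\<^sup>+r. (ennreal (r powr (real ?n - 1)) * indicator {a'<..<R} r) \<partial>lborel) = ennreal ((R powr real ?n - a' powr real ?n) / real ?n)"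
      using True by (intro nn_integral_powr) (auto simp: a'_def)
    moreover have "R powr real ?n = R ^ ?n" using assms by (simp add: powr_realpow)
    moreover have "a' powr real ?n = a' ^ ?n"
      using powr_realpow[of a' ?n] by (cases "a' = 0") (auto simp: a'_def max_def)
    moreover have "a' ^ ?n \<le> R ^ ?n" using True by (intro power_mono) (auto simp: a'_def)
    ultimately show ?thesis by (simp add: sphere_area_def flip: ennreal_mult)
  next
    case False
    have "R ^ ?n \<le> a' ^ ?n" using False assms by (intro power_mono) auto
    then show ?thesis using False by simp
  qed
  finally show "emeasure (distr (lebesgue_on (ball (0 :: real ^ 'n) R)) borel norm) {a<..} = emeasure (radial_measure ?n R) {a<..}"
    using L by simp
qed auto

lemma nn_integral_ball_radial:
  assumes "0 < R" and [measurable]: "f \<in> borel_measurable borel"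
  shows "(\<integral>\<^sup>+x. f (norm (x :: real ^ 'n)) \<partial>lebesgue_on (ball 0 R))
    = ennreal (sphere_area CARD('n)) * (\<integral>\<^sup>+r. f r * ennreal (power_weight R (real CARD('n) - 1) r) \<partial>lborel)"
proof -
  have "(\<integral>\<^sup>+x. f (norm (x :: real ^ 'n)) \<partial>lebesgue_on (ball 0 R)) = (\<integral>\<^sup>+r. f r \<partial>radial_measure CARD('n) R)"
    unfolding distr_norm_ball[OF assms(1), symmetric] by (subst nn_integral_distr) auto
  also have "\<dots> = (\<integral>\<^sup>+r. ennreal (sphere_area CARD('n)) * (f r * ennreal (power_weight R (real CARD('n) - 1) r)) \<partial>lborel)"
    by (subst nn_integral_density)
      (auto simp: ennreal_mult sphere_area_def power_weight_def mult_ac intro!: nn_integral_cong)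
  finally show ?thesis by (simp add: nn_integral_cmult)
qed

lemma AE_ball_norm_pos:
  assumes "0 < R"
  shows "AE x in lebesgue_on (ball (0 :: real ^ 'n) R). 0 < norm x \<and> norm x < R"
proof -
  have "AE r in radial_measure CARD('n) R. 0 < r \<and> r < R"
    by (subst AE_density) (auto simp: power_weight_def sphere_area_def)
  then show ?thesis unfolding distr_norm_ball[OF assms, symmetric] by (subst (asm) AE_distr_iff) auto
qed

section \<open>Radial densities and moments\<close>

text \<open>Used in place of Hoelder's inequality to pass from convergence of p-th powers to
  convergence in mean on the ball: for t > e one has t = t^(1-p) t^p <= e^(1-p) t^p.\<close>

lemma le_eps_plus_powr:
  fixes t e p :: real
  assumes "0 \<le> t" "0 < e" "1 \<le> p"
  shows "t \<le> e + e powr (1 - p) * t powr p"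
proof (cases "t \<le> e")
  case False
  have "t = t powr (1 - p) * t powr p" using False assms by (simp flip: powr_add)
  also have "\<dots> \<le> e powr (1 - p) * t powr p"
    using False assms by (intro mult_right_mono powr_mono2') auto
  finally show ?thesis using assms by simp
qed (simp add: add_increasing2)

lemma finite_measure_ball: "finite_measure (lebesgue_on (ball (0 :: real ^ 'n) R))"
  by (rule finite_measure_lebesgue_on) (rule lmeasurable_ball)

lemma Lp_converges_L1:
  fixes f :: "nat \<Rightarrow> real ^ 'n \<Rightarrow> 'b::euclidean_space"
  assumes conv: "Lp_converges p R f g" and p: "1 \<le> p"
    and int: "\<And>n. integrable (lebesgue_on (ball 0 R)) (f n)"
  shows "integrable (lebesgue_on (ball 0 R)) g"
    and "(\<lambda>n. \<integral>\<^sup>+x. ennreal (norm (f n x - g x)) \<partial>lebesgue_on (ball 0 R)) \<longlonglongrightarrow> 0"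
proof -
  let ?M = "lebesgue_on (ball (0 :: real ^ 'n) R)"
  interpret finite_measure ?M by (rule finite_measure_ball)
  note [measurable] = borel_measurable_integrable[OF int]
  have [measurable]: "g \<in> borel_measurable ?M" using conv by (simp add: Lp_converges_def)
  define v where "v = measure ?M (space ?M)"
  have v: "emeasure ?M (space ?M) = ennreal v" "0 \<le> v" by (simp_all add: v_def emeasure_eq_measure)
  have bound: "(\<integral>\<^sup>+x. ennreal (norm (f n x - g x)) \<partial>?M) \<le> ennreal (e * v) + ennreal (e powr (1 - p)) * Lp_energy p R (\<lambda>x. f n x - g x)"
    if "0 < e" for n e
  proof -
    have "(\<integral>\<^sup>+x. ennreal (norm (f n x - g x)) \<partial>?M)
        \<le> (\<integral>\<^sup>+x. ennreal e + ennreal (e powr (1 - p)) * ennreal (norm (f n x - g x) powr p) \<partial>?M)"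
    proof (intro nn_integral_mono)
      fix x
      show "ennreal (norm (f n x - g x)) \<le> ennreal e + ennreal (e powr (1 - p)) * ennreal (norm (f n x - g x) powr p)"
        using le_eps_plus_powr[of "norm (f n x - g x)" e p] that p
        by (simp flip: ennreal_mult ennreal_plus)
    qed
    also have "\<dots> = ennreal (e * v) + ennreal (e powr (1 - p)) * Lp_energy p R (\<lambda>x. f n x - g x)"
      using that v by (simp add: nn_integral_add nn_integral_cmult Lp_energy_def ennreal_mult)
    finally show ?thesis .
  qed
  show lim: "(\<lambda>n. \<integral>\<^sup>+x. ennreal (norm (f n x - g x)) \<partial>?M) \<longlonglongrightarrow> 0"
  proof (rule tendsto_zero_ennreal)
    fix d :: real assume d: "0 < d"
    define e where "e = d / (2 * (v + 1))"
    have e: "0 < e" "e * v < d / 2"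
      using d v(2) by (auto simp: e_def field_simps intro: add_nonneg_pos)
    have "(\<lambda>n. Lp_energy p R (\<lambda>x. f n x - g x)) \<longlonglongrightarrow> 0" using conv by (simp add: Lp_converges_def)
    moreover have "0 < ennreal (d / 2 / e powr (1 - p))" using d e by simp
    ultimately have "\<forall>\<^sub>F n in sequentially. Lp_energy p R (\<lambda>x. f n x - g x) < ennreal (d / 2 / e powr (1 - p))"
      by (rule order_tendstoD(2))
    then show "\<forall>\<^sub>F n in sequentially. (\<integral>\<^sup>+x. ennreal (norm (f n x - g x)) \<partial>?M) < ennreal d"
    proof eventually_elim
      case (elim n)
      have "(\<integral>\<^sup>+x. ennreal (norm (f n x - g x)) \<partial>?M)
          \<le> ennreal (e * v) + ennreal (e powr (1 - p)) * Lp_energy p R (\<lambda>x. f n x - g x)"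
        by (rule bound[OF e(1)])
      also have "\<dots> \<le> ennreal (e * v) + ennreal (e powr (1 - p)) * ennreal (d / 2 / e powr (1 - p))"
        using elim by (intro add_left_mono mult_left_mono) auto
      also have "\<dots> = ennreal (e * v + d / 2)"
        using e v d by (simp flip: ennreal_mult ennreal_plus)
      also have "\<dots> < ennreal d" using e d v by (intro ennreal_lessI) auto
      finally show ?case .
    qed
  qed
  then obtain n where "(\<integral>\<^sup>+x. ennreal (norm (f n x - g x)) \<partial>?M) < 1"
    using order_tendstoD(2)[OF lim, of 1] by (auto simp: eventually_sequentially)
  then have "integrable ?M (\<lambda>x. f n x - g x)"
    by (intro integrableI_bounded) (auto intro: less_trans simp: less_top)
  from Bochner_Integration.integrable_diff[OF int[of n] this] show "integrable ?M g" by simp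
qed

lemma Lp_converges_inner:
  fixes f :: "nat \<Rightarrow> real ^ 'n \<Rightarrow> 'b::euclidean_space"
  assumes conv: "Lp_converges p R f g" and p: "1 \<le> p"
    and int: "\<And>n. integrable (lebesgue_on (ball 0 R)) (f n)"
    and E: "E \<in> borel_measurable (lebesgue_on (ball 0 R))" "\<And>x. x \<in> ball 0 R \<Longrightarrow> norm (E x) \<le> C"
  shows "(\<lambda>n. LINT x|lebesgue_on (ball 0 R). f n x \<bullet> E x) \<longlonglongrightarrow> (LINT x|lebesgue_on (ball 0 R). g x \<bullet> E x)"
    and "integrable (lebesgue_on (ball 0 R)) (\<lambda>x. g x \<bullet> E x)"
proof -
  let ?M = "lebesgue_on (ball (0 :: real ^ 'n) R)"
  note L1 = Lp_converges_L1[OF conv p int]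
  note [measurable] = E(1) borel_measurable_integrable[OF int] borel_measurable_integrable[OF L1(1)]
  have prod: "integrable ?M (\<lambda>x. h x \<bullet> E x)" if h: "integrable ?M h" for h :: "real ^ 'n \<Rightarrow> 'b"
  proof (rule Bochner_Integration.integrable_bound)
    show "integrable ?M (\<lambda>x. C *\<^sub>R norm (h x))" using h by (intro integrable_scaleR_right integrable_norm)
    show "AE x in ?M. norm (h x \<bullet> E x) \<le> norm (C *\<^sub>R norm (h x))"
    proof (intro AE_I2)
      fix x assume "x \<in> space ?M"
      then have "norm (E x) \<le> C" using E(2) by (simp add: space_restrict_space)
      then have "norm (h x) * norm (E x) \<le> \<bar>C\<bar> * norm (h x)" by (metis abs_ge_self mult.commute mult_right_mono norm_ge_zero order_trans)
      then show "norm (h x \<bullet> E x) \<le> norm (C *\<^sub>R norm (h x))"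
        using Cauchy_Schwarz_ineq2[of "h x" "E x"] by simp
    qed
    show "(\<lambda>x. h x \<bullet> E x) \<in> borel_measurable ?M" using borel_measurable_integrable[OF h] by measurable
  qed
  then show "integrable ?M (\<lambda>x. g x \<bullet> E x)" using L1 by blast
  show "(\<lambda>n. LINT x|?M. f n x \<bullet> E x) \<longlonglongrightarrow> (LINT x|?M. g x \<bullet> E x)"
  proof (rule tendsto_L1_int)
    have "(\<lambda>n. ennreal \<bar>C\<bar> * (\<integral>\<^sup>+x. ennreal (norm (f n x - g x)) \<partial>?M)) \<longlonglongrightarrow> ennreal \<bar>C\<bar> * 0"
      by (intro ennreal_tendsto_cmult L1) simp
    then have lim: "(\<lambda>n. ennreal \<bar>C\<bar> * (\<integral>\<^sup>+x. ennreal (norm (f n x - g x)) \<partial>?M)) \<longlonglongrightarrow> 0" by simp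
    show "(\<lambda>n. \<integral>\<^sup>+x. ennreal (norm (f n x \<bullet> E x - g x \<bullet> E x)) \<partial>?M) \<longlonglongrightarrow> 0"
    proof (rule tendsto_sandwich[OF _ _ tendsto_const lim]; intro always_eventually allI)
      fix n
      have "(\<integral>\<^sup>+x. ennreal (norm (f n x \<bullet> E x - g x \<bullet> E x)) \<partial>?M) \<le> (\<integral>\<^sup>+x. ennreal \<bar>C\<bar> * ennreal (norm (f n x - g x)) \<partial>?M)"
      proof (intro nn_integral_mono)
        fix x assume "x \<in> space ?M"
        then have "norm (E x) \<le> C" using E(2) by (simp add: space_restrict_space)
        then have "norm (f n x - g x) * norm (E x) \<le> \<bar>C\<bar> * norm (f n x - g x)"
          by (metis abs_ge_self mult.commute mult_right_mono norm_ge_zero order_trans)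
        then have "norm (f n x \<bullet> E x - g x \<bullet> E x) \<le> \<bar>C\<bar> * norm (f n x - g x)"
          using Cauchy_Schwarz_ineq2[of "f n x - g x" "E x"] by (simp add: inner_diff_left)
        then show "ennreal (norm (f n x \<bullet> E x - g x \<bullet> E x)) \<le> ennreal \<bar>C\<bar> * ennreal (norm (f n x - g x))"
          by (simp flip: ennreal_mult)
      qed
      also have "\<dots> = ennreal \<bar>C\<bar> * (\<integral>\<^sup>+x. ennreal (norm (f n x - g x)) \<partial>?M)"
        by (rule nn_integral_cmult) measurable
      finally show "(\<integral>\<^sup>+x. ennreal (norm (f n x \<bullet> E x - g x \<bullet> E x)) \<partial>?M) \<le> ennreal \<bar>C\<bar> * (\<integral>\<^sup>+x. ennreal (norm (f n x - g x)) \<partial>?M)" .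
    qed simp
  qed (use prod int L1 in auto)
qed

section \<open>Averages over spheres\<close>

text \<open>\<open>G\<close> is the conditional expectation of the positive part of \<open>f\<close>
  given \<open>T\<close>, obtained as a Radon-Nikodym derivative; for the norm it is an average over
  spheres.\<close>

lemma ex_pushforward_density:
  fixes f :: "'a \<Rightarrow> real" and T :: "'a \<Rightarrow> real"
  assumes "finite_measure M" and [measurable]: "f \<in> borel_measurable M" "T \<in> borel_measurable M"
  shows "\<exists>G :: real \<Rightarrow> ennreal. G \<in> borel_measurable borel \<and>
    (\<forall>h \<in> borel_measurable borel. (\<integral>\<^sup>+x. ennreal (f x) * h (T x) \<partial>M) = (\<integral>\<^sup>+r. G r * h r \<partial>distr M borel T))"
proof -
  interpret finite_measure M by fact
  interpret D: finite_measure "distr M borel T" by (rule finite_measure_distr) measurable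
  let ?N = "distr (density M (\<lambda>x. ennreal (f x))) borel T"
  have "absolutely_continuous (distr M borel T) ?N"
  proof (unfold absolutely_continuous_def, rule subsetI)
    fix A assume "A \<in> null_sets (distr M borel T)"
    then have A: "A \<in> sets borel" "T -` A \<inter> space M \<in> null_sets M" by (auto simp: null_sets_distr_iff)
    then have "T -` A \<inter> space M \<in> null_sets (density M (\<lambda>x. ennreal (f x)))"
      by (intro null_setsI) (auto simp: emeasure_density null_sets_def nn_integral_null_set)
    then show "A \<in> null_sets ?N" using A by (auto simp: null_sets_distr_iff)
  qed
  then obtain G where G: "G \<in> borel_measurable (distr M borel T)" "density (distr M borel T) G = ?N"
    using D.Radon_Nikodym[of ?N] by auto
  have "(\<integral>\<^sup>+x. ennreal (f x) * h (T x) \<partial>M) = (\<integral>\<^sup>+r. G r * h r \<partial>distr M borel T)"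
    if [measurable]: "h \<in> borel_measurable borel" for h
  proof -
    have [measurable]: "G \<in> borel_measurable borel" using G by simp
    have "(\<integral>\<^sup>+r. G r * h r \<partial>distr M borel T) = (\<integral>\<^sup>+r. h r \<partial>?N)"
      unfolding G(2)[symmetric] by (subst nn_integral_density) auto
    also have "\<dots> = (\<integral>\<^sup>+x. ennreal (f x) * h (T x) \<partial>M)"
      by (subst nn_integral_distr) (auto simp: nn_integral_density)
    finally show ?thesis by simp
  qed
  then show ?thesis using G by auto
qed

text \<open>The conditional Jensen inequality by duality: testing with the (p-1)-st power of
  \<open>G\<close> and applying Young's inequality bounds the energy of \<open>G\<close> by 1/p
  times the energy of \<open>f\<close> plus 1 - 1/p times itself.\<close>

lemma pushforward_density_power_le:
  fixes f :: "'a \<Rightarrow> real" and T :: "'a \<Rightarrow> real" and G :: "real \<Rightarrow> ennreal"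
  assumes "finite_measure M" and [measurable]: "T \<in> borel_measurable M" "G \<in> borel_measurable borel"
    and f: "integrable M f" "\<And>x. 0 \<le> f x" and p: "1 < p"
    and G: "\<And>h. h \<in> borel_measurable borel \<Longrightarrow> (\<integral>\<^sup>+x. ennreal (f x) * h (T x) \<partial>M) = (\<integral>\<^sup>+r. G r * h r \<partial>distr M borel T)"
  shows "(\<integral>\<^sup>+r. epow (G r) p \<partial>distr M borel T) \<le> (\<integral>\<^sup>+x. ennreal (f x powr p) \<partial>M)"
proof -
  interpret finite_measure M by fact
  let ?D = "distr M borel T"
  interpret D: finite_measure ?D by (rule finite_measure_distr) measurable
  have [measurable]: "f \<in> borel_measurable M" using f by auto
  define J where "J = (\<integral>\<^sup>+x. ennreal (f x powr p) \<partial>M)"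
  \<comment> \<open>Truncation makes the energy finite, so that its multiple on the right can be
    absorbed; Fatou's lemma removes the truncation at the end.\<close>
  define g where "g n r = min (enn2real (G r)) (real n)" for n r
  have [measurable]: "g n \<in> borel_measurable borel" for n unfolding g_def by measurable
  have g0: "0 \<le> g n r" for n r by (simp add: g_def)
  have fin: "AE r in ?D. G r < \<infinity>"
  proof -
    have "(\<integral>\<^sup>+r. G r \<partial>?D) = (\<integral>\<^sup>+x. ennreal (f x) \<partial>M)" using G[of "\<lambda>_. 1"] by simp
    also have "\<dots> < \<infinity>" using f by (simp add: nn_integral_eq_integral)
    finally show ?thesis using nn_integral_PInf_AE[of G ?D] by (auto simp: less_top)
  qed
  have trunc: "(\<integral>\<^sup>+r. ennreal (g n r powr p) \<partial>?D) \<le> J" for n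
  proof -
    let ?I = "\<integral>\<^sup>+r. ennreal (g n r powr p) \<partial>?D"
    have "?I \<le> (\<integral>\<^sup>+r. ennreal (real n powr p) \<partial>?D)"
      using p by (intro nn_integral_mono ennreal_leI powr_mono2) (auto simp: g_def)
    also have "\<dots> < \<infinity>"
    proof -
      have "emeasure ?D UNIV < top" using D.emeasure_finite[of UNIV] by (metis infinity_ennreal_def less_top)
      then show ?thesis by (simp add: ennreal_mult_less_top)
    qed
    finally have Ifin: "?I < \<infinity>" .
    then obtain i where i: "?I = ennreal i" "0 \<le> i" by (cases ?I) auto
    have "?I \<le> (\<integral>\<^sup>+r. G r * ennreal (g n r powr (p - 1)) \<partial>?D)"
    proof (intro nn_integral_mono_AE, use fin in eventually_elim)
      case (elim r)
      have "g n r powr p = g n r * g n r powr (p - 1)"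
        using g0[of n r] by (cases "g n r = 0") (auto simp: powr_diff less_le)
      also have "\<dots> \<le> enn2real (G r) * g n r powr (p - 1)" by (intro mult_right_mono) (auto simp: g_def)
      finally have "ennreal (g n r powr p) \<le> ennreal (enn2real (G r)) * ennreal (g n r powr (p - 1))"
        by (simp flip: ennreal_mult)
      then show ?case using elim by simp
    qed
    also have "\<dots> = (\<integral>\<^sup>+x. ennreal (f x) * ennreal (g n (T x) powr (p - 1)) \<partial>M)"
      by (rule G[symmetric]) measurable
    also have "\<dots> \<le> (\<integral>\<^sup>+x. ennreal (1 / p) * ennreal (f x powr p) + ennreal (1 - 1 / p) * ennreal (g n (T x) powr p) \<partial>M)"
    proof (intro nn_integral_mono)
      fix x
      let ?c = "g n (T x)"
      have "f x * ?c powr (p - 1) \<le> 1 / p * f x powr p + (1 - 1 / p) * ?c powr p"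
      proof (cases "?c = 0")
        case False
        then have c: "0 < ?c" using g0[of n "T x"] by simp
        have "f x * ?c powr (p - 1) \<le> (f x powr p * ?c powr (1 - p) / p + (1 - 1/p) * ?c) * ?c powr (p - 1)"
          using Young_scaled[OF f(2) c p] by (intro mult_right_mono) auto
        also have "\<dots> = 1 / p * f x powr p * (?c powr (1 - p) * ?c powr (p - 1)) + (1 - 1 / p) * (?c * ?c powr (p - 1))"
          by (simp add: algebra_simps)
        also have "?c powr (1 - p) * ?c powr (p - 1) = 1" using c by (simp flip: powr_add)
        also have "?c * ?c powr (p - 1) = ?c powr p" using c by (simp add: powr_diff)
        finally show ?thesis by simp
      qed (use p in simp)
      then show "ennreal (f x) * ennreal (?c powr (p - 1)) \<le> ennreal (1 / p) * ennreal (f x powr p) + ennreal (1 - 1 / p) * ennreal (?c powr p)"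
        using p f(2)[of x] by (simp flip: ennreal_mult ennreal_plus)
    qed
    also have "\<dots> = ennreal (1 / p) * J + ennreal (1 - 1 / p) * (\<integral>\<^sup>+x. ennreal (g n (T x) powr p) \<partial>M)"
      by (simp add: nn_integral_add nn_integral_cmult J_def)
    also have "(\<integral>\<^sup>+x. ennreal (g n (T x) powr p) \<partial>M) = ?I" by (subst nn_integral_distr) auto
    finally have le: "?I \<le> ennreal (1 / p) * J + ennreal (1 - 1 / p) * ?I" .
    show "?I \<le> J"
    proof (cases J)
      case (real j)
      have "ennreal i \<le> ennreal (1 / p * j + (1 - 1 / p) * i)"
        using le i real p by (simp flip: ennreal_mult ennreal_plus)
      then have "i \<le> 1 / p * j + (1 - 1 / p) * i" using i real p by (subst (asm) ennreal_le_iff) auto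
      then have "i \<le> j" using p by (simp add: field_simps)
      then show ?thesis using i real by (simp add: ennreal_leI)
    qed simp
  qed
  have "(\<integral>\<^sup>+r. epow (G r) p \<partial>?D) \<le> (\<integral>\<^sup>+r. liminf (\<lambda>n. ennreal (g n r powr p)) \<partial>?D)"
  proof (intro nn_integral_mono_AE, use fin in eventually_elim)
    case (elim r)
    obtain n0 where n0: "enn2real (G r) \<le> real n0" using real_arch_simple by blast
    have "\<forall>\<^sub>F n in sequentially. ennreal (g n r powr p) = epow (G r) p"
      using eventually_ge_at_top[of n0]
    proof eventually_elim
      case (elim n)
      then have "g n r = enn2real (G r)" using n0 by (simp add: g_def)
      then show ?case using \<open>G r < \<infinity>\<close> by (auto simp: epow_def)
    qed
    then have "(\<lambda>n. ennreal (g n r powr p)) \<longlonglongrightarrow> epow (G r) p" by (rule tendsto_eventually)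
    then show ?case by (simp add: lim_imp_Liminf)
  qed
  also have "\<dots> \<le> liminf (\<lambda>n. \<integral>\<^sup>+r. ennreal (g n r powr p) \<partial>?D)"
    by (rule nn_integral_liminf) measurable
  also have "\<dots> \<le> J" using trunc by (intro Liminf_le) auto
  finally show ?thesis by (simp add: J_def)
qed


text \<open>Only even powers are available, since odd powers of the norm are not smooth at the
  origin. They suffice because squaring is injective on [0,R]: polynomials in r^2 are uniformly
  dense there, and continuous functions detect half-lines.\<close>

lemma moments_determine_measure:
  fixes M N :: "real measure"
  assumes "finite_measure M" "finite_measure N" and sets: "sets M = sets borel" "sets N = sets borel"
    and supp: "AE r in M. 0 < r \<and> r < R" "AE r in N. 0 < r \<and> r < R"
    and moments: "\<And>i :: nat. (LINT r|M. r ^ (2 * i)) = (LINT r|N. r ^ (2 * i))"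
  shows "M = N"
proof -
  interpret M: finite_measure M by fact
  interpret N: finite_measure N by fact
  note [measurable_cong] = sets
  have intg: "integrable M f" "integrable N f"
    if [measurable]: "f \<in> borel_measurable borel" and "\<And>r. 0 \<le> r \<Longrightarrow> r \<le> R \<Longrightarrow> \<bar>f r\<bar> \<le> c" for f :: "real \<Rightarrow> real" and c
  proof -
    have "AE r in M. norm (f r) \<le> c" using supp(1) by eventually_elim (use that(2) in auto)
    moreover have "AE r in N. norm (f r) \<le> c" using supp(2) by eventually_elim (use that(2) in auto)
    ultimately show "integrable M f" "integrable N f"
      by (auto intro!: M.integrable_const_bound[of _ c] N.integrable_const_bound[of _ c])
  qed
  have power: "integrable M (\<lambda>r. r ^ (2 * i))" "integrable N (\<lambda>r. r ^ (2 * i))" for i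
    by (rule intg[of _ "R ^ (2 * i)"]; auto intro!: power_mono)+
  have eq: "(LINT r|M. h r) = (LINT r|N. h r)"
    if h: "continuous_on UNIV h" and hb: "\<And>r. \<bar>h r\<bar> \<le> 1" for h :: "real \<Rightarrow> real"
  proof -
    have [measurable]: "h \<in> borel_measurable borel" using h by (rule borel_measurable_continuous_onI)
    let ?m = "measure M (space M) + measure N (space N)"
    have close: "\<bar>(LINT r|M. h r) - (LINT r|N. h r)\<bar> \<le> e * ?m" if e: "0 < e" for e
    proof -
      \<comment> \<open>The approximation is made in the variable y = r^2, which turns polynomials
        in y into even polynomials in r.\<close>
      obtain g where g: "real_polynomial_function g" "\<And>y. y \<in> {0..R\<^sup>2} \<Longrightarrow> \<bar>h (sqrt y) - g y\<bar> < e"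
      proof (rule Stone_Weierstrass_real_polynomial_function[of "{0..R\<^sup>2}" "\<lambda>y. h (sqrt y)" e])
        show "continuous_on {0..R\<^sup>2} (\<lambda>y. h (sqrt y))"
          by (rule continuous_on_compose2[OF h]) (auto intro!: continuous_intros)
      qed (use e in auto)
      then obtain a n where ga: "g = (\<lambda>y. \<Sum>i\<le>n. a i * y ^ i)"
        using real_polynomial_function_iff_sum by blast
      have gsum: "g (r\<^sup>2) = (\<Sum>i\<le>n. a i * r ^ (2 * i))" for r by (simp add: ga power_mult)
      have gi: "integrable M (\<lambda>r. g (r\<^sup>2))" "integrable N (\<lambda>r. g (r\<^sup>2))"
        unfolding gsum using power by auto
      have geq: "(LINT r|M. g (r\<^sup>2)) = (LINT r|N. g (r\<^sup>2))"
        unfolding gsum using power moments by simp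
      have hg: "\<bar>h r - g (r\<^sup>2)\<bar> \<le> e" if "0 < r" "r < R" for r
        using g(2)[of "r\<^sup>2"] that by (simp add: power_mono less_imp_le)
      have hgM: "AE r in M. \<bar>h r - g (r\<^sup>2)\<bar> \<le> e"
        using supp(1) by eventually_elim (use hg in auto)
      have hgN: "AE r in N. \<bar>h r - g (r\<^sup>2)\<bar> \<le> e"
        using supp(2) by eventually_elim (use hg in auto)
      have hi: "integrable M h" "integrable N h" by (rule intg[of h 1]; use hb in auto)+
      have "\<bar>(LINT r|M. h r - g (r\<^sup>2))\<bar> \<le> (LINT r|M. e)"
        by (rule order_trans[OF integral_abs_bound integral_mono_AE])
          (use gi hi hgM in auto)
      moreover have "\<bar>(LINT r|N. h r - g (r\<^sup>2))\<bar> \<le> (LINT r|N. e)"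
        by (rule order_trans[OF integral_abs_bound integral_mono_AE])
          (use gi hi hgN in auto)
      ultimately show ?thesis using gi hi geq by (simp add: algebra_simps)
    qed
    have "\<bar>(LINT r|M. h r) - (LINT r|N. h r)\<bar> \<le> 0"
    proof (rule field_le_epsilon)
      fix d :: real assume "0 < d"
      moreover have "0 < ?m + 1" by (simp add: add_nonneg_pos)
      ultimately have "\<bar>(LINT r|M. h r) - (LINT r|N. h r)\<bar> \<le> d / (?m + 1) * ?m" by (intro close) simp
      also have "\<dots> \<le> d" using \<open>0 < d\<close> \<open>0 < ?m + 1\<close> by (simp add: field_simps)
      finally show "\<bar>(LINT r|M. h r) - (LINT r|N. h r)\<bar> \<le> 0 + d" by simp
    qed
    then show ?thesis by simp
  qed
  show ?thesis
  proof (rule measure_eqI_lessThan)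
    fix a :: real
    \<comment> \<open>Continuous ramps that converge pointwise to the indicator of {a<..}.\<close>
    define h where "h n r = min 1 (max 0 (real n * (r - a)))" for n r
    have hc: "continuous_on UNIV (h n)" for n unfolding h_def by (intro continuous_intros)
    have [measurable]: "h n \<in> borel_measurable borel" for n using hc by (rule borel_measurable_continuous_onI)
    have hb: "\<bar>h n r\<bar> \<le> 1" for n r by (simp add: h_def)
    have hl: "(\<lambda>n. h n r) \<longlonglongrightarrow> indicator {a<..} r" for r
    proof (cases "a < r")
      case True
      obtain n0 where n0: "1 / (r - a) \<le> real n0" using real_arch_simple by blast
      have "\<forall>\<^sub>F n in sequentially. h n r = 1"
        using eventually_ge_at_top[of n0]
      proof eventually_elim
        case (elim n)
        then have "1 / (r - a) \<le> real n" using n0 by simp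
        then show ?case using True by (simp add: h_def field_simps)
      qed
      then show ?thesis using True by (simp add: tendsto_eventually)
    next
      case False
      then have "h n r = 0" for n by (simp add: h_def mult_nonneg_nonpos)
      then show ?thesis using False by simp
    qed
    have "(\<lambda>n. LINT r|M. h n r) \<longlonglongrightarrow> (LINT r|M. indicator {a<..} r)"
      by (rule integral_dominated_convergence[where w = "\<lambda>_. 1"]) (use hb hl in auto)
    moreover have "(\<lambda>n. LINT r|N. h n r) \<longlonglongrightarrow> (LINT r|N. indicator {a<..} r)"
      by (rule integral_dominated_convergence[where w = "\<lambda>_. 1"]) (use hb hl in auto)
    ultimately have "(LINT r|M. indicator {a<..} r) = (LINT r|N. indicator {a<..} r :: real)"
      unfolding eq[OF hc hb] by (rule LIMSEQ_unique)
    then show "emeasure M {a<..} = emeasure N {a<..}"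
      by (simp add: M.emeasure_eq_measure N.emeasure_eq_measure)
    show "emeasure M {a<..} < \<infinity>" using M.emeasure_finite by (metis infinity_ennreal_def less_top)
  qed (use sets in auto)
qed

text \<open>The profile of a function that is radial almost everywhere is arbitrary on a null set of
  radii that need not be measurable.  Superlevel sets, stripped of null sets, are countable unions of
  compact sets, whose images under the norm are Borel; the profile is rebuilt from these.\<close>

lemma ex_borel_radial_profile:
  fixes u :: "real ^ 'n \<Rightarrow> real"
  assumes [measurable]: "u \<in> borel_measurable (lebesgue_on (ball 0 R))"
    and v: "AE x in lebesgue_on (ball 0 R). u x = v (norm x)"
  shows "\<exists>U :: real \<Rightarrow> real. U \<in> borel_measurable borel \<and> (AE x in lebesgue_on (ball 0 R). u x = U (norm x))"
proof -
  let ?M = "lebesgue_on (ball (0 :: real ^ 'n) R)"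
  obtain N where N: "N \<in> null_sets ?M" "\<And>x. x \<in> ball 0 R - N \<Longrightarrow> u x = v (norm x)"
    using AE_E3[OF v] by (auto simp: space_restrict_space)
  have ball: "ball (0 :: real ^ 'n) R \<in> sets lebesgue" by simp
  have "\<exists>B T. B \<in> sets borel \<and> T \<in> null_sets ?M \<and>
      (\<forall>x \<in> ball 0 R - N - T. c < u x \<longleftrightarrow> norm x \<in> B)" for c
  proof -
    let ?S = "{x \<in> space ?M. c < u x} - N"
    have "{x \<in> space ?M. c < u x} \<in> sets ?M" by measurable
    then have "?S \<in> sets ?M" using N(1) by (intro sets.Diff) auto
    then have "?S \<in> sets lebesgue" using ball by (simp add: sets_restrict_space_iff)
    then obtain C T where CT: "fsigma C" "T \<in> null_sets lebesgue" "C \<union> T = ?S" "disjnt C T"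
      by (rule lebesgue_set_almost_fsigma)
    obtain F :: "nat \<Rightarrow> (real ^ 'n) set" where "range F \<subseteq> Collect compact" "C = \<Union> (F ` UNIV)"
      using CT(1) fsigma_Union_compact by metis
    then have F: "\<And>n. compact (F n)" "C = (\<Union>n. F n)" by auto
    have "norm ` C = (\<Union>n. norm ` F n)" using F by auto
    moreover have "norm ` F n \<in> sets borel" for n
      using F(1) by (intro borel_compact compact_continuous_image continuous_on_norm_id)
    ultimately have "norm ` C \<in> sets borel" by auto
    moreover have "T \<subseteq> ball 0 R" using CT(3) by (auto simp: space_restrict_space)
    then have "T \<in> null_sets ?M" using CT(2) ball by (simp add: null_sets_restrict_space)
    moreover have "c < u x \<longleftrightarrow> norm x \<in> norm ` C" if "x \<in> ball 0 R - N - T" for x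
    proof
      assume "c < u x"
      then have "x \<in> ?S" using that by (simp add: space_restrict_space)
      then show "norm x \<in> norm ` C" using CT(3) that by blast
    next
      assume "norm x \<in> norm ` C"
      then obtain y where y: "y \<in> C" "norm x = norm y" by blast
      \<comment> \<open>Here radiality enters: outside \<open>N\<close> two points of equal norm
        have equal values, so one point of \<open>C\<close> decides for its whole sphere.\<close>
      then have "y \<in> ?S" using CT(3) by blast
      then have "c < u y" "u y = v (norm y)" using N(2)[of y] by (auto simp: space_restrict_space)
      then show "c < u x" using N(2)[of x] that y by simp
    qed
    ultimately show ?thesis by blast
  qed
  then obtain B T where BT: "\<And>c. B c \<in> sets borel" "\<And>c. T c \<in> null_sets ?M"
      "\<And>c x. x \<in> ball 0 R - N - T c \<Longrightarrow> c < u x \<longleftrightarrow> norm x \<in> B c"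
    by metis
  note [measurable] = BT(1)
  \<comment> \<open>The value is rebuilt as the supremum of the rational levels below it; countably
    many levels keep the union of the exceptional sets null.\<close>
  define U where "U r = real_of_ereal (SUP c\<in>\<rat>. if r \<in> B c then ereal c else - \<infinity>)" for r
  have "U \<in> borel_measurable borel"
    unfolding U_def by (intro borel_measurable_real_of_ereal borel_measurable_SUP countable_rat) measurable
  moreover have "AE x in ?M. u x = U (norm x)"
  proof -
    have "N \<union> (\<Union>c\<in>\<rat>. T c) \<in> null_sets ?M"
      using N(1) BT(2) by (intro null_sets.Un null_sets_UN' countable_rat) auto
    then have "AE x in ?M. x \<notin> N \<union> (\<Union>c\<in>\<rat>. T c)" by (rule AE_not_in)
    moreover have "AE x in ?M. x \<in> ball 0 R" by (auto simp: space_restrict_space intro: AE_I2)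
    ultimately show ?thesis
    proof eventually_elim
      case (elim x)
      have "(SUP c\<in>\<rat>. if norm x \<in> B c then ereal c else - \<infinity>) = ereal (u x)"
      proof (rule antisym)
        show "(SUP c\<in>\<rat>. if norm x \<in> B c then ereal c else - \<infinity>) \<le> ereal (u x)"
          using elim BT(3)[of x] by (intro SUP_least) (auto intro: less_imp_le)
        show "ereal (u x) \<le> (SUP c\<in>\<rat>. if norm x \<in> B c then ereal c else - \<infinity>)"
        proof (rule dense_le)
          fix y assume "y < ereal (u x)"
          then obtain z where z: "y < ereal z" "z < u x" by (metis ereal_dense2 ereal_less(2) less_ereal.simps(1))
          obtain c where c: "c \<in> \<rat>" "z < c" "c < u x" using Rats_dense_in_real[OF z(2)] by blast
          then have "y \<le> ereal c" using z by (meson ereal_less_eq(3) less_imp_le order_trans)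
          also have "ereal c \<le> (SUP c\<in>\<rat>. if norm x \<in> B c then ereal c else - \<infinity>)"
            using c elim BT(3)[of x c] by (intro SUP_upper2[of c]) auto
          finally show "y \<le> (SUP c\<in>\<rat>. if norm x \<in> B c then ereal c else - \<infinity>)" .
        qed
      qed
      then show ?case by (simp add: U_def)
    qed
  qed
  ultimately show ?thesis by blast
qed

section \<open>Representation of radial Sobolev functions\<close>

lemma kernel_op_add:
  assumes [measurable]: "case_prod K \<in> borel_measurable (borel \<Otimes>\<^sub>M borel)" "f \<in> borel_measurable borel" "g \<in> borel_measurable borel"
  shows "kernel_op K (\<lambda>s. f s + g s) = (\<lambda>r. kernel_op K f r + kernel_op K g r)"
proof
  fix r
  have [measurable]: "K r \<in> borel_measurable borel" by measurable
  show "kernel_op K (\<lambda>s. f s + g s) r = kernel_op K f r + kernel_op K g r"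
    unfolding kernel_op_def distrib_right by (rule nn_integral_add) measurable
qed

lemma chain_add:
  assumes "f \<in> borel_measurable borel" "g \<in> borel_measurable borel"
  shows "chain n R k (\<lambda>s. f s + g s) r = chain n R k f r + chain n R k g r"
  using assms
proof (induction k arbitrary: f g)
  case (Suc k)
  note [measurable] = Suc.prems
  have "step_op n R (Suc k) (\<lambda>s. f s + g s) = (\<lambda>r. step_op n R (Suc k) f r + step_op n R (Suc k) g r)"
    unfolding step_op_def by (rule kernel_op_add) auto
  then show ?case using Suc.IH[of "step_op n R (Suc k) f" "step_op n R (Suc k) g"] by simp
qed simp

text \<open>Pairing with it yields the value of a scalar gradient and the radial component of a
  vector one. At the origin the vector is 0.\<close>

definition radial_dir :: "nat \<Rightarrow> real ^ 'n \<Rightarrow> real \<times> (real ^ 'n)" where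
  "radial_dir k x = (if even k then (1, 0) else (0, (1 / norm x) *\<^sub>R x))"

lemma norm_radial_dir: "norm (radial_dir k x) \<le> 1"
  by (auto simp: radial_dir_def norm_Pair)

lemma radial_field_eq: "radial_field k b x = profile k b (norm x) *\<^sub>R radial_dir k x"
  by (cases "x = 0") (auto simp: radial_field_def profile_def radial_dir_def power2_norm_eq_inner zero_prod_def)

lemma borel_measurable_lebesgue_on:
  "f \<in> borel_measurable borel \<Longrightarrow> f \<in> borel_measurable (lebesgue_on S)"
  by (intro measurable_restrict_space1 measurable_completion) simp

lemma radial_dir_measurable [measurable]: "radial_dir k \<in> borel_measurable (lebesgue_on (ball 0 R))"
proof -
  have "radial_dir k \<in> borel_measurable borel" unfolding radial_dir_def[abs_def] by measurable
  then show ?thesis by (rule borel_measurable_lebesgue_on)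
qed

lemma continuous_measurable_ball:
  "continuous_on UNIV f \<Longrightarrow> f \<in> borel_measurable (lebesgue_on (ball (0 :: real ^ 'n) R))"
  for f :: "real ^ 'n \<Rightarrow> 'b::euclidean_space"
  by (intro borel_measurable_lebesgue_on borel_measurable_continuous_onI)

lemma continuous_integrable_ball:
  fixes f :: "real ^ 'n \<Rightarrow> 'b::euclidean_space"
  assumes "continuous_on UNIV f"
  shows "integrable (lebesgue_on (ball 0 R)) f" and "\<exists>C \<ge> 0. \<forall>x\<in>ball 0 R. norm (f x) \<le> C"
proof -
  interpret finite_measure "lebesgue_on (ball (0 :: real ^ 'n) R)" by (rule finite_measure_ball)
  have "bounded (f ` cball 0 R)"
    using assms by (intro compact_imp_bounded compact_continuous_image) (auto intro: continuous_on_subset)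
  then obtain C where C: "\<And>x. x \<in> cball 0 R \<Longrightarrow> norm (f x) \<le> C"
    unfolding bounded_iff by blast
  show "integrable (lebesgue_on (ball 0 R)) f"
    by (rule integrable_const_bound[of _ C])
      (use C continuous_measurable_ball[OF assms] in \<open>auto simp: space_restrict_space intro!: AE_I2\<close>)
  show "\<exists>C \<ge> 0. \<forall>x\<in>ball 0 R. norm (f x) \<le> C"
    using C by (intro exI[of _ "max C 0"]) (auto intro: le_max_iff_disj[THEN iffD2])
qed

lemma integral_ball_eq_lborel:
  fixes f :: "real ^ 'n \<Rightarrow> real"
  assumes "continuous_on UNIV f" "\<And>x. R \<le> norm x \<Longrightarrow> f x = 0"
  shows "(LINT x|lebesgue_on (ball 0 R). f x) = (LINT x|lborel. f x)"
proof -
  have "(LINT x|lebesgue_on (ball 0 R). f x) = (LINT x|lebesgue. indicator (ball 0 R) x *\<^sub>R f x)"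
    by (rule integral_restrict_space) auto
  also have "(\<lambda>x. indicator (ball 0 R) x *\<^sub>R f x) = f"
    using assms(2) by (force simp: indicator_def)
  also have "(LINT x|lebesgue. f x) = (LINT x|lborel. f x)"
    using assms(1) by (intro integral_completion) (auto intro: borel_measurable_continuous_onI)
  finally show ?thesis .
qed

text \<open>The moment identity pairs functions with fields that are bounded on the ball, so
  convergence in mean is enough to pass to the limit. Integrability, finite energy and these moments
  are all that is used later about a function and its weak gradient.\<close>

lemma W0_nabla_moments:
  fixes u :: "real ^ 'n \<Rightarrow> real"
  assumes g: "has_W0_nabla k p R u g" and p: "1 \<le> p" and R: "0 < R"
  shows "integrable (lebesgue_on (ball 0 R)) u" "integrable (lebesgue_on (ball 0 R)) g" "Lp_energy p R g < \<infinity>"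
    and "\<exists>b. (\<forall>r. 0 < r \<longrightarrow> r < R \<longrightarrow> 0 \<le> profile k b r \<and> cochain CARD('n) R k (\<lambda>r. ennreal (r ^ (2 * i))) r = ennreal (profile k b r))
      \<and> integrable (lebesgue_on (ball 0 R)) (\<lambda>x. u x * norm x ^ (2 * i))
      \<and> integrable (lebesgue_on (ball 0 R)) (\<lambda>x. (-1) ^ (Suc k div 2) * (g x \<bullet> radial_dir k x) * profile k b (norm x))
      \<and> (LINT x|lebesgue_on (ball 0 R). u x * norm x ^ (2 * i))
         = (LINT x|lebesgue_on (ball 0 R). (-1) ^ (Suc k div 2) * (g x \<bullet> radial_dir k x) * profile k b (norm x))"
proof -
  let ?M = "lebesgue_on (ball (0 :: real ^ 'n) R)"
  obtain \<phi> where \<phi>: "\<And>n. \<phi> n \<in> test_functions R" and u: "Lp_converges p R \<phi> u"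
    and gn: "Lp_converges p R (\<lambda>n. nabla k (\<phi> n)) g"
    using g unfolding has_W0_nabla_def by blast
  have cont: "continuous_on UNIV (\<phi> n)" "continuous_on UNIV (nabla k (\<phi> n))" for n
    using \<phi> smooth_continuous test_functions_smooth continuous_nabla by blast+
  have int: "integrable ?M (\<phi> n)" "integrable ?M (nabla k (\<phi> n))" for n
    using cont continuous_integrable_ball by blast+
  show "integrable ?M u" "integrable ?M g"
    using Lp_converges_L1(1)[OF u p int(1)] Lp_converges_L1(1)[OF gn p int(2)] by auto
  note [measurable] = borel_measurable_integrable[OF int(2)] borel_measurable_integrable[OF \<open>integrable ?M g\<close>]
  show "Lp_energy p R g < \<infinity>"
  proof -
    \<comment> \<open>A single approximant at energy distance below 1 gives finiteness, since its
      own k-th gradient is bounded.\<close>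
    obtain n where n: "Lp_energy p R (\<lambda>x. nabla k (\<phi> n) x - g x) < 1"
      using gn order_tendstoD(2)[of "\<lambda>n. Lp_energy p R (\<lambda>x. nabla k (\<phi> n) x - g x)" 0 sequentially 1]
      by (auto simp: Lp_converges_def eventually_sequentially)
    obtain C where C: "0 \<le> C" "\<And>x. x \<in> ball 0 R \<Longrightarrow> norm (nabla k (\<phi> n) x) \<le> C"
      using continuous_integrable_ball(2)[OF cont(2)] by blast
    have "Lp_energy p R g \<le> (\<integral>\<^sup>+x. ennreal (2 powr p) * (ennreal (C powr p) + ennreal (norm (nabla k (\<phi> n) x - g x) powr p)) \<partial>?M)"
      unfolding Lp_energy_def
    proof (intro nn_integral_mono)
      fix x assume "x \<in> space ?M"
      then have x: "norm (nabla k (\<phi> n) x) \<le> C" using C by (simp add: space_restrict_space)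
      let ?d = "norm (nabla k (\<phi> n) x - g x)"
      have "norm (g x) \<le> norm (nabla k (\<phi> n) x) + ?d"
        by (metis norm_minus_commute norm_triangle_sub)
      then have "norm (g x) \<le> 2 * max C ?d" using x by linarith
      then have "norm (g x) powr p \<le> (2 * max C ?d) powr p" using p by (intro powr_mono2) auto
      also have "\<dots> = 2 powr p * max C ?d powr p" using C by (simp add: powr_mult)
      also have "\<dots> \<le> 2 powr p * (C powr p + ?d powr p)"
        by (intro mult_left_mono) (auto simp: max_def)
      finally show "ennreal (norm (g x) powr p) \<le> ennreal (2 powr p) * (ennreal (C powr p) + ennreal (?d powr p))"
        by (simp flip: ennreal_mult ennreal_plus)
    qed
    also have "\<dots> = ennreal (2 powr p) * (ennreal (C powr p) * emeasure ?M (space ?M) + Lp_energy p R (\<lambda>x. nabla k (\<phi> n) x - g x))"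
      by (simp add: nn_integral_cmult nn_integral_add Lp_energy_def)
    also have "\<dots> < \<infinity>"
    proof -
      have "emeasure ?M (space ?M) < top"
        using finite_measure.emeasure_finite[OF finite_measure_ball] by (metis infinity_ennreal_def less_top)
      moreover have "Lp_energy p R (\<lambda>x. nabla k (\<phi> n) x - g x) < top"
        using n by (rule order.strict_trans) simp
      ultimately show ?thesis by (simp add: ennreal_mult_less_top ennreal_add_less_top)
    qed
    finally show ?thesis .
  qed
  obtain b where b: "\<And>r. 0 < r \<Longrightarrow> r < R \<Longrightarrow> 0 \<le> profile k b r \<and> cochain CARD('n) R k (\<lambda>r. ennreal (r ^ (2 * i))) r = ennreal (profile k b r)"
    and ibp: "\<And>f :: real ^ 'n \<Rightarrow> real. f \<in> test_functions R \<Longrightarrow> (LINT x|lborel. f x * norm x ^ (2 * i))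
         = (-1) ^ (Suc k div 2) * (LINT x|lborel. nabla k f x \<bullet> radial_field k b x)"
    using moment_duality[OF R, where 'n = 'n and k = k and i = i] by blast
  have contE: "continuous_on UNIV (radial_field k b :: real ^ 'n \<Rightarrow> _)"
    unfolding radial_field_def[abs_def] by (cases "even k") (auto intro!: continuous_intros)
  have contP: "continuous_on UNIV (\<lambda>x :: real ^ 'n. norm x ^ (2 * i))" by (intro continuous_intros)
  obtain C1 where C1: "\<And>x :: real ^ 'n. x \<in> ball 0 R \<Longrightarrow> norm (radial_field k b x) \<le> C1"
    using continuous_integrable_ball(2)[OF contE] by blast
  obtain C2 where C2: "\<And>x :: real ^ 'n. x \<in> ball 0 R \<Longrightarrow> norm (norm x ^ (2 * i)) \<le> C2"
    using continuous_integrable_ball(2)[OF contP] by blast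
  note L1 = Lp_converges_inner[OF gn p int(2) continuous_measurable_ball[OF contE] C1]
  note L2 = Lp_converges_inner[OF u p int(1) continuous_measurable_ball[OF contP] C2]
  have eqn: "(LINT x|?M. \<phi> n x \<bullet> norm x ^ (2 * i)) = (-1) ^ (Suc k div 2) * (LINT x|?M. nabla k (\<phi> n) x \<bullet> radial_field k b x)" for n
  proof -
    obtain r where "r < R" "\<And>x. r < norm x \<Longrightarrow> \<phi> n x = 0" using \<phi>[of n] unfolding test_functions_iff by blast
    then have "(LINT x|?M. \<phi> n x \<bullet> norm x ^ (2 * i)) = (LINT x|lborel. \<phi> n x * norm x ^ (2 * i))"
      by (subst integral_ball_eq_lborel) (auto intro!: continuous_intros cont)
    moreover obtain r' where "r' < R" "\<And>x. r' < norm x \<Longrightarrow> nabla k (\<phi> n) x = 0" using nabla_eq_0[OF \<phi>] by blast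
    then have "(LINT x|?M. nabla k (\<phi> n) x \<bullet> radial_field k b x) = (LINT x|lborel. nabla k (\<phi> n) x \<bullet> radial_field k b x)"
      by (subst integral_ball_eq_lborel) (auto intro!: continuous_intros cont contE)
    ultimately show ?thesis using ibp[OF \<phi>] by simp
  qed
  have "(\<lambda>n. (-1) ^ (Suc k div 2) * (LINT x|?M. nabla k (\<phi> n) x \<bullet> radial_field k b x))
      \<longlonglongrightarrow> (-1) ^ (Suc k div 2) * (LINT x|?M. g x \<bullet> radial_field k b x)"
    by (intro tendsto_intros L1)
  then have "(LINT x|?M. u x \<bullet> norm x ^ (2 * i)) = (-1) ^ (Suc k div 2) * (LINT x|?M. g x \<bullet> radial_field k b x)"
    using L2(1) unfolding eqn using LIMSEQ_unique by blast
  then show "\<exists>b. (\<forall>r. 0 < r \<longrightarrow> r < R \<longrightarrow> 0 \<le> profile k b r \<and> cochain CARD('n) R k (\<lambda>r. ennreal (r ^ (2 * i))) r = ennreal (profile k b r))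
      \<and> integrable ?M (\<lambda>x. u x * norm x ^ (2 * i))
      \<and> integrable ?M (\<lambda>x. (-1) ^ (Suc k div 2) * (g x \<bullet> radial_dir k x) * profile k b (norm x))
      \<and> (LINT x|?M. u x * norm x ^ (2 * i)) = (LINT x|?M. (-1) ^ (Suc k div 2) * (g x \<bullet> radial_dir k x) * profile k b (norm x))"
  proof (intro exI[of _ b] conjI)
    have eq: "(\<lambda>x. (-1) ^ (Suc k div 2) * (g x \<bullet> radial_dir k x) * profile k b (norm x))
        = (\<lambda>x. (-1) ^ (Suc k div 2) * (g x \<bullet> radial_field k b x))"
      by (simp add: radial_field_eq mult_ac)
    show "integrable ?M (\<lambda>x. (-1) ^ (Suc k div 2) * (g x \<bullet> radial_dir k x) * profile k b (norm x))"
      unfolding eq using L1(2) by simp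
    assume "(LINT x|?M. u x \<bullet> norm x ^ (2 * i)) = (-1) ^ (Suc k div 2) * (LINT x|?M. g x \<bullet> radial_field k b x)"
    then show "(LINT x|?M. u x * norm x ^ (2 * i)) = (LINT x|?M. (-1) ^ (Suc k div 2) * (g x \<bullet> radial_dir k x) * profile k b (norm x))"
      unfolding eq by simp
  qed (use b L2(2) in auto)
qed

text \<open>Only the radial density \<open>G\<close> of the radial component of the weak gradient enters the estimate:
  it controls the profile of \<open>u\<close> pointwise, and averaging over spheres does not increase the energy.\<close>

lemma W0_rad_representation:
  fixes u :: "real ^ 'n \<Rightarrow> real"
  assumes u: "u \<in> W0_rad k p R" and g: "has_W0_nabla k p R u g" and p: "1 < p" and R: "0 < R"
  shows "\<exists>U G. U \<in> borel_measurable borel \<and> G \<in> borel_measurable borel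
    \<and> (AE x in lebesgue_on (ball 0 R). u x = U (norm x))
    \<and> (AE r in radial_measure CARD('n) R. ennreal \<bar>U r\<bar> \<le> chain CARD('n) R k G r)
    \<and> (\<integral>\<^sup>+r. epow (G r) p \<partial>radial_measure CARD('n) R) \<le> Lp_energy p R g"
proof -
  let ?M = "lebesgue_on (ball (0 :: real ^ 'n) R)" and ?n = "CARD('n)"
  let ?D = "distr ?M borel norm"
  have finM: "finite_measure ?M" by (rule finite_measure_ball)
  have D: "?D = radial_measure ?n R" by (rule distr_norm_ball[OF R])
  interpret D: finite_measure ?D
    using finM norm_measurable_ball by (rule finite_measure.finite_measure_distr)
  have p1: "1 \<le> p" using p by simp
  note mom = W0_nabla_moments[OF g p1 R]
  have [measurable]: "u \<in> borel_measurable ?M" "g \<in> borel_measurable ?M"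
    using mom(1,2) by auto
  obtain v where "AE x in ?M. u x = v (norm x)" using u unfolding W0_rad_def by blast
  then obtain U where U [measurable]: "U \<in> borel_measurable borel" and uU: "AE x in ?M. u x = U (norm x)"
    using ex_borel_radial_profile[of u R v] by auto
  \<comment> \<open>The radial component of the gradient, with the sign of
    \<open>moment_duality\<close> absorbed.\<close>
  define gt where "gt x = (-1) ^ (Suc k div 2) * (g x \<bullet> radial_dir k x)" for x
  have gt [measurable]: "gt \<in> borel_measurable ?M" unfolding gt_def by measurable
  have gt_le: "\<bar>gt x\<bar> \<le> norm (g x)" for x
  proof -
    have "\<bar>gt x\<bar> \<le> norm (g x) * norm (radial_dir k x)"
      using Cauchy_Schwarz_ineq2 by (simp add: gt_def abs_mult power_abs)
    also have "\<dots> \<le> norm (g x) * 1" using norm_radial_dir by (intro mult_left_mono) auto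
    finally show ?thesis by simp
  qed
  have gt_int: "integrable ?M gt"
    by (rule Bochner_Integration.integrable_bound[OF mom(2)]) (use gt_le in auto)
  obtain Gp where Gp [measurable]: "Gp \<in> borel_measurable borel"
    and Gp': "\<And>h. h \<in> borel_measurable borel \<Longrightarrow> (\<integral>\<^sup>+x. ennreal (max 0 (gt x)) * h (norm x) \<partial>?M) = (\<integral>\<^sup>+r. Gp r * h r \<partial>?D)"
    using ex_pushforward_density[OF finM, of "\<lambda>x. max 0 (gt x)" norm] by auto
  obtain Gm where Gm [measurable]: "Gm \<in> borel_measurable borel"
    and Gm': "\<And>h. h \<in> borel_measurable borel \<Longrightarrow> (\<integral>\<^sup>+x. ennreal (max 0 (- gt x)) * h (norm x) \<partial>?M) = (\<integral>\<^sup>+r. Gm r * h r \<partial>?D)"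
    using ex_pushforward_density[OF finM, of "\<lambda>x. max 0 (- gt x)" norm] by auto
  \<comment> \<open>The spherical average of the absolute value of \<open>gt\<close>, as
    \<open>G'\<close> confirms.\<close>
  define G where "G r = Gp r + Gm r" for r
  have [measurable]: "G \<in> borel_measurable borel" unfolding G_def by measurable
  have G': "(\<integral>\<^sup>+x. ennreal \<bar>gt x\<bar> * h (norm x) \<partial>?M) = (\<integral>\<^sup>+r. G r * h r \<partial>?D)"
    if [measurable]: "h \<in> borel_measurable borel" for h
  proof -
    have "(\<integral>\<^sup>+x. ennreal \<bar>gt x\<bar> * h (norm x) \<partial>?M)
      = (\<integral>\<^sup>+x. ennreal (max 0 (gt x)) * h (norm x) + ennreal (max 0 (- gt x)) * h (norm x) \<partial>?M)"
      by (intro nn_integral_cong) (auto simp: max_def distrib_right[symmetric] simp flip: ennreal_plus)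
    also have "\<dots> = (\<integral>\<^sup>+r. Gp r * h r \<partial>?D) + (\<integral>\<^sup>+r. Gm r * h r \<partial>?D)"
      using Gp'[of h] Gm'[of h] by (simp add: nn_integral_add)
    also have "\<dots> = (\<integral>\<^sup>+r. G r * h r \<partial>?D)"
      by (simp add: nn_integral_add[symmetric] G_def distrib_right)
    finally show ?thesis .
  qed
  have energy: "(\<integral>\<^sup>+r. epow (G r) p \<partial>?D) \<le> Lp_energy p R g"
  proof -
    have "(\<integral>\<^sup>+r. epow (G r) p \<partial>?D) \<le> (\<integral>\<^sup>+x. ennreal (\<bar>gt x\<bar> powr p) \<partial>?M)"
      by (rule pushforward_density_power_le[OF finM]) (use gt_int p G' in auto)
    also have "\<dots> \<le> Lp_energy p R g"
      unfolding Lp_energy_def using gt_le p by (intro nn_integral_mono ennreal_leI powr_mono2) auto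
    finally show ?thesis .
  qed
  \<comment> \<open>The goal is that U equals the chain of \<open>Gp\<close> minus the chain of
    \<open>Gm\<close>. \<open>F1\<close> and \<open>F2\<close> are the two sides after all negative
    terms have changed sides: \<open>ennreal (U r)\<close> and \<open>ennreal (- U r)\<close> are
    the positive and negative part of U.\<close>
  define F1 where "F1 r = ennreal (U r) + chain ?n R k Gm r" for r
  define F2 where "F2 r = ennreal (- U r) + chain ?n R k Gp r" for r
  have [measurable]: "F1 \<in> borel_measurable borel" "F2 \<in> borel_measurable borel"
    unfolding F1_def F2_def by measurable
  have supp: "AE r in ?D. 0 < r \<and> r < R"
    unfolding D by (subst AE_density) (auto simp: power_weight_def sphere_area_def)
  have moments: "(\<integral>\<^sup>+r. F1 r * ennreal (r ^ (2 * i)) \<partial>?D) = (\<integral>\<^sup>+r. F2 r * ennreal (r ^ (2 * i)) \<partial>?D) \<and>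
      (\<integral>\<^sup>+r. F1 r * ennreal (r ^ (2 * i)) \<partial>?D) < \<infinity>" for i
  proof -
    obtain b where b: "\<And>r. 0 < r \<Longrightarrow> r < R \<Longrightarrow> 0 \<le> profile k b r \<and> cochain ?n R k (\<lambda>r. ennreal (r ^ (2 * i))) r = ennreal (profile k b r)"
      and iu: "integrable ?M (\<lambda>x. u x * norm x ^ (2 * i))"
      and ig: "integrable ?M (\<lambda>x. gt x * profile k b (norm x))"
      and eq: "(LINT x|?M. u x * norm x ^ (2 * i)) = (LINT x|?M. gt x * profile k b (norm x))"
      using mom(4)[of i] unfolding gt_def by blast
    have suppM: "AE x in ?M. 0 < norm x \<and> norm x < R"
      using supp by (subst (asm) AE_distr_iff) auto
    have [measurable]: "profile k b \<in> borel_measurable borel"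
      unfolding profile_def[abs_def] by (intro borel_measurable_continuous_onI) (cases "even k"; auto intro!: continuous_intros)
    \<comment> \<open>The adjoint moves the chain onto the power r^(2i), where it becomes the
      polynomial profile that also occurs in the moment identity.\<close>
    have chainint: "(\<integral>\<^sup>+r. chain ?n R k H r * ennreal (r ^ (2 * i)) \<partial>?D) = (\<integral>\<^sup>+x. ennreal (s x) * ennreal (profile k b (norm x)) \<partial>?M)"
      if [measurable]: "H \<in> borel_measurable borel" and H: "\<And>h. h \<in> borel_measurable borel \<Longrightarrow> (\<integral>\<^sup>+x. ennreal (s x) * h (norm x) \<partial>?M) = (\<integral>\<^sup>+r. H r * h r \<partial>?D)" for H s
    proof -
      have dens: "(\<integral>\<^sup>+r. A r * B r \<partial>?D) = ennreal (sphere_area ?n) * (\<integral>\<^sup>+r. A r * B r * ennreal (power_weight R (real ?n - 1) r) \<partial>lborel)"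
        if [measurable]: "A \<in> borel_measurable borel" "B \<in> borel_measurable borel" for A B :: "real \<Rightarrow> ennreal"
        unfolding nn_integral_ball_radial[OF R, where 'n = 'n, of "\<lambda>r. A r * B r", symmetric, simplified]
        by (subst nn_integral_distr) auto
      have "(\<integral>\<^sup>+r. chain ?n R k H r * ennreal (r ^ (2 * i)) \<partial>?D) = (\<integral>\<^sup>+r. H r * cochain ?n R k (\<lambda>r. ennreal (r ^ (2 * i))) r \<partial>?D)"
        by (simp add: dens chain_adjoint)
      also have "\<dots> = (\<integral>\<^sup>+r. H r * ennreal (profile k b r) \<partial>?D)"
        by (intro nn_integral_cong_AE, use supp in eventually_elim) (use b in auto)
      also have "\<dots> = (\<integral>\<^sup>+x. ennreal (s x) * ennreal (profile k b (norm x)) \<partial>?M)"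
        by (rule H[symmetric]) measurable
      finally show ?thesis .
    qed
    have pos: "AE x in ?M. 0 \<le> profile k b (norm x)" using suppM by eventually_elim (use b in auto)
    define a1 where "a1 = (LINT x|?M. max 0 (u x * norm x ^ (2 * i)))"
    define a2 where "a2 = (LINT x|?M. max 0 (- (u x * norm x ^ (2 * i))))"
    define b1 where "b1 = (LINT x|?M. max 0 (gt x * profile k b (norm x)))"
    define b2 where "b2 = (LINT x|?M. max 0 (- (gt x * profile k b (norm x))))"
    have split: "(LINT x|?M. h x) = (LINT x|?M. max 0 (h x)) - (LINT x|?M. max 0 (- h x))" if "integrable ?M h" for h :: "real ^ 'n \<Rightarrow> real"
    proof -
      have "(LINT x|?M. h x) = (LINT x|?M. max 0 (h x) - max 0 (- h x))"
        by (intro Bochner_Integration.integral_cong) auto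
      then show ?thesis using that by (subst (asm) Bochner_Integration.integral_diff) auto
    qed
    have ab: "a1 + b2 = a2 + b1"
      using split[OF iu] split[OF ig] eq unfolding a1_def a2_def b1_def b2_def by simp
    have nn: "(\<integral>\<^sup>+x. ennreal (max 0 (h x)) \<partial>?M) = ennreal (LINT x|?M. max 0 (h x))" if "integrable ?M h" for h :: "real ^ 'n \<Rightarrow> real"
      using that by (intro nn_integral_eq_integral) auto
    have U1: "(\<integral>\<^sup>+r. ennreal (U r) * ennreal (r ^ (2 * i)) \<partial>?D) = ennreal a1"
    proof -
      have "(\<integral>\<^sup>+r. ennreal (U r) * ennreal (r ^ (2 * i)) \<partial>?D) = (\<integral>\<^sup>+x. ennreal (U (norm x)) * ennreal (norm x ^ (2 * i)) \<partial>?M)"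
        by (subst nn_integral_distr) auto
      also have "\<dots> = (\<integral>\<^sup>+x. ennreal (max 0 (u x * norm x ^ (2 * i))) \<partial>?M)"
        by (intro nn_integral_cong_AE, use uU in eventually_elim)
          (auto simp: max_def ennreal_neg zero_le_mult_iff not_le mult_le_0_iff ennreal_mult' simp flip: ennreal_mult'')
      finally show ?thesis using nn[OF iu] by (simp add: a1_def)
    qed
    have U2: "(\<integral>\<^sup>+r. ennreal (- U r) * ennreal (r ^ (2 * i)) \<partial>?D) = ennreal a2"
    proof -
      have "(\<integral>\<^sup>+r. ennreal (- U r) * ennreal (r ^ (2 * i)) \<partial>?D) = (\<integral>\<^sup>+x. ennreal (- U (norm x)) * ennreal (norm x ^ (2 * i)) \<partial>?M)"
        by (subst nn_integral_distr) auto
      also have "\<dots> = (\<integral>\<^sup>+x. ennreal (max 0 (- (u x * norm x ^ (2 * i)))) \<partial>?M)"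
        by (intro nn_integral_cong_AE, use uU in eventually_elim)
          (auto simp: max_def ennreal_neg zero_le_mult_iff not_le mult_le_0_iff ennreal_mult' simp flip: ennreal_mult'')
      finally show ?thesis using nn[of "\<lambda>x. - (u x * norm x ^ (2 * i))"] iu by (simp add: a2_def)
    qed
    have C1: "(\<integral>\<^sup>+r. chain ?n R k Gp r * ennreal (r ^ (2 * i)) \<partial>?D) = ennreal b1"
    proof -
      have "(\<integral>\<^sup>+x. ennreal (max 0 (gt x)) * ennreal (profile k b (norm x)) \<partial>?M) = (\<integral>\<^sup>+x. ennreal (max 0 (gt x * profile k b (norm x))) \<partial>?M)"
        by (intro nn_integral_cong_AE, use pos in eventually_elim)
          (auto simp: max_def ennreal_neg zero_le_mult_iff not_le mult_le_0_iff mult_nonneg_nonpos2 simp flip: ennreal_mult'')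
      moreover have "(\<integral>\<^sup>+r. chain ?n R k Gp r * ennreal (r ^ (2 * i)) \<partial>?D) = (\<integral>\<^sup>+x. ennreal (max 0 (gt x)) * ennreal (profile k b (norm x)) \<partial>?M)"
        by (rule chainint[OF Gp Gp'])
      ultimately show ?thesis using nn[OF ig] by (simp add: b1_def)
    qed
    have C2: "(\<integral>\<^sup>+r. chain ?n R k Gm r * ennreal (r ^ (2 * i)) \<partial>?D) = ennreal b2"
    proof -
      have "(\<integral>\<^sup>+x. ennreal (max 0 (- gt x)) * ennreal (profile k b (norm x)) \<partial>?M) = (\<integral>\<^sup>+x. ennreal (max 0 (- (gt x * profile k b (norm x)))) \<partial>?M)"
        by (intro nn_integral_cong_AE, use pos in eventually_elim)
          (auto simp: max_def ennreal_neg zero_le_mult_iff not_le mult_le_0_iff mult_nonneg_nonpos2 simp flip: ennreal_mult'')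
      moreover have "(\<integral>\<^sup>+r. chain ?n R k Gm r * ennreal (r ^ (2 * i)) \<partial>?D) = (\<integral>\<^sup>+x. ennreal (max 0 (- gt x)) * ennreal (profile k b (norm x)) \<partial>?M)"
        by (rule chainint[OF Gm Gm'])
      ultimately show ?thesis using nn[of "\<lambda>x. - (gt x * profile k b (norm x))"] ig by (simp add: b2_def)
    qed
    have "0 \<le> a1" "0 \<le> a2" "0 \<le> b1" "0 \<le> b2"
      unfolding a1_def a2_def b1_def b2_def by (auto intro!: Bochner_Integration.integral_nonneg)
    moreover have "(\<integral>\<^sup>+r. F1 r * ennreal (r ^ (2 * i)) \<partial>?D) = ennreal a1 + ennreal b2"
      unfolding F1_def distrib_right U1[symmetric] C2[symmetric] by (rule nn_integral_add) measurable
    moreover have "(\<integral>\<^sup>+r. F2 r * ennreal (r ^ (2 * i)) \<partial>?D) = ennreal a2 + ennreal b1"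
      unfolding F2_def distrib_right U2[symmetric] C1[symmetric] by (rule nn_integral_add) measurable
    ultimately show ?thesis using ab by (simp flip: ennreal_plus)
  qed
  have "density ?D F1 = density ?D F2"
  proof (rule moments_determine_measure)
    have fin: "emeasure (density ?D F) (space (density ?D F)) \<noteq> \<infinity>" if "(\<integral>\<^sup>+r. F r * ennreal (r ^ (2 * 0)) \<partial>?D) < \<infinity>" "F \<in> borel_measurable borel" for F
      using that by (auto simp: emeasure_density)
    show "finite_measure (density ?D F1)" "finite_measure (density ?D F2)"
      using moments[of 0] by (intro finite_measureI fin; simp)+
    show "AE r in density ?D F1. 0 < r \<and> r < R" "AE r in density ?D F2. 0 < r \<and> r < R"
    proof -
      have "AE r in density ?D F. 0 < r \<and> r < R" if [measurable]: "F \<in> borel_measurable borel" for F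
      proof -
        have "AE r in ?D. 0 < F r \<longrightarrow> 0 < r \<and> r < R" using supp by eventually_elim auto
        then show ?thesis by (subst AE_density) auto
      qed
      then show "AE r in density ?D F1. 0 < r \<and> r < R" "AE r in density ?D F2. 0 < r \<and> r < R" by auto
    qed
    fix i :: nat
    have real: "(LINT r|density ?D F. r ^ (2 * i)) = enn2real (\<integral>\<^sup>+r. F r * ennreal (r ^ (2 * i)) \<partial>?D)" if "F \<in> borel_measurable borel" for F
      using that by (subst integral_eq_nn_integral) (auto simp: nn_integral_density)
    show "(LINT r|density ?D F1. r ^ (2 * i)) = (LINT r|density ?D F2. r ^ (2 * i))"
      using moments[of i] by (simp add: real)
  qed auto
  then have "AE r in ?D. F1 r = F2 r"
    by (intro D.density_unique) auto
  \<comment> \<open>At each radius one of the two parts of U vanishes, so the equality of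
    \<open>F1\<close> and \<open>F2\<close> bounds |U| by one of the two chains, hence by their
    sum.\<close>
  then have "AE r in ?D. ennreal \<bar>U r\<bar> \<le> chain ?n R k G r"
  proof eventually_elim
    case (elim r)
    have G: "chain ?n R k G r = chain ?n R k Gp r + chain ?n R k Gm r"
      unfolding G_def[abs_def] by (rule chain_add) auto
    show ?case
    proof (cases "0 \<le> U r")
      case True
      then have "ennreal \<bar>U r\<bar> \<le> F1 r" by (simp add: F1_def)
      also have "\<dots> = chain ?n R k Gp r" using elim True by (simp add: F2_def ennreal_neg)
      also have "\<dots> \<le> chain ?n R k G r" by (simp add: G)
      finally show ?thesis .
    next
      case False
      then have "ennreal \<bar>U r\<bar> \<le> F2 r" by (simp add: F2_def)
      also have "\<dots> = chain ?n R k Gm r" using elim False by (simp add: F1_def ennreal_neg)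
      also have "\<dots> \<le> chain ?n R k G r" by (simp add: G)
      finally show ?thesis .
    qed
  qed
  then show ?thesis using uU energy U unfolding D by (intro exI[of _ U] exI[of _ G]) auto
qed

section \<open>The inequality and its strictness\<close>

text \<open>The steps of order 2i and 2i + 1 contribute n - 2i and 2i; paired, they give the factors
  of K.\<close>

lemma prod_step_const:
  "(\<Prod>j=2..2 * m + 1. step_const n j) = (\<Prod>j=1..m. 2 * real j * (n - 2 * real j))"
proof (induction m)
  case (Suc m)
  have "{2..2 * Suc m + 1} = insert (2 * m + 3) (insert (2 * m + 2) {2..2 * m + 1})" by auto
  then show ?case using Suc by (simp add: step_const_def algebra_simps)
qed simp

text \<open>For k = 2m the last pair of \<open>prod_step_const\<close> lacks its odd step 2m + 1,
  whose constant is 2m = k: this is the k in the denominator. The factor (N - k)/N is 1 -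
  1/p.\<close>

lemma rellich_const_eq:
  assumes "1 \<le> m" "k = 2 * m \<or> k = 2 * m + 1" "k < N" "p = real N / real k"
  shows "rellich_const N k m p = Hardy_const (real N) p k powr p"
  using assms(2)
proof
  assume k: "k = 2 * m"
  have "{2..2 * m + 1} = insert (2 * m + 1) {2..2 * m}" using assms(1) by auto
  then have "(\<Prod>j=2..2 * m. step_const (real N) j) * (2 * real m) = (\<Prod>j=1..m. 2 * real j * (real N - 2 * real j))"
    unfolding prod_step_const[symmetric] by (simp add: step_const_def)
  then have "(\<Prod>j=2..2 * m. step_const (real N) j) = (\<Prod>j=1..m. 2 * real j * (real N - 2 * real j)) / real k"
    using assms(1) k by (simp add: field_simps)
  moreover have "1 - 1 / p = (real N - real k) / real N" using assms by (simp add: field_simps)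
  ultimately have "Hardy_const (real N) p k = (real N - real k) / (real k * real N) * (\<Prod>j=1..m. 2 * real j * (real N - 2 * real j))"
    unfolding Hardy_const_def k by simp
  then show ?thesis using k by (simp add: rellich_const_def)
next
  assume k: "k = 2 * m + 1"
  have "1 - 1 / p = (real N - real k) / real N" using assms by (simp add: field_simps)
  then have "Hardy_const (real N) p k = (real N - real k) / real N * (\<Prod>j=1..m. 2 * real j * (real N - 2 * real j))"
    unfolding Hardy_const_def k prod_step_const by simp
  then show ?thesis using k by (simp add: rellich_const_def)
qed

text \<open>For a >= 1 the logarithm is at least ln(R/|x|), so the case a = 1 dominates. The profile
  \<open>U\<close> enters only through its bound \<open>H\<close>.\<close>

lemma log_weight_integral_le:
  fixes u :: "real ^ 'n \<Rightarrow> real"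
  assumes p: "1 < p" and R: "0 < R" and a: "1 \<le> a"
    and [measurable]: "U \<in> borel_measurable borel" "H \<in> borel_measurable borel"
    and uU: "AE x in lebesgue_on (ball 0 R). u x = U (norm x)"
    and UH: "AE r in radial_measure CARD('n) R. ennreal \<bar>U r\<bar> \<le> H r"
  shows "log_weight_integral p a R u \<le> ennreal (sphere_area CARD('n)) * log_energy p R H"
proof -
  let ?n = "CARD('n)"
  have "log_weight_integral p a R u
    = (\<integral>\<^sup>+x. ennreal (\<bar>U (norm x)\<bar> powr p / (norm x ^ ?n * ln (a * R / norm x) powr p)) \<partial>lebesgue_on (ball (0 :: real ^ 'n) R))"
    unfolding log_weight_integral_def by (intro nn_integral_cong_AE, use uU in eventually_elim) auto
  also have "\<dots> = ennreal (sphere_area ?n) *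
      (\<integral>\<^sup>+r. ennreal (\<bar>U r\<bar> powr p / (r ^ ?n * ln (a * R / r) powr p)) * ennreal (power_weight R (real ?n - 1) r) \<partial>lborel)"
    by (rule nn_integral_ball_radial[OF R]) measurable
  also have "\<dots> \<le> ennreal (sphere_area ?n) * log_energy p R H"
    unfolding log_energy_def
  proof (intro mult_left_mono nn_integral_mono_AE)
    have "AE r in lborel. 0 < ennreal (sphere_area ?n * power_weight R (real ?n - 1) r) \<longrightarrow> ennreal \<bar>U r\<bar> \<le> H r"
      using UH by (subst (asm) AE_density) auto
    then show "AE r in lborel. ennreal (\<bar>U r\<bar> powr p / (r ^ ?n * ln (a * R / r) powr p)) * ennreal (power_weight R (real ?n - 1) r)
        \<le> epow (H r) p * ennreal (log_weight R p r)"
    proof eventually_elim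
      case (elim r)
      show ?case
      proof (cases "0 < r \<and> r < R")
        case True
        then have UH: "ennreal \<bar>U r\<bar> \<le> H r" using elim sphere_area_pos[of ?n] by (simp add: power_weight_def)
        have l: "0 < ln (R / r)" "ln (R / r) \<le> ln (a * R / r)"
          using True a mult_right_mono[OF a, of R] by (auto intro!: divide_right_mono)
        have "\<bar>U r\<bar> powr p / (r ^ ?n * ln (a * R / r) powr p) * power_weight R (real ?n - 1) r
            = \<bar>U r\<bar> powr p * (1 / r) / ln (a * R / r) powr p"
          using True by (simp add: power_weight_def powr_diff powr_realpow)
        also have "\<dots> \<le> \<bar>U r\<bar> powr p * (1 / r) / ln (R / r) powr p"
          using True l p by (intro divide_left_mono powr_mono2 mult_pos_pos) auto
        also have "\<dots> = \<bar>U r\<bar> powr p * log_weight R p r"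
          using True by (simp add: log_weight_def powr_minus divide_inverse)
        finally have "ennreal (\<bar>U r\<bar> powr p / (r ^ ?n * ln (a * R / r) powr p)) * ennreal (power_weight R (real ?n - 1) r)
            \<le> ennreal (\<bar>U r\<bar> powr p) * ennreal (log_weight R p r)"
          using True by (simp add: log_weight_def power_weight_def flip: ennreal_mult)
        also have "\<dots> \<le> epow (H r) p * ennreal (log_weight R p r)"
          using epow_mono[OF UH, of p] p by (intro mult_right_mono) (auto simp: epow_ennreal)
        finally show ?thesis .
      qed (auto simp: power_weight_def)
    qed
  qed auto
  finally show ?thesis .
qed

lemma power_energy_radial_measure:
  assumes [measurable]: "G \<in> borel_measurable borel" and "0 < k" "p = real N / real k"
  shows "(\<integral>\<^sup>+r. epow (G r) p \<partial>radial_measure N R) = ennreal (sphere_area N) * power_energy p R k G"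
proof -
  have "real k * p - 1 = real N - 1" using assms by simp
  then have "ennreal (sphere_area N) * power_energy p R k G
      = (\<integral>\<^sup>+r. ennreal (sphere_area N) * (epow (G r) p * ennreal (power_weight R (real N - 1) r)) \<partial>lborel)"
    unfolding power_energy_def by (subst nn_integral_cmult) auto
  also have "\<dots> = (\<integral>\<^sup>+r. epow (G r) p \<partial>radial_measure N R)"
    by (subst nn_integral_density)
      (auto simp: ennreal_mult sphere_area_def power_weight_def mult_ac intro!: nn_integral_cong)
  finally show ?thesis by simp
qed

lemma critical_Rellich:
  fixes u :: "real ^ 'n \<Rightarrow> real"
  assumes k: "2 \<le> k" "k < CARD('n)" and p: "p = real CARD('n) / real k" and R: "0 < R" and a: "1 \<le> a"
    and u: "u \<in> W0_rad k p R" and g: "has_W0_nabla k p R u g"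
  defines "K \<equiv> Hardy_const CARD('n) p k powr p"
  shows "ennreal K * log_weight_integral p a R u \<le> Lp_energy p R g"
    and "\<not> (AE x in lebesgue_on (ball 0 R). u x = 0) \<Longrightarrow> ennreal K * log_weight_integral p a R u < Lp_energy p R g"
proof -
  let ?n = "CARD('n)" and ?s = "ennreal (sphere_area CARD('n))"
  have p1: "1 < p" using k p by simp
  have H: "0 < Hardy_const ?n p k" using k p1 by (intro Hardy_const_pos) auto
  then have K: "0 < K" by (simp add: K_def)
  have s: "0 < ?s" "?s < top" using sphere_area_pos[of ?n] by auto
  obtain U G where [measurable]: "U \<in> borel_measurable borel" "G \<in> borel_measurable borel"
    and uU: "AE x in lebesgue_on (ball 0 R). u x = U (norm x)"
    and UG: "AE r in radial_measure ?n R. ennreal \<bar>U r\<bar> \<le> chain ?n R k G r"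
    and GE: "(\<integral>\<^sup>+r. epow (G r) p \<partial>radial_measure ?n R) \<le> Lp_energy p R g"
    using W0_rad_representation[OF u g p1 R] by blast
  have GE: "?s * power_energy p R k G \<le> Lp_energy p R g"
    using GE k p by (subst (asm) power_energy_radial_measure) auto
  have L: "log_weight_integral p a R u \<le> ?s * log_energy p R (chain ?n R k G)"
    by (rule log_weight_integral_le[OF p1 R a _ _ uU UG]) measurable
  have KH: "ennreal K * (ennreal (1 / Hardy_const ?n p k powr p) * x) = x" for x
    using K by (simp add: K_def mult.assoc[symmetric] flip: ennreal_mult)
  have le: "log_energy p R (chain ?n R k G) \<le> ennreal (1 / Hardy_const ?n p k powr p) * power_energy p R k G"
    using k p1 R by (intro log_energy_chain) auto
  have KL: "ennreal K * log_weight_integral p a R u \<le> ?s * (ennreal K * log_energy p R (chain ?n R k G))"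
    using mult_left_mono[OF L, of "ennreal K"] by (simp add: mult_ac)
  also have "\<dots> \<le> ?s * (ennreal K * (ennreal (1 / Hardy_const ?n p k powr p) * power_energy p R k G))"
    using le by (intro mult_left_mono) auto
  also have "\<dots> = ?s * power_energy p R k G" by (simp only: KH)
  also note GE
  finally show "ennreal K * log_weight_integral p a R u \<le> Lp_energy p R g" .
  assume nz: "\<not> (AE x in lebesgue_on (ball 0 R). u x = 0)"
  have fin: "power_energy p R k G < \<infinity>"
  proof -
    have "?s * power_energy p R k G < \<infinity>"
      using GE W0_nabla_moments(3)[OF g _ R] p1 by (auto intro: le_less_trans)
    then show ?thesis using s by (auto simp: ennreal_mult_less_top)
  qed
  \<comment> \<open>If this energy vanished, so would the weighted integral of u, and then u itself,
    because the weight is positive and finite almost everywhere in the ball.\<close>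
  have "power_energy p R k G \<noteq> 0"
  proof
    assume "power_energy p R k G = 0"
    then have "log_energy p R (chain ?n R k G) = 0" using le by simp
    then have L0: "log_weight_integral p a R u = 0" using L by simp
    have [measurable]: "u \<in> borel_measurable (lebesgue_on (ball 0 R))"
      using W0_nabla_moments(1)[OF g _ R] p1 by auto
    have "AE x in lebesgue_on (ball 0 R). ennreal (\<bar>u x\<bar> powr p / (norm x ^ ?n * ln (a * R / norm x) powr p)) = 0"
      using L0 unfolding log_weight_integral_def by (subst (asm) nn_integral_0_iff_AE) auto
    moreover note AE_ball_norm_pos[OF R, where 'n = 'n]
    ultimately have "AE x in lebesgue_on (ball 0 R). u x = 0"
    proof eventually_elim
      case (elim x)
      have "1 * R \<le> a * R" using a R by (intro mult_right_mono) auto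
      then have "norm x < a * R" using elim(2) by linarith
      then have "1 < a * R / norm x" using elim(2) by simp
      from ln_gt_zero[OF this] have "ln (a * R / norm x) \<noteq> 0" by (rule less_imp_neq[THEN not_sym])
      then have "0 < ln (a * R / norm x) powr p" unfolding powr_gt_zero .
      then have "0 < norm x ^ ?n * ln (a * R / norm x) powr p" using elim(2) by (intro mult_pos_pos) auto
      then have "\<bar>u x\<bar> powr p \<le> 0" using elim by (auto simp: ennreal_eq_0_iff divide_le_0_iff)
      then show ?case by simp
    qed
    then show False using nz by simp
  qed
  then have "log_energy p R (chain ?n R k G) < ennreal (1 / Hardy_const ?n p k powr p) * power_energy p R k G"
    using k p1 R fin by (intro log_energy_chain_strict) auto
  then have "?s * (ennreal K * log_energy p R (chain ?n R k G)) < ?s * (ennreal K * (ennreal (1 / Hardy_const ?n p k powr p) * power_energy p R k G))"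
    using s K by (intro ennreal_mult_strict_left_mono) auto
  also have "\<dots> = ?s * power_energy p R k G" by (simp only: KH)
  also note GE
  finally show "ennreal K * log_weight_integral p a R u < Lp_energy p R g" using KL by (rule le_less_trans[rotated])
qed

section \<open>Smooth functions of one variable\<close>

fun times_diff :: "nat \<Rightarrow> (real \<Rightarrow> real) \<Rightarrow> bool" where
  "times_diff 0 f = True"
| "times_diff (Suc n) f = ((\<forall>x. f differentiable (at x)) \<and> times_diff n (deriv f))"

definition smooth_real :: "(real \<Rightarrow> real) \<Rightarrow> bool" where
  "smooth_real f \<longleftrightarrow> (\<forall>n. times_diff n f)"

lemma times_diff_SucI:
  assumes "\<And>x. (f has_real_derivative f' x) (at x)" "times_diff n f'"
  shows "times_diff (Suc n) f"
proof -
  have "deriv f = f'" using assms(1) DERIV_imp_deriv by blast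
  then show ?thesis using assms real_differentiable_def by auto
qed

lemma times_diff_deriv: "times_diff (Suc n) f \<Longrightarrow> (f has_real_derivative deriv f x) (at x)"
  by (simp add: DERIV_deriv_iff_real_differentiable)

lemma times_diff_Suc: "times_diff (Suc n) f \<Longrightarrow> times_diff n f"
  by (induction n arbitrary: f) auto

lemma times_diff_const: "times_diff n (\<lambda>x. c)"
  by (induction n arbitrary: c) (auto intro!: times_diff_SucI[where f' = "\<lambda>_. 0"] simp del: times_diff.simps(2))

lemma times_diff_add: "times_diff n f \<Longrightarrow> times_diff n g \<Longrightarrow> times_diff n (\<lambda>x. f x + g x)"
proof (induction n arbitrary: f g)
  case (Suc n)
  show ?case
    by (rule times_diff_SucI[where f' = "\<lambda>x. deriv f x + deriv g x"])
      (use Suc times_diff_deriv in \<open>auto intro!: derivative_eq_intros simp: DERIV_deriv_iff_real_differentiable\<close>)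
qed simp

lemma times_diff_mult: "times_diff n f \<Longrightarrow> times_diff n g \<Longrightarrow> times_diff n (\<lambda>x. f x * g x)"
proof (induction n arbitrary: f g)
  case (Suc n)
  show ?case
  proof (rule times_diff_SucI[where f' = "\<lambda>x. deriv f x * g x + deriv g x * f x"])
    show "((\<lambda>x. f x * g x) has_real_derivative deriv f x * g x + deriv g x * f x) (at x)" for x
      using DERIV_mult[OF times_diff_deriv[OF Suc.prems(1)] times_diff_deriv[OF Suc.prems(2)]] by simp
    show "times_diff n (\<lambda>x. deriv f x * g x + deriv g x * f x)"
      using Suc.prems times_diff_Suc[OF Suc.prems(1)] times_diff_Suc[OF Suc.prems(2)]
      by (intro times_diff_add Suc.IH) auto
  qed
qed simp

lemma times_diff_affine: "times_diff n f \<Longrightarrow> times_diff n (\<lambda>x. f (a * x + b))"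
proof (induction n arbitrary: f)
  case (Suc n)
  show ?case
  proof (rule times_diff_SucI[where f' = "\<lambda>x. deriv f (a * x + b) * a"])
    show "((\<lambda>x. f (a * x + b)) has_real_derivative deriv f (a * x + b) * a) (at x)" for x
      by (rule DERIV_chain2[OF times_diff_deriv[OF Suc.prems]]) (auto intro!: derivative_eq_intros)
    show "times_diff n (\<lambda>x. deriv f (a * x + b) * a)"
      using Suc by (intro times_diff_mult times_diff_const) auto
  qed
qed simp

lemma smooth_real_deriv: "smooth_real f \<Longrightarrow> (f has_real_derivative deriv f x) (at x)"
  unfolding smooth_real_def using times_diff_deriv by blast

lemma smooth_real_deriv_smooth: "smooth_real f \<Longrightarrow> smooth_real (deriv f)"
  unfolding smooth_real_def using times_diff.simps(2) by blast

lemma smooth_real_add: "smooth_real f \<Longrightarrow> smooth_real g \<Longrightarrow> smooth_real (\<lambda>x. f x + g x)"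
  by (simp add: smooth_real_def times_diff_add)

lemma smooth_real_mult: "smooth_real f \<Longrightarrow> smooth_real g \<Longrightarrow> smooth_real (\<lambda>x. f x * g x)"
  by (simp add: smooth_real_def times_diff_mult)

lemma smooth_real_cmult: "smooth_real f \<Longrightarrow> smooth_real (\<lambda>x. c * f x)"
  by (simp add: smooth_real_def times_diff_mult times_diff_const)

lemma smooth_real_affine: "smooth_real f \<Longrightarrow> smooth_real (\<lambda>x. f (a * x + b))"
  by (simp add: smooth_real_def times_diff_affine)

lemma smooth_real_continuous: "smooth_real f \<Longrightarrow> continuous_on S f"
  by (meson DERIV_isCont continuous_at_imp_continuous_on smooth_real_deriv)

section \<open>Powers times functions of the logarithm\<close>

definition supported :: "real \<Rightarrow> real \<Rightarrow> (real \<Rightarrow> real) \<Rightarrow> bool" where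
  "supported c d f \<longleftrightarrow> (\<forall>x. x \<notin> {c..d} \<longrightarrow> f x = 0)"

lemma has_real_derivative_supported:
  assumes "supported c d f" "x \<notin> {c..d}"
  shows "(f has_real_derivative 0) (at x)"
proof (rule has_field_derivative_transform_within_open[of "\<lambda>_. 0" 0 x "- {c..d}"])
  show "open (- {c..d})" by (simp add: open_Compl)
qed (use assms in \<open>auto simp: supported_def\<close>)

lemma supported_deriv: "supported c d f \<Longrightarrow> supported c d (deriv f)"
  unfolding supported_def[of c d "deriv f"] using has_real_derivative_supported DERIV_imp_deriv by blast

text \<open>The variable y stands for |x|^2. The shape is stable under differentiation: the exponent
  drops by one and A is replaced by \<alpha> A + A'.\<close>

definition log_profile :: "real \<Rightarrow> (real \<Rightarrow> real) \<Rightarrow> real \<Rightarrow> real" where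
  "log_profile \<alpha> A y = (if 0 < y then y powr \<alpha> * A (ln y) else 0)"

lemma log_profile_supported: "supported c d A \<Longrightarrow> supported (exp c) (exp d) (log_profile \<alpha> A)"
proof -
  have "0 < y \<Longrightarrow> ln y \<in> {c..d} \<longleftrightarrow> y \<in> {exp c..exp d}" for y
    by (metis atLeastAtMost_iff exp_le_cancel_iff exp_ln)
  then show "supported c d A \<Longrightarrow> supported (exp c) (exp d) (log_profile \<alpha> A)"
    unfolding supported_def log_profile_def by auto
qed

text \<open>Since A vanishes far to the left, the function is 0 near y = 0, and the extension by 0
  is differentiable at y <= 0 as well.\<close>

lemma log_profile_has_derivative:
  assumes A: "\<And>s. (A has_real_derivative A' s) (at s)" and "supported c d A"
  shows "(log_profile \<alpha> A has_real_derivative log_profile (\<alpha> - 1) (\<lambda>s. \<alpha> * A s + A' s) y) (at y)"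
proof (cases "0 < y")
  case True
  have "((\<lambda>y. A (ln y)) has_real_derivative A' (ln y) * (1 / y)) (at y)"
    by (rule DERIV_chain2[OF A]) (use True in \<open>auto intro!: derivative_eq_intros\<close>)
  then have "((\<lambda>y. y powr \<alpha> * A (ln y)) has_real_derivative log_profile (\<alpha> - 1) (\<lambda>s. \<alpha> * A s + A' s) y) (at y)"
    using True by (auto intro!: derivative_eq_intros simp: log_profile_def powr_diff field_simps)
  then show ?thesis
    by (rule has_field_derivative_transform_within_open[of _ _ _ "{0<..}"]) (use True in \<open>auto simp: log_profile_def\<close>)
next
  case False
  then have "y \<notin> {exp c..exp d}" by (metis atLeastAtMost_iff exp_gt_zero less_le_trans)
  then show ?thesis using has_real_derivative_supported[OF log_profile_supported[OF assms(2)], of y \<alpha>] False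
    by (simp add: log_profile_def)
qed

lemma deriv_log_profile:
  assumes "\<And>s. (A has_real_derivative A' s) (at s)" and "supported c d A"
  shows "deriv (log_profile \<alpha> A) = log_profile (\<alpha> - 1) (\<lambda>s. \<alpha> * A s + A' s)"
  using log_profile_has_derivative[OF assms] DERIV_imp_deriv by blast

lemma smooth_log_profile:
  assumes "smooth_real A" "supported c d A"
  shows "smooth_real (log_profile \<alpha> A)"
proof -
  have "times_diff n (log_profile \<alpha> A)" for n
    using assms
  proof (induction n arbitrary: \<alpha> A)
    case (Suc n)
    have "supported c d (\<lambda>s. \<alpha> * A s + deriv A s)"
      using Suc.prems(2) supported_deriv[OF Suc.prems(2)] by (simp add: supported_def)
    moreover have "smooth_real (\<lambda>s. \<alpha> * A s + deriv A s)"
      using Suc.prems by (intro smooth_real_add smooth_real_cmult smooth_real_deriv_smooth)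
    ultimately show ?case
      by (intro times_diff_SucI[OF log_profile_has_derivative[OF smooth_real_deriv[OF Suc.prems(1)] Suc.prems(2)]] Suc.IH)
  qed simp
  then show ?thesis by (simp add: smooth_real_def)
qed

section \<open>A smooth bump function\<close>

text \<open>The polynomial makes the class closed under differentiation: with w = 1/x, the
  derivative of P(w) exp(-w) in x is w^2 (P - P')(w) exp(-w).\<close>

definition flat_function :: "real poly \<Rightarrow> real \<Rightarrow> real" where
  "flat_function P x = (if 0 < x then poly P (1 / x) * exp (- (1 / x)) else 0)"

lemma poly_mult_exp_tendsto_0: "((\<lambda>w. poly P w * exp (- w)) \<longlongrightarrow> 0) (at_top :: real filter)"
proof -
  have "((\<lambda>w. \<Sum>i\<le>degree P. coeff P i * (w ^ i / exp w)) \<longlongrightarrow> (\<Sum>i\<le>degree P. coeff P i * 0)) (at_top :: real filter)"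
    by (intro tendsto_sum tendsto_mult tendsto_const tendsto_power_div_exp_0)
  then show ?thesis by (simp add: poly_altdef exp_minus divide_inverse sum_distrib_right mult.assoc)
qed

lemma flat_function_has_derivative:
  "(flat_function P has_real_derivative flat_function ([:0, 0, 1:] * (P - pderiv P)) x) (at x)"
proof -
  consider "0 < x" | "x < 0" | "x = 0" by linarith
  then show ?thesis
  proof cases
    case 1
    have "((\<lambda>x. poly P (1 / x)) has_real_derivative poly (pderiv P) (1 / x) * (- 1 / x\<^sup>2)) (at x)"
      by (rule DERIV_chain2[OF poly_DERIV]) (use 1 in \<open>auto intro!: derivative_eq_intros simp: power2_eq_square\<close>)
    then have "((\<lambda>x. poly P (1 / x) * exp (- (1 / x))) has_real_derivative flat_function ([:0, 0, 1:] * (P - pderiv P)) x) (at x)"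
      using 1 by (auto intro!: derivative_eq_intros simp: flat_function_def field_simps power2_eq_square)
    then show ?thesis
      by (rule has_field_derivative_transform_within_open[of _ _ _ "{0<..}"]) (use 1 in \<open>auto simp: flat_function_def\<close>)
  next
    case 2
    then have "flat_function ([:0, 0, 1:] * (P - pderiv P)) x = 0" by (simp add: flat_function_def)
    moreover have "(flat_function P has_real_derivative 0) (at x)"
      by (rule has_field_derivative_transform_within_open[of "\<lambda>_. 0" 0 x "{..<0}"]) (use 2 in \<open>auto simp: flat_function_def\<close>)
    ultimately show ?thesis by simp
  next
    case 3
    \<comment> \<open>The difference quotient at 0 from the right is again of the form Q(w) exp(-w),
      with Q(w) = w P(w) and w = 1/h.\<close>
    have r: "((\<lambda>h. flat_function P h / h) \<longlongrightarrow> 0) (at_right 0)"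
    proof (rule Lim_transform_eventually)
      have "filterlim (\<lambda>h :: real. 1 / h) at_top (at_right 0)" by real_asymp
      from filterlim_compose[OF poly_mult_exp_tendsto_0[of "[:0, 1:] * P"] this]
      show "((\<lambda>h. poly ([:0, 1:] * P) (1 / h) * exp (- (1 / h))) \<longlongrightarrow> 0) (at_right 0)" .
      show "\<forall>\<^sub>F h in at_right 0. poly ([:0, 1:] * P) (1 / h) * exp (- (1 / h)) = flat_function P h / h"
        using eventually_at_right_less[of 0] by eventually_elim (simp add: flat_function_def)
    qed
    have l: "((\<lambda>h. flat_function P h / h) \<longlongrightarrow> 0) (at_left 0)"
      by (rule Lim_transform_eventually[OF tendsto_const])
        (auto simp: eventually_at_filter flat_function_def)
    have "((\<lambda>h. flat_function P h / h) \<longlongrightarrow> 0) (at 0)"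
      using l r by (rule filterlim_split_at)
    then show ?thesis using 3 by (simp add: DERIV_def flat_function_def)
  qed
qed

lemma smooth_flat_function: "smooth_real (flat_function P)"
proof -
  have "times_diff n (flat_function P)" for n
    by (induction n arbitrary: P) (auto intro: times_diff_SucI[OF flat_function_has_derivative] simp del: times_diff.simps(2))
  then show ?thesis by (simp add: smooth_real_def)
qed

definition bump :: "real \<Rightarrow> real" where
  "bump x = flat_function 1 x * flat_function 1 (- 1 * x + 1)"

lemma smooth_bump: "smooth_real bump"
  unfolding bump_def[abs_def] by (intro smooth_real_mult smooth_real_affine smooth_flat_function)

lemma supported_bump: "supported 0 1 bump"
  by (auto simp: supported_def bump_def flat_function_def)

lemma bump_nonneg: "0 \<le> bump x"
  by (simp add: bump_def flat_function_def)

lemma bump_pos: "0 < x \<Longrightarrow> x < 1 \<Longrightarrow> 0 < bump x"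
  by (simp add: bump_def flat_function_def)

section \<open>Families depending polynomially on a scale parameter\<close>

text \<open>Polynomials in e whose coefficients are fixed smooth functions supported in {c..d}. The
  shape survives derivatives in t and is jointly continuous up to e = 0, which permits the limit in
  the rescaled integrals.\<close>

inductive scale_family :: "real \<Rightarrow> real \<Rightarrow> (real \<Rightarrow> real \<Rightarrow> real) \<Rightarrow> bool" for c d where
  const: "smooth_real F \<Longrightarrow> supported c d F \<Longrightarrow> scale_family c d (\<lambda>e. F)"
| add: "scale_family c d P \<Longrightarrow> scale_family c d Q \<Longrightarrow> scale_family c d (\<lambda>e t. P e t + Q e t)"
| cmult: "scale_family c d P \<Longrightarrow> scale_family c d (\<lambda>e t. x * P e t)"
| scale: "scale_family c d P \<Longrightarrow> scale_family c d (\<lambda>e t. e * P e t)"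

lemma scale_family_smooth: "scale_family c d P \<Longrightarrow> smooth_real (P e)"
  by (induction rule: scale_family.induct) (auto intro: smooth_real_add smooth_real_cmult)

lemma scale_family_supported: "scale_family c d P \<Longrightarrow> supported c d (P e)"
  by (induction rule: scale_family.induct) (auto simp: supported_def)

lemma scale_family_deriv: "scale_family c d P \<Longrightarrow> scale_family c d (\<lambda>e. deriv (P e))"
proof (induction rule: scale_family.induct)
  case (const F)
  then show ?case by (intro scale_family.const smooth_real_deriv_smooth supported_deriv)
next
  case (add P Q)
  have "deriv (\<lambda>t. P e t + Q e t) = (\<lambda>t. deriv (P e) t + deriv (Q e) t)" for e
    using DERIV_add[OF smooth_real_deriv[OF scale_family_smooth[OF add(1)]] smooth_real_deriv[OF scale_family_smooth[OF add(2)]]] DERIV_imp_deriv by blast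
  then show ?case using scale_family.add[OF add(3,4)] by simp
next
  case (cmult P x)
  have "deriv (\<lambda>t. x * P e t) = (\<lambda>t. x * deriv (P e) t)" for e
    using DERIV_cmult[OF smooth_real_deriv[OF scale_family_smooth[OF cmult(1)]]] DERIV_imp_deriv by blast
  then show ?case using scale_family.cmult[OF cmult(2)] by simp
next
  case (scale P)
  have "deriv (\<lambda>t. e * P e t) = (\<lambda>t. e * deriv (P e) t)" for e
    using DERIV_cmult[OF smooth_real_deriv[OF scale_family_smooth[OF scale(1)]]] DERIV_imp_deriv by blast
  then show ?case using scale_family.scale[OF scale(2)] by simp
qed

lemma scale_family_continuous:
  "scale_family c d P \<Longrightarrow> continuous_on S (\<lambda>(e, t). P e t)"
proof (induction rule: scale_family.induct)
  case (const F)
  then show ?case unfolding case_prod_beta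
    by (intro continuous_on_compose2[OF smooth_real_continuous[of F UNIV]]) (auto intro: continuous_intros)
qed (auto simp: case_prod_beta intro!: continuous_intros)

section \<open>Logarithmic substitution\<close>

text \<open>The logarithm transports the measure dr/r to Lebesgue measure; on intervals this is the
  integral of 1/r, and intervals determine Lebesgue measure.\<close>

lemma nn_integral_log_subst:
  assumes [measurable]: "f \<in> borel_measurable borel"
  shows "(\<integral>\<^sup>+r. f (ln r) * (ennreal (1 / r) * indicator {0<..} r) \<partial>lborel) = (\<integral>\<^sup>+s. f s \<partial>lborel)"
proof -
  let ?D = "distr (density lborel (\<lambda>r. ennreal (1 / r) * indicator {0<..} r)) borel ln"
  have "lborel = ?D"
  proof (rule lborel_eqI)
    fix l u :: real assume "\<And>b. b \<in> Basis \<Longrightarrow> l \<bullet> b \<le> u \<bullet> b"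
    then have lu: "l \<le> u" by simp
    have "(\<lambda>r :: real. ln r) \<in> borel_measurable borel" by measurable
    then have [measurable]: "ln -` {l<..<u} \<in> sets borel"
      using measurable_sets[of ln borel borel "{l<..<u}"] by simp
    have "emeasure ?D (box l u) = (\<integral>\<^sup>+r. ennreal (1 / r) * indicator {0<..} r * indicator (ln -` {l<..<u}) r \<partial>lborel)"
      by (subst emeasure_distr) (auto simp: emeasure_density box_real)
    also have "\<dots> = (\<integral>\<^sup>+r. ennreal (1 / r) * indicator {exp l<..<exp u} r \<partial>lborel)"
    proof (intro nn_integral_cong)
      fix r :: real
      have "0 < r \<Longrightarrow> l < ln r \<longleftrightarrow> exp l < r" "0 < r \<Longrightarrow> ln r < u \<longleftrightarrow> r < exp u"
        by (metis exp_less_cancel_iff exp_ln)+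
      moreover have "exp l < r \<Longrightarrow> 0 < r" using exp_gt_zero[of l] by (rule less_trans)
      ultimately show "ennreal (1 / r) * indicator {0<..} r * indicator (ln -` {l<..<u}) r = ennreal (1 / r) * indicator {exp l<..<exp u} r"
        by (auto simp: indicator_def)
    qed
    also have "\<dots> = ennreal (u - l)"
    proof (cases "l = u")
      case False
      have "(\<integral>\<^sup>+r. ennreal (1 / r) * indicator {exp l<..<exp u} r \<partial>lborel) = ennreal (ln (exp u) - ln (exp l))"
      proof (rule nn_integral_FTC_open)
        have pos: "exp l < r \<Longrightarrow> 0 < r" for r using exp_gt_zero[of l] by (rule less_trans)
        show "(ln has_real_derivative 1 / r) (at r)" if "exp l < r" for r
          using pos[OF that] by (auto intro!: derivative_eq_intros)
        show "isCont (\<lambda>r. 1 / r) r" "0 \<le> 1 / r" if "exp l < r" for r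
          using pos[OF that] by (auto intro!: continuous_intros)
        show "(ln \<longlongrightarrow> ln (exp l)) (at_right (exp l))" "(ln \<longlongrightarrow> ln (exp u)) (at_left (exp u))"
          by (intro tendsto_intros; simp)+
      qed (use lu False in auto)
      then show ?thesis by simp
    qed simp
    finally show "emeasure ?D (box l u) = ennreal (\<Prod>b\<in>Basis. (u - l) \<bullet> b)" by simp
  qed auto
  then have "(\<integral>\<^sup>+s. f s \<partial>lborel) = (\<integral>\<^sup>+s. f s \<partial>?D)" by simp
  also have "\<dots> = (\<integral>\<^sup>+r. f (ln r) * (ennreal (1 / r) * indicator {0<..} r) \<partial>lborel)"
    by (subst nn_integral_distr) (auto simp: nn_integral_density mult.commute)
  finally show ?thesis by simp
qed

lemma nn_integral_log_affine_subst:
  assumes [measurable]: "f \<in> borel_measurable borel" and "c \<noteq> 0"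
  shows "(\<integral>\<^sup>+r. f (b + c * ln r) * (ennreal (1 / r) * indicator {0<..} r) \<partial>lborel) = ennreal (1 / \<bar>c\<bar>) * (\<integral>\<^sup>+s. f s \<partial>lborel)"
proof -
  have "(\<integral>\<^sup>+s. f s \<partial>lborel) = ennreal \<bar>c\<bar> * (\<integral>\<^sup>+s. f (b + c * s) \<partial>lborel)"
    by (rule nn_integral_real_affine) (use assms in auto)
  then have "ennreal (1 / \<bar>c\<bar>) * (\<integral>\<^sup>+s. f s \<partial>lborel) = (\<integral>\<^sup>+s. f (b + c * s) \<partial>lborel)"
    using assms(2) by (simp add: mult.assoc[symmetric] flip: ennreal_mult)
  also have "\<dots> = (\<integral>\<^sup>+r. f (b + c * ln r) * (ennreal (1 / r) * indicator {0<..} r) \<partial>lborel)"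
    by (rule nn_integral_log_subst[symmetric]) measurable
  finally show ?thesis by simp
qed

lemma nn_integral_supported:
  fixes f :: "real \<Rightarrow> real"
  assumes f: "continuous_on {c..d} f" "\<And>x. 0 \<le> f x" "supported c d f"
  shows "(\<integral>\<^sup>+x. ennreal (f x) \<partial>lborel) = ennreal (integral {c..d} f)"
proof -
  have "(\<integral>\<^sup>+x. ennreal (f x) \<partial>lborel) = (\<integral>\<^sup>+x. ennreal (indicator {c..d} x *\<^sub>R f x) \<partial>lborel)"
    using f(3) by (intro nn_integral_cong) (auto simp: supported_def indicator_def)
  also have "\<dots> = ennreal (integral {c..d} f)"
  proof -
    have int: "set_integrable lborel {c..d} f"
      using borel_integrable_compact[of "{c..d}" f] f(1) by (simp add: set_integrable_def)
    then have "(\<integral>\<^sup>+x. ennreal (indicator {c..d} x *\<^sub>R f x) \<partial>lborel) = ennreal (LINT x|lborel. indicator {c..d} x *\<^sub>R f x)"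
      using f(2) by (intro nn_integral_eq_integral) (auto simp: set_integrable_def)
    then show ?thesis using set_borel_integral_eq_integral(2)[OF int] by (simp add: set_lebesgue_integral_def)
  qed
  finally show ?thesis .
qed

section \<open>Iterated Laplacians of logarithmic profiles\<close>

inductive radial_class :: "(real ^ 'n \<Rightarrow> real) \<Rightarrow> bool" where
  base: "smooth_real h \<Longrightarrow> radial_class (\<lambda>x. h (x \<bullet> x))"
| coord: "radial_class f \<Longrightarrow> radial_class (\<lambda>x. x $ i * f x)"
| cmult: "radial_class f \<Longrightarrow> radial_class (\<lambda>x. c * f x)"
| add: "radial_class f \<Longrightarrow> radial_class g \<Longrightarrow> radial_class (\<lambda>x. f x + g x)"

lemma radial_class_differentiable: "radial_class f \<Longrightarrow> f differentiable (at x)"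
proof (induction rule: radial_class.induct)
  case (base h)
  show ?case using radial_has_derivative[OF smooth_real_deriv[OF base]] by (rule differentiableI)
next
  case (coord f i)
  then show ?case by (intro differentiable_mult differentiableI[OF coordinate_has_derivative])
qed (auto intro: differentiable_mult differentiable_add)

lemma radial_class_pderiv_at: "radial_class f \<Longrightarrow> radial_class (pderiv_at j f)"
proof (induction rule: radial_class.induct)
  case (base h)
  have "pderiv_at j (\<lambda>x :: real ^ 'a. h (x \<bullet> x)) = (\<lambda>x. 2 * (x $ j * deriv h (x \<bullet> x)))"
    using pderiv_at_radial[OF smooth_real_deriv[OF base]] by (auto simp: mult.assoc)
  then show ?case using base by (simp add: radial_class.intros smooth_real_deriv_smooth)
next
  case (coord f i)
  have "pderiv_at j (\<lambda>x. x $ i * f x) = (\<lambda>x. x $ i * pderiv_at j f x + (if i = j then 1 else 0) * f x)"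
    using pderiv_at_mult[OF differentiableI[OF coordinate_has_derivative] radial_class_differentiable[OF coord(1)]]
    by (auto simp: pderiv_at_coordinate)
  then show ?case using coord by (simp only: radial_class.intros)
next
  case (cmult f c)
  have "pderiv_at j (\<lambda>x. c * f x) = (\<lambda>x. c * pderiv_at j f x)"
    using pderiv_at_mult[OF differentiable_const radial_class_differentiable[OF cmult(1)]]
    by (auto simp: pderiv_at_def[of _ "\<lambda>x. c"])
  then show ?case using cmult by (simp only: radial_class.intros)
next
  case (add f g)
  have "pderiv_at j (\<lambda>x. f x + g x) = (\<lambda>x. pderiv_at j f x + pderiv_at j g x)"
    using pderiv_at_add radial_class_differentiable add by blast
  then show ?case using add by (simp only: radial_class.intros)
qed

lemma smooth_radial: "smooth_real h \<Longrightarrow> smooth (\<lambda>x :: real ^ 'n. h (x \<bullet> x))"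
  by (rule smooth_coinduct[where S = "Collect radial_class"])
    (auto intro: radial_class.base radial_class_pderiv_at radial_class_differentiable)

lemma gradient_radial:
  assumes "smooth_real h"
  shows "gradient (\<lambda>x :: real ^ 'n. h (x \<bullet> x)) x = (2 * deriv h (x \<bullet> x)) *\<^sub>R x"
  by (simp add: gradient_def pderiv_at_radial[OF smooth_real_deriv[OF assms]] vec_eq_iff)

lemma laplacian_radial:
  assumes "smooth_real h"
  shows "laplacian (\<lambda>x :: real ^ 'n. h (x \<bullet> x))
    = (\<lambda>x. 4 * (x \<bullet> x) * deriv (deriv h) (x \<bullet> x) + 2 * real CARD('n) * deriv h (x \<bullet> x))"
proof
  fix x :: "real ^ 'n"
  have 1: "pderiv_at i (\<lambda>x :: real ^ 'n. h (x \<bullet> x)) = (\<lambda>x. x $ i * (2 * deriv h (x \<bullet> x)))" for i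
    by (simp add: fun_eq_iff pderiv_at_radial[OF smooth_real_deriv[OF assms]])
  have 2: "smooth_real (\<lambda>y. 2 * deriv h y)"
    using assms by (intro smooth_real_cmult smooth_real_deriv_smooth)
  have d2: "((\<lambda>y. 2 * deriv h y) has_real_derivative 2 * deriv (deriv h) y) (at y)" for y
    by (intro DERIV_cmult smooth_real_deriv smooth_real_deriv_smooth assms)
  have "pderiv_at i (pderiv_at i (\<lambda>x :: real ^ 'n. h (x \<bullet> x))) x
      = 4 * (x $ i)\<^sup>2 * deriv (deriv h) (x \<bullet> x) + 2 * deriv h (x \<bullet> x)" for i
    unfolding 1
    by (subst pderiv_at_mult)
      (auto simp: pderiv_at_radial[OF d2] pderiv_at_coordinate power2_eq_square
        intro: differentiableI[OF coordinate_has_derivative]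
          differentiableI[OF radial_has_derivative[OF smooth_real_deriv[OF smooth_real_deriv_smooth[OF assms]]]])
  then show "laplacian (\<lambda>x :: real ^ 'n. h (x \<bullet> x)) x
      = 4 * (x \<bullet> x) * deriv (deriv h) (x \<bullet> x) + 2 * real CARD('n) * deriv h (x \<bullet> x)"
    by (simp add: laplacian_def sum.distrib inner_vec_def power2_eq_square sum_distrib_left sum_distrib_right mult_ac)
qed

text \<open>In the variable s = ln |x|^2 the Laplacian acts on A with constant coefficients. The
  coefficient of A itself is 2 \<alpha> (2 \<alpha> + N - 2), as for the pure power |x|^(2
  \<alpha>), and vanishes for \<alpha> = 0.\<close>

lemma laplacian_log_profile:
  assumes A: "smooth_real A" "supported c d A"
  shows "laplacian (\<lambda>x :: real ^ 'n. log_profile \<alpha> A (x \<bullet> x))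
    = (\<lambda>x. log_profile (\<alpha> - 1) (\<lambda>s. 4 * deriv (deriv A) s + (8 * \<alpha> - 4 + 2 * real CARD('n)) * deriv A s
        + (4 * \<alpha> * (\<alpha> - 1) + 2 * real CARD('n) * \<alpha>) * A s) (x \<bullet> x))"
proof -
  define A1 where "A1 s = \<alpha> * A s + deriv A s" for s
  have A1: "smooth_real A1" "supported c d A1"
    using A supported_deriv[OF A(2)] unfolding A1_def
    by (auto intro: smooth_real_add smooth_real_cmult smooth_real_deriv_smooth simp: supported_def)
  have dA1: "deriv A1 = (\<lambda>s. \<alpha> * deriv A s + deriv (deriv A) s)"
    unfolding A1_def using DERIV_add[OF DERIV_cmult[OF smooth_real_deriv[OF A(1)]] smooth_real_deriv[OF smooth_real_deriv_smooth[OF A(1)]]]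
      DERIV_imp_deriv by blast
  have d1: "deriv (log_profile \<alpha> A) = log_profile (\<alpha> - 1) A1"
    unfolding A1_def by (rule deriv_log_profile[OF smooth_real_deriv[OF A(1)] A(2)])
  have d2: "deriv (log_profile (\<alpha> - 1) A1) = log_profile (\<alpha> - 2) (\<lambda>s. (\<alpha> - 1) * A1 s + deriv A1 s)"
    using deriv_log_profile[OF smooth_real_deriv[OF A1(1)] A1(2), of "\<alpha> - 1"] by simp
  show ?thesis
    unfolding laplacian_radial[OF smooth_log_profile[OF A]] d1 d2
  proof
    fix x :: "real ^ 'n"
    have "(x \<bullet> x) * (x \<bullet> x) powr (\<alpha> - 2) = (x \<bullet> x) powr (\<alpha> - 1)" if "0 < x \<bullet> x"
    proof -
      have "(x \<bullet> x) powr (\<alpha> - 1) = (x \<bullet> x) powr (1 + (\<alpha> - 2))" by simp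
      then show ?thesis using that by (simp only: powr_add powr_one)
    qed
    note pw = this[symmetric]
    show "4 * (x \<bullet> x) * log_profile (\<alpha> - 2) (\<lambda>s. (\<alpha> - 1) * A1 s + deriv A1 s) (x \<bullet> x) + 2 * real CARD('n) * log_profile (\<alpha> - 1) A1 (x \<bullet> x)
      = log_profile (\<alpha> - 1) (\<lambda>s. 4 * deriv (deriv A) s + (8 * \<alpha> - 4 + 2 * real CARD('n)) * deriv A s
        + (4 * \<alpha> * (\<alpha> - 1) + 2 * real CARD('n) * \<alpha>) * A s) (x \<bullet> x)"
      by (cases "x = 0") (simp_all add: log_profile_def dA1 A1_def pw algebra_simps)
  qed
qed

section \<open>Slowly varying functions of the logarithm\<close>

lemma deriv_affine:
  assumes "smooth_real f"
  shows "deriv (\<lambda>s. f (a * s + b)) = (\<lambda>s. a * deriv f (a * s + b))"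
proof
  fix s
  have "((\<lambda>s. f (a * s + b)) has_real_derivative deriv f (a * s + b) * a) (at s)"
    by (rule DERIV_chain2[OF smooth_real_deriv[OF assms]]) (auto intro!: derivative_eq_intros)
  then show "deriv (\<lambda>s. f (a * s + b)) s = a * deriv f (a * s + b)" using DERIV_imp_deriv by (simp add: mult.commute)
qed

lemma supported_affine:
  assumes "supported c d f" "0 < e"
  shows "supported (L - d / e) (L - c / e) (\<lambda>s. f ((- e) * s + e * L))"
  unfolding supported_def
proof (intro allI impI)
  fix s assume "s \<notin> {L - d / e..L - c / e}"
  then have "(- e) * s + e * L \<notin> {c..d}" using assms(2) by (auto simp: field_simps)
  then show "f ((- e) * s + e * L) = 0" using assms(1) by (simp add: supported_def)
qed

lemma deriv_cmult_smooth:
  "smooth_real f \<Longrightarrow> deriv (\<lambda>s. c * f s) = (\<lambda>s. c * deriv f s)"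
  using DERIV_cmult[OF smooth_real_deriv] DERIV_imp_deriv by blast

text \<open>For \<open>L = ln (R\<^sup>2)\<close> this is \<psi>(2 e ln(R/|x|)) away from the
  origin, written as a profile in |x|^2 to fit \<open>laplacian_log_profile\<close>.\<close>

abbreviation log_scaled :: "(real \<Rightarrow> real) \<Rightarrow> real \<Rightarrow> real \<Rightarrow> real ^ 'n \<Rightarrow> real" where
  "log_scaled \<psi> e L \<equiv> \<lambda>x. log_profile 0 (\<lambda>s. \<psi> ((- e) * s + e * L)) (x \<bullet> x)"

text \<open>At the first Laplacian the exponent is 0, so there is no zero-order term and the chain
  rule gives a factor e, with leading coefficient 4 - 2N of \<psi>'. At e = 0 each later Laplacian
  multiplies by its zero-order coefficient, which is minus a product of two consecutive step
  constants. The additional 2 is due to ln |x|^2 = 2 ln |x|.\<close>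

lemma laplacian_power_scaled:
  assumes \<psi>: "smooth_real \<psi>" "supported c d \<psi>"
  shows "\<exists>P \<kappa>. scale_family c d P \<and> \<bar>\<kappa>\<bar> = 2 * \<bar>\<Prod>j=2..2 * Suc m. step_const CARD('n) j\<bar> \<and> (\<forall>t. P 0 t = \<kappa> * deriv \<psi> t) \<and>
    (\<forall>e>0. (laplacian ^^ Suc m) (log_scaled \<psi> e L :: real ^ 'n \<Rightarrow> real)
      = (\<lambda>x. log_profile (- real (Suc m)) (\<lambda>s. e * P e ((- e) * s + e * L)) (x \<bullet> x)))"
proof (induction m)
  case 0
  let ?N = "real CARD('n)"
  define P where "P e t = (4 * (e * deriv (deriv \<psi>) t)) + (4 - 2 * ?N) * deriv \<psi> t" for e t
  have P: "scale_family c d P"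
    unfolding P_def[abs_def]
    using \<psi> by (intro scale_family.add scale_family.cmult scale_family.scale scale_family.const
        smooth_real_deriv_smooth supported_deriv)
  have "(laplacian ^^ Suc 0) (log_scaled \<psi> e L :: real ^ 'n \<Rightarrow> real)
      = (\<lambda>x. log_profile (- real (Suc 0)) (\<lambda>s. e * P e ((- e) * s + e * L)) (x \<bullet> x))" if e: "0 < e" for e
  proof -
    have s: "smooth_real (\<lambda>s. \<psi> ((- e) * s + e * L))" by (rule smooth_real_affine[OF \<psi>(1)])
    have dd: "deriv (\<lambda>s. (- e) * deriv \<psi> ((- e) * s + e * L)) = (\<lambda>s. (- e) * ((- e) * deriv (deriv \<psi>) ((- e) * s + e * L)))"
      using deriv_cmult_smooth[OF smooth_real_affine[OF smooth_real_deriv_smooth[OF \<psi>(1)]], of "- e" "- e" "e * L"]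
        deriv_affine[OF smooth_real_deriv_smooth[OF \<psi>(1)], of "- e" "e * L"] by simp
    show ?thesis
      using laplacian_log_profile[OF s supported_affine[OF \<psi>(2) e], of 0, where 'n = 'n]
      unfolding deriv_affine[OF \<psi>(1)] dd by (simp add: P_def algebra_simps)
  qed
  moreover have "\<bar>4 - 2 * ?N\<bar> = 2 * \<bar>\<Prod>j=2..2 * Suc 0. step_const ?N j\<bar>"
    using abs_mult[of "-2" "?N - 2"] by (simp add: step_const_def algebra_simps)
  moreover have "P 0 t = (4 - 2 * ?N) * deriv \<psi> t" for t by (simp add: P_def)
  ultimately show ?case using P by (intro exI[of _ P] exI[of _ "4 - 2 * ?N"] conjI) auto
next
  case (Suc m)
  let ?N = "real CARD('n)"
  from Suc obtain P \<kappa> where all: "scale_family c d P \<and> \<bar>\<kappa>\<bar> = 2 * \<bar>\<Prod>j=2..2 * Suc m. step_const ?N j\<bar> \<and> (\<forall>t. P 0 t = \<kappa> * deriv \<psi> t) \<and>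
    (\<forall>e>0. (laplacian ^^ Suc m) (log_scaled \<psi> e L :: real ^ 'n \<Rightarrow> real)
      = (\<lambda>x. log_profile (- real (Suc m)) (\<lambda>s. e * P e ((- e) * s + e * L)) (x \<bullet> x)))"
    by (elim exE)
  note P = conjunct1[OF all] and \<kappa> = conjunct1[OF conjunct2[OF all]]
    and P0 = spec[OF conjunct1[OF conjunct2[OF conjunct2[OF all]]]]
    and lap = mp[OF spec[OF conjunct2[OF conjunct2[OF conjunct2[OF all]]]]]
  define \<alpha> where "\<alpha> = - real (Suc m)"
  define q where "q = 4 * \<alpha> * (\<alpha> - 1) + 2 * ?N * \<alpha>"
  \<comment> \<open>Each derivative of the profile brings a factor -e, so at e = 0 only the
    zero-order term with coefficient \<open>q\<close> remains.\<close>
  define Q where "Q e t = 4 * (e * (e * deriv (deriv (P e)) t)) + ((-1) * (8 * \<alpha> - 4 + 2 * ?N)) * (e * deriv (P e) t) + q * P e t" for e t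
  have Q: "scale_family c d Q"
    unfolding Q_def[abs_def]
    by (intro scale_family.add scale_family.cmult scale_family.scale scale_family_deriv P)
  have step: "laplacian (\<lambda>x :: real ^ 'n. log_profile \<alpha> (\<lambda>s. e * P e ((- e) * s + e * L)) (x \<bullet> x))
      = (\<lambda>x. log_profile (\<alpha> - 1) (\<lambda>s. e * Q e ((- e) * s + e * L)) (x \<bullet> x))" if e: "0 < e" for e
  proof -
    have sP: "smooth_real (P e)" "smooth_real (deriv (P e))"
      using scale_family_smooth[OF P] smooth_real_deriv_smooth by auto
    have s: "smooth_real (\<lambda>s. e * P e ((- e) * s + e * L))"
      by (intro smooth_real_cmult smooth_real_affine sP)
    have supp: "supported (L - d / e) (L - c / e) (\<lambda>s. e * P e ((- e) * s + e * L))"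
      using supported_affine[OF scale_family_supported[OF P] e] by (simp add: supported_def)
    have d1: "deriv (\<lambda>s. e * P e ((- e) * s + e * L)) = (\<lambda>s. e * (- e) * deriv (P e) ((- e) * s + e * L))"
      using deriv_cmult_smooth[OF smooth_real_affine[OF sP(1)], of e "- e" "e * L"]
        deriv_affine[OF sP(1), of "- e" "e * L"] by (simp add: mult.assoc)
    have d2: "deriv (\<lambda>s. e * (- e) * deriv (P e) ((- e) * s + e * L)) = (\<lambda>s. e * (- e) * ((- e) * deriv (deriv (P e)) ((- e) * s + e * L)))"
      using deriv_cmult_smooth[OF smooth_real_affine[OF sP(2)], of "e * (- e)" "- e" "e * L"]
        deriv_affine[OF sP(2), of "- e" "e * L"] by simp
    show ?thesis
      unfolding laplacian_log_profile[OF s supp] d1 d2 by (simp add: Q_def q_def algebra_simps)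
  qed
  have "(laplacian ^^ Suc (Suc m)) (log_scaled \<psi> e L :: real ^ 'n \<Rightarrow> real)
      = (\<lambda>x. log_profile (- real (Suc (Suc m))) (\<lambda>s. e * Q e ((- e) * s + e * L)) (x \<bullet> x))" if e: "0 < e" for e
  proof -
    have "(laplacian ^^ Suc (Suc m)) (log_scaled \<psi> e L :: real ^ 'n \<Rightarrow> real)
       = laplacian ((laplacian ^^ Suc m) (log_scaled \<psi> e L :: real ^ 'n \<Rightarrow> real))" by simp
    also have "\<dots> = (\<lambda>x. log_profile (\<alpha> - 1) (\<lambda>s. e * Q e ((- e) * s + e * L)) (x \<bullet> x))"
      unfolding lap[OF e] using step[OF e] by (simp only: \<alpha>_def)
    also have "\<alpha> - 1 = - real (Suc (Suc m))" by (simp add: \<alpha>_def)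
    finally show ?thesis .
  qed
  moreover have "Q 0 t = (q * \<kappa>) * deriv \<psi> t" for t by (simp add: Q_def P0)
  moreover have "\<bar>q * \<kappa>\<bar> = 2 * \<bar>\<Prod>j=2..2 * Suc (Suc m). step_const ?N j\<bar>"
  proof -
    have "{2..2 * Suc (Suc m)} = insert (2 * m + 4) (insert (2 * m + 3) {2..2 * Suc m})" by auto
    then have prod: "(\<Prod>j=2..2 * Suc (Suc m). step_const ?N j) = step_const ?N (2 * m + 4) * (step_const ?N (2 * m + 3) * (\<Prod>j=2..2 * Suc m. step_const ?N j))"
      by simp
    have "- q = step_const ?N (2 * m + 4) * step_const ?N (2 * m + 3)"
      by (simp add: q_def \<alpha>_def step_const_def algebra_simps)
    then have q: "\<bar>q\<bar> = \<bar>step_const ?N (2 * m + 4)\<bar> * \<bar>step_const ?N (2 * m + 3)\<bar>" by (metis abs_minus_cancel abs_mult)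
    show ?thesis unfolding prod abs_mult q \<kappa> by (simp only: mult_ac)
  qed
  ultimately show ?case using Q by (intro exI[of _ Q] exI[of _ "q * \<kappa>"] conjI allI impI)
qed

text \<open>For odd k the final gradient acts at leading order on |x|^(1-k) and contributes k - 1,
  the constant of the odd step. For p = N/k the p-th power of |x|^(-k) is |x|^(-N), as the
  logarithmic substitution requires.\<close>

lemma nabla_scaled:
  assumes \<psi>: "smooth_real \<psi>" "supported c d \<psi>" and k: "2 \<le> k"
  shows "\<exists>Q. scale_family c d Q \<and> (\<forall>t. \<bar>Q 0 t\<bar> = 2 * \<bar>\<Prod>j=2..k. step_const CARD('n) j\<bar> * \<bar>deriv \<psi> t\<bar>) \<and>
    (\<forall>e>0. \<forall>x :: real ^ 'n. x \<noteq> 0 \<longrightarrow> norm (nabla k (log_scaled \<psi> e L) x)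
      = norm x powr (- real k) * (e * \<bar>Q e ((- e) * ln (x \<bullet> x) + e * L)\<bar>))"
proof -
  let ?N = "real CARD('n)"
  define m where "m = k div 2 - 1"
  have km: "k div 2 = Suc m" using k by (simp add: m_def)
  from laplacian_power_scaled[OF \<psi>, where 'n = 'n and L = L and m = m] obtain P \<kappa> where all: "scale_family c d P \<and> \<bar>\<kappa>\<bar> = 2 * \<bar>\<Prod>j=2..2 * Suc m. step_const ?N j\<bar> \<and> (\<forall>t. P 0 t = \<kappa> * deriv \<psi> t) \<and>
    (\<forall>e>0. (laplacian ^^ Suc m) (log_scaled \<psi> e L :: real ^ 'n \<Rightarrow> real)
      = (\<lambda>x. log_profile (- real (Suc m)) (\<lambda>s. e * P e ((- e) * s + e * L)) (x \<bullet> x)))"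
    by (elim exE)
  note P = conjunct1[OF all] and \<kappa> = conjunct1[OF conjunct2[OF all]]
    and P0 = spec[OF conjunct1[OF conjunct2[OF conjunct2[OF all]]]]
    and lap = mp[OF spec[OF conjunct2[OF conjunct2[OF conjunct2[OF all]]]]]
  have pw: "(x \<bullet> x) powr b = norm x powr (2 * b)" if "x \<noteq> 0" for x :: "real ^ 'n" and b
  proof -
    have "x \<bullet> x = norm x powr 2" using that by (simp add: dot_square_norm)
    then show ?thesis by (simp only: powr_powr)
  qed
  show ?thesis
  proof (cases "even k")
    case True
    then have k2: "k = 2 * Suc m" using km by auto
    have "norm (nabla k (log_scaled \<psi> e L) x)
      = norm x powr (- real k) * (e * \<bar>P e ((- e) * ln (x \<bullet> x) + e * L)\<bar>)" if "0 < e" "x \<noteq> 0" for e and x :: "real ^ 'n"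
    proof -
      have "nabla k (log_scaled \<psi> e L) x
        = (log_profile (- real (Suc m)) (\<lambda>s. e * P e ((- e) * s + e * L)) (x \<bullet> x), 0)"
        unfolding nabla_def km lap[OF that(1)] if_P[OF True] ..
      moreover have "log_profile (- real (Suc m)) (\<lambda>s. e * P e ((- e) * s + e * L)) (x \<bullet> x)
        = norm x powr (- real k) * (e * P e ((- e) * ln (x \<bullet> x) + e * L))"
      proof -
        have "2 * - real (Suc m) = - real k" using k2 by simp
        then have "(x \<bullet> x) powr (- real (Suc m)) = norm x powr (- real k)"
          using pw[OF that(2), of "- real (Suc m)"] by (simp only:)
        then show ?thesis using that(2) by (simp add: log_profile_def)
      qed
      ultimately show ?thesis using that by (simp add: norm_Pair abs_mult)
    qed
    moreover have "\<bar>P 0 t\<bar> = 2 * \<bar>\<Prod>j=2..k. step_const ?N j\<bar> * \<bar>deriv \<psi> t\<bar>" for t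
      unfolding P0 abs_mult \<kappa> k2 ..
    ultimately show ?thesis using P by (intro exI[of _ P] conjI allI impI)
  next
    case False
    then have k2: "k = Suc (2 * Suc m)" using km by presburger
    define Q where "Q e t = (-2) * (e * deriv (P e) t) + (- 2 * real (Suc m)) * P e t" for e t
    have Q: "scale_family c d Q"
      unfolding Q_def[abs_def] by (intro scale_family.add scale_family.cmult scale_family.scale scale_family_deriv P)
    have "norm (nabla k (log_scaled \<psi> e L) x)
      = norm x powr (- real k) * (e * \<bar>Q e ((- e) * ln (x \<bullet> x) + e * L)\<bar>)" if e: "0 < e" "x \<noteq> 0" for e and x :: "real ^ 'n"
    proof -
      have sP: "smooth_real (P e)" using scale_family_smooth[OF P] by auto
      have s: "smooth_real (\<lambda>s. e * P e ((- e) * s + e * L))" by (intro smooth_real_cmult smooth_real_affine sP)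
      have supp: "supported (L - d / e) (L - c / e) (\<lambda>s. e * P e ((- e) * s + e * L))"
        using supported_affine[OF scale_family_supported[OF P] e(1)] by (simp add: supported_def)
      have d1: "deriv (\<lambda>s. e * P e ((- e) * s + e * L)) = (\<lambda>s. e * (- e) * deriv (P e) ((- e) * s + e * L))"
        using deriv_cmult_smooth[OF smooth_real_affine[OF sP(1)], of e "- e" "e * L"]
          deriv_affine[OF sP(1), of "- e" "e * L"] by (simp add: mult.assoc)
      have "nabla k (log_scaled \<psi> e L) x
        = (0, (2 * log_profile (- real (Suc m) - 1) (\<lambda>s. - real (Suc m) * (e * P e ((- e) * s + e * L)) + e * (- e) * deriv (P e) ((- e) * s + e * L)) (x \<bullet> x)) *\<^sub>R x)"
        unfolding nabla_def km lap[OF e(1)] if_not_P[OF False] gradient_radial[OF smooth_log_profile[OF s supp]]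
          deriv_log_profile[OF smooth_real_deriv[OF s] supp] d1 ..
      then have N: "norm (nabla k (log_scaled \<psi> e L) x) = \<bar>2 * log_profile (- real (Suc m) - 1) (\<lambda>s. - real (Suc m) * (e * P e ((- e) * s + e * L)) + e * (- e) * deriv (P e) ((- e) * s + e * L)) (x \<bullet> x)\<bar> * norm x"
        by (simp add: norm_Pair)
      have V: "2 * log_profile (- real (Suc m) - 1) (\<lambda>s. - real (Suc m) * (e * P e ((- e) * s + e * L)) + e * (- e) * deriv (P e) ((- e) * s + e * L)) (x \<bullet> x)
          = (x \<bullet> x) powr (- real (Suc m) - 1) * (e * Q e ((- e) * ln (x \<bullet> x) + e * L))"
      proof -
        have "0 < x \<bullet> x" using e by simp
        then show ?thesis unfolding log_profile_def Q_def if_P[OF \<open>0 < x \<bullet> x\<close>] by algebra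
      qed
      have W: "(x \<bullet> x) powr (- real (Suc m) - 1) * norm x = norm x powr (- real k)"
      proof -
        have "norm x powr (2 * (- real (Suc m) - 1)) * norm x powr 1 = norm x powr (- real k)"
          unfolding powr_add[symmetric] k2 by (intro arg_cong2[where f = "(powr)"]) simp_all
        moreover have "norm x powr 1 = norm x" by simp
        ultimately show ?thesis unfolding pw[OF e(2)] by (simp only:)
      qed
      show ?thesis unfolding N V W[symmetric] using e by (simp add: abs_mult)
    qed
    moreover have "\<bar>Q 0 t\<bar> = 2 * \<bar>\<Prod>j=2..k. step_const ?N j\<bar> * \<bar>deriv \<psi> t\<bar>" for t
    proof -
      have "{2..k} = insert (Suc (2 * Suc m)) {2..2 * Suc m}" by (auto simp: k2)
      then have prod: "(\<Prod>j=2..k. step_const ?N j) = step_const ?N (Suc (2 * Suc m)) * (\<Prod>j=2..2 * Suc m. step_const ?N j)"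
        by simp
      have "Q 0 t = - (step_const ?N (Suc (2 * Suc m)) * (\<kappa> * deriv \<psi> t))" by (simp add: Q_def P0 step_const_def algebra_simps)
      then show ?thesis unfolding prod by (simp only: abs_minus_cancel abs_mult \<kappa> mult_ac)
    qed
    ultimately show ?thesis using Q by (intro exI[of _ Q] conjI allI impI)
  qed
qed

section \<open>Optimality of the constant\<close>

lemma test_function_W0_rad:
  fixes h :: "real \<Rightarrow> real"
  assumes "(\<lambda>x :: real ^ 'n. h (x \<bullet> x)) \<in> test_functions R"
  shows "(\<lambda>x :: real ^ 'n. h (x \<bullet> x)) \<in> W0_rad k p R"
    and "has_W0_nabla k p R (\<lambda>x :: real ^ 'n. h (x \<bullet> x)) (nabla k (\<lambda>x. h (x \<bullet> x)))"
proof -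
  let ?u = "\<lambda>x :: real ^ 'n. h (x \<bullet> x)"
  have "?u \<in> borel_measurable (lebesgue_on (ball 0 R))"
    by (intro continuous_measurable_ball smooth_continuous test_functions_smooth[OF assms])
  moreover have "nabla k ?u \<in> borel_measurable (lebesgue_on (ball 0 R))"
    by (intro continuous_measurable_ball continuous_nabla[OF assms])
  ultimately show nab: "has_W0_nabla k p R ?u (nabla k ?u)"
    unfolding has_W0_nabla_def Lp_converges_def using assms
    by (intro exI[of _ "\<lambda>_. ?u"]) (simp add: Lp_energy_def)
  have "\<exists>v :: real \<Rightarrow> real. AE x in lebesgue_on (ball 0 R). ?u x = v (norm x)"
    by (rule exI[of _ "\<lambda>r. h (r\<^sup>2)"]) (simp add: power2_norm_eq_inner)
  then show "?u \<in> W0_rad k p R"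
    unfolding W0_rad_def W0_def using nab by blast
qed

text \<open>The lower bound c > 0 of the support of \<psi> makes the function vanish for |x| near R;
  the upper bound d makes it vanish near the origin.\<close>

lemma scaled_test_function:
  assumes \<psi>: "smooth_real \<psi>" "supported c d \<psi>" and "0 < c" "0 < e" "0 < R"
  shows "(log_scaled \<psi> e (ln (R\<^sup>2)) :: real ^ 'n \<Rightarrow> real) \<in> test_functions R"
  unfolding test_functions_iff
proof (intro conjI exI allI impI)
  let ?A = "\<lambda>s. \<psi> ((- e) * s + e * ln (R\<^sup>2))"
  have A: "smooth_real ?A" "supported (ln (R\<^sup>2) - d / e) (ln (R\<^sup>2) - c / e) ?A"
    by (rule smooth_real_affine[OF \<psi>(1)], rule supported_affine[OF \<psi>(2) \<open>0 < e\<close>])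
  show "smooth (\<lambda>x :: real ^ 'n. log_profile 0 ?A (x \<bullet> x))"
    by (rule smooth_radial[OF smooth_log_profile[OF A]])
  let ?r = "sqrt (exp (ln (R\<^sup>2) - c / e))"
  have "ln (R\<^sup>2) - c / e < ln (R\<^sup>2)" using assms by simp
  then have "exp (ln (R\<^sup>2) - c / e) < exp (ln (R\<^sup>2))" by (simp only: exp_less_cancel_iff)
  also have "\<dots> = R\<^sup>2" using assms by simp
  finally have lt: "exp (ln (R\<^sup>2) - c / e) < R\<^sup>2" .
  show "?r < R" by (rule real_less_lsqrt[OF _ lt]) (use assms in auto)
  fix x :: "real ^ 'n" assume "?r < norm x"
  then have "?r < sqrt ((norm x)\<^sup>2)" by simp
  then have "exp (ln (R\<^sup>2) - c / e) < (norm x)\<^sup>2" by (simp only: real_sqrt_less_iff)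
  then show "log_profile 0 ?A (x \<bullet> x) = 0"
    using log_profile_supported[OF A(2), of 0] by (auto simp: supported_def power2_norm_eq_inner)
qed

text \<open>The substitution t = 2 e ln(R/|x|) turns |x|^(-N) dx into a multiple of dt, with the
  same factor for both sides of the inequality.\<close>

lemma nn_integral_ball_log:
  fixes f :: "real \<Rightarrow> real" and F :: "real ^ 'n \<Rightarrow> ennreal"
  assumes R: "0 < R" and e: "0 < e" and f [measurable]: "f \<in> borel_measurable borel"
    and f0: "\<And>t. 0 \<le> f t" "\<And>t. t \<le> 0 \<Longrightarrow> f t = 0"
    and F: "\<And>x. 0 < norm x \<Longrightarrow> norm x < R \<Longrightarrow> F x = ennreal (f (2 * e * ln (R / norm x)) / norm x ^ CARD('n))"
  shows "(\<integral>\<^sup>+x. F x \<partial>lebesgue_on (ball 0 R)) = ennreal (sphere_area CARD('n) / (2 * e)) * (\<integral>\<^sup>+t. ennreal (f t) \<partial>lborel)"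
proof -
  let ?n = "CARD('n)"
  have "(\<integral>\<^sup>+x. F x \<partial>lebesgue_on (ball 0 R))
      = (\<integral>\<^sup>+x. ennreal (f (2 * e * ln (R / norm x)) / norm x ^ ?n) \<partial>lebesgue_on (ball (0 :: real ^ 'n) R))"
    by (intro nn_integral_cong_AE, use AE_ball_norm_pos[OF R, where 'n = 'n] in eventually_elim) (use F in auto)
  also have "\<dots> = ennreal (sphere_area ?n) * (\<integral>\<^sup>+r. ennreal (f (2 * e * ln (R / r)) / r ^ ?n) * ennreal (power_weight R (real ?n - 1) r) \<partial>lborel)"
    by (rule nn_integral_ball_radial[OF R]) measurable
  also have "(\<integral>\<^sup>+r. ennreal (f (2 * e * ln (R / r)) / r ^ ?n) * ennreal (power_weight R (real ?n - 1) r) \<partial>lborel)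
      = (\<integral>\<^sup>+r. ennreal (f (2 * e * ln R + (- 2 * e) * ln r)) * (ennreal (1 / r) * indicator {0<..} r) \<partial>lborel)"
  proof (intro nn_integral_cong)
    fix r :: real
    have ln: "2 * e * ln (R / r) = 2 * e * ln R + (- 2 * e) * ln r" if "0 < r"
      using that R by (simp add: ln_div algebra_simps)
    consider "r \<le> 0" | "0 < r" "r < R" | "R \<le> r" "0 < r" by linarith
    then show "ennreal (f (2 * e * ln (R / r)) / r ^ ?n) * ennreal (power_weight R (real ?n - 1) r)
        = ennreal (f (2 * e * ln R + (- 2 * e) * ln r)) * (ennreal (1 / r) * indicator {0<..} r)"
    proof cases
      case 2
      have "f (2 * e * ln (R / r)) / r ^ ?n * r powr (real ?n - 1) = f (2 * e * ln (R / r)) * (1 / r)"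
        using 2 by (simp add: powr_diff powr_realpow)
      then show ?thesis using 2 f0 by (simp add: ln power_weight_def flip: ennreal_mult)
    next
      case 3
      \<comment> \<open>Radii beyond R correspond to t <= 0, where f vanishes, in agreement with the
        cutoff of \<open>power_weight\<close>.\<close>
      have "2 * e * ln (R / r) \<le> 0" using 3 R e by (simp add: mult_nonneg_nonpos)
      then have "f (2 * e * ln R + (- 2 * e) * ln r) = 0" using f0(2) ln[OF 3(2)] by simp
      then show ?thesis using 3 by (simp add: power_weight_def)
    qed (auto simp: power_weight_def)
  qed
  also have "\<dots> = ennreal (1 / \<bar>- 2 * e\<bar>) * (\<integral>\<^sup>+t. ennreal (f t) \<partial>lborel)"
    by (rule nn_integral_log_affine_subst) (use e in auto)
  finally show ?thesis using e sphere_area_pos[of ?n] by (simp add: mult.assoc[symmetric] flip: ennreal_mult)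
qed

lemma nn_integral_scaled:
  fixes h :: "real \<Rightarrow> real"
  assumes "h \<in> borel_measurable borel" "\<And>t. 0 \<le> h t" "(\<integral>\<^sup>+t. ennreal (h t) \<partial>lborel) = ennreal I"
    and "0 \<le> I" "0 \<le> s" "0 \<le> c"
  shows "ennreal s * (\<integral>\<^sup>+t. ennreal (c * h t) \<partial>lborel) = ennreal (s * (c * I))"
proof -
  have "(\<integral>\<^sup>+t. ennreal (c * h t) \<partial>lborel) = ennreal c * ennreal I"
    unfolding assms(3)[symmetric] using assms by (simp add: ennreal_mult nn_integral_cmult)
  then show ?thesis using assms by (simp add: ennreal_mult)
qed

text \<open>The inequality tested with \<open>log_scaled\<close>. Since ln(aR/|x|) = (2 e ln a +
  t)/(2 e), the left side acquires (2 e)^p; its e^p cancels against the gradient energy and 2^p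
  stays. The parameter a survives only in the shift 2 e ln a.\<close>

lemma scaled_inequality:
  assumes k: "2 \<le> k" "k < CARD('n)" and p: "p = real CARD('n) / real k" and R: "0 < R" and a: "1 \<le> a"
    and C: "0 \<le> C" "\<And>u g. u \<in> (W0_rad k p R :: (real ^ 'n \<Rightarrow> real) set) \<Longrightarrow> has_W0_nabla k p R u g \<Longrightarrow>
          ennreal C * log_weight_integral p a R u \<le> Lp_energy p R g"
    and \<psi>: "smooth_real \<psi>" "supported c d \<psi>" "0 < c"
    and Q: "scale_family c d Q"
    and nab: "\<And>e x. 0 < e \<Longrightarrow> x \<noteq> 0 \<Longrightarrow>
      norm (nabla k (log_scaled \<psi> e (ln (R\<^sup>2)) :: real ^ 'n \<Rightarrow> real) x)
      = norm x powr (- real k) * (e * \<bar>Q e ((- e) * ln (x \<bullet> x) + e * ln (R\<^sup>2))\<bar>)"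
    and e: "0 < e"
  shows "C * 2 powr p * integral {c..d} (\<lambda>t. \<bar>\<psi> t\<bar> powr p / (2 * e * ln a + t) powr p)
    \<le> integral {c..d} (\<lambda>t. \<bar>Q e t\<bar> powr p)"
proof -
  let ?n = "CARD('n)" and ?s = "sphere_area CARD('n)"
  define u where "u = (log_scaled \<psi> e (ln (R\<^sup>2)) :: real ^ 'n \<Rightarrow> real)"
  have p1: "1 < p" using k p by simp
  have test: "u \<in> test_functions R" unfolding u_def by (rule scaled_test_function[OF \<psi> e R])
  have main: "ennreal C * log_weight_integral p a R u \<le> Lp_energy p R (nabla k u)"
    using C(2) test_function_W0_rad[of "log_profile 0 (\<lambda>s. \<psi> ((- e) * s + e * ln (R\<^sup>2)))" R k p] test unfolding u_def by blast
  have arg: "(- e) * ln (x \<bullet> x) + e * ln (R\<^sup>2) = 2 * e * ln (R / norm x)" if "0 < norm x" for x :: "real ^ 'n"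
  proof -
    have "ln (x \<bullet> x) = 2 * ln (norm x)" using that by (simp add: dot_square_norm ln_realpow)
    moreover have "ln (R\<^sup>2) = 2 * ln R" using R by (simp add: ln_realpow)
    ultimately show ?thesis using that R by (simp add: ln_div algebra_simps)
  qed
  have la: "0 \<le> ln a" using a by simp
  have supQ: "supported c d (Q e)" using scale_family_supported[OF Q] .
  have contQ: "continuous_on UNIV (Q e)" by (rule smooth_real_continuous[OF scale_family_smooth[OF Q]])
  have cont\<psi>: "continuous_on UNIV \<psi>" by (rule smooth_real_continuous[OF \<psi>(1)])
  have [measurable]: "Q e \<in> borel_measurable borel" "\<psi> \<in> borel_measurable borel"
    using contQ cont\<psi> by (auto intro: borel_measurable_continuous_onI)
  define fQ where "fQ t = \<bar>Q e t\<bar> powr p" for t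
  define f\<psi> where "f\<psi> t = \<bar>\<psi> t\<bar> powr p / (2 * e * ln a + t) powr p" for t
  have cQ: "continuous_on {c..d} fQ"
    unfolding fQ_def using p1 by (intro continuous_on_powr' continuous_intros continuous_on_subset[OF contQ]) auto
  have c\<psi>: "continuous_on {c..d} f\<psi>"
    unfolding f\<psi>_def using p1 la e \<psi>(3)
    by (intro continuous_on_divide continuous_on_powr' continuous_intros continuous_on_subset[OF cont\<psi>])
      (auto simp: add_nonneg_eq_0_iff intro: add_nonneg_nonneg)
  have IQ: "(\<integral>\<^sup>+t. ennreal (fQ t) \<partial>lborel) = ennreal (integral {c..d} fQ)"
    by (rule nn_integral_supported[OF cQ]) (use supQ in \<open>auto simp: fQ_def supported_def\<close>)
  have I\<psi>: "(\<integral>\<^sup>+t. ennreal (f\<psi> t) \<partial>lborel) = ennreal (integral {c..d} f\<psi>)"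
    by (rule nn_integral_supported[OF c\<psi>]) (use \<psi>(2) in \<open>auto simp: f\<psi>_def supported_def\<close>)
  have "Lp_energy p R (nabla k u) = ennreal (?s / (2 * e)) * (\<integral>\<^sup>+t. ennreal (e powr p * fQ t) \<partial>lborel)"
    unfolding Lp_energy_def
  proof (rule nn_integral_ball_log[OF R e])
    show "(\<lambda>t. e powr p * fQ t) \<in> borel_measurable borel" unfolding fQ_def by measurable
    show "e powr p * fQ t = 0" if "t \<le> 0" for t using supQ that \<psi>(3) by (auto simp: fQ_def supported_def)
    fix x :: "real ^ 'n" assume x: "0 < norm x" "norm x < R"
    have "norm (nabla k u x) = norm x powr (- real k) * (e * \<bar>Q e (2 * e * ln (R / norm x))\<bar>)"
      using nab[OF e, of x] x unfolding u_def arg[OF x(1)] by simp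
    then have "norm (nabla k u x) powr p = (norm x powr (- real k)) powr p * (e * \<bar>Q e (2 * e * ln (R / norm x))\<bar>) powr p"
      using e by (simp only: powr_mult powr_ge_zero mult_nonneg_nonneg abs_ge_zero less_imp_le)
    also have "(norm x powr (- real k)) powr p = 1 / norm x ^ ?n"
    proof -
      have e1: "(- real k) * p = - real ?n" using p k by simp
      show ?thesis unfolding powr_powr e1 using x by (simp add: powr_minus powr_realpow divide_inverse)
    qed
    finally show "ennreal (norm (nabla k u x) powr p) = ennreal (e powr p * fQ (2 * e * ln (R / norm x)) / norm x ^ ?n)"
      using e by (simp add: fQ_def powr_mult)
  qed (auto simp: fQ_def)
  also have "\<dots> = ennreal (?s / (2 * e) * (e powr p * integral {c..d} fQ))"
  proof -
    have "0 \<le> integral {c..d} fQ" by (intro integral_nonneg integrable_continuous_real cQ) (simp add: fQ_def)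
    then show ?thesis using e sphere_area_pos[of ?n]
      by (intro nn_integral_scaled[OF _ _ IQ]) (auto simp: fQ_def[abs_def])
  qed
  finally have E: "Lp_energy p R (nabla k u) = ennreal (?s / (2 * e) * (e powr p * integral {c..d} fQ))" .
  have "log_weight_integral p a R u = ennreal (?s / (2 * e)) * (\<integral>\<^sup>+t. ennreal ((2 * e) powr p * f\<psi> t) \<partial>lborel)"
    unfolding log_weight_integral_def
  proof (rule nn_integral_ball_log[OF R e])
    show "(\<lambda>t. (2 * e) powr p * f\<psi> t) \<in> borel_measurable borel" unfolding f\<psi>_def by measurable
    show "(2 * e) powr p * f\<psi> t = 0" if "t \<le> 0" for t using \<psi>(2,3) that by (auto simp: f\<psi>_def supported_def)
    fix x :: "real ^ 'n" assume x: "0 < norm x" "norm x < R"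
    let ?t = "2 * e * ln (R / norm x)"
    have ux: "u x = \<psi> ?t" using x by (simp add: u_def log_profile_def flip: arg)
    have "0 < ln (R / norm x)" by (rule ln_gt_zero) (use x in simp)
    then have pos: "0 < 2 * e * ln a + ?t" using e la by (intro add_nonneg_pos) auto
    have "2 * e * ln a + ?t = 2 * e * ln (a * R / norm x)"
      using x R a by (simp add: ln_div ln_mult algebra_simps)
    then have l: "ln (a * R / norm x) = (2 * e * ln a + ?t) / (2 * e)" using e by simp
    have "ln (a * R / norm x) powr p = (2 * e * ln a + ?t) powr p / (2 * e) powr p"
      unfolding l using pos e by (simp add: powr_divide)
    then show "ennreal (\<bar>u x\<bar> powr p / (norm x ^ ?n * ln (a * R / norm x) powr p)) = ennreal ((2 * e) powr p * f\<psi> ?t / norm x ^ ?n)"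
      by (simp add: ux f\<psi>_def mult_ac)
  qed (auto simp: f\<psi>_def)
  also have "\<dots> = ennreal (?s / (2 * e) * ((2 * e) powr p * integral {c..d} f\<psi>))"
  proof -
    have "0 \<le> integral {c..d} f\<psi>" by (intro integral_nonneg integrable_continuous_real c\<psi>) (simp add: f\<psi>_def)
    then show ?thesis using e sphere_area_pos[of ?n]
      by (intro nn_integral_scaled[OF _ _ I\<psi>]) (auto simp: f\<psi>_def[abs_def])
  qed
  finally have L: "log_weight_integral p a R u = ennreal (?s / (2 * e) * ((2 * e) powr p * integral {c..d} f\<psi>))" .
  have nnQ: "0 \<le> integral {c..d} fQ" by (intro integral_nonneg integrable_continuous_real cQ) (simp add: fQ_def)
  have "ennreal (C * (?s / (2 * e) * ((2 * e) powr p * integral {c..d} f\<psi>))) \<le> ennreal (?s / (2 * e) * (e powr p * integral {c..d} fQ))"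
    using main unfolding L E ennreal_mult'[OF C(1), symmetric] .
  then have "C * (?s / (2 * e) * ((2 * e) powr p * integral {c..d} f\<psi>)) \<le> ?s / (2 * e) * (e powr p * integral {c..d} fQ)"
    using e sphere_area_pos[of ?n] nnQ by (subst (asm) ennreal_le_iff) auto
  then have "(?s / (2 * e) * e powr p) * (C * 2 powr p * integral {c..d} f\<psi>) \<le> (?s / (2 * e) * e powr p) * integral {c..d} fQ"
    using e by (simp add: powr_mult mult_ac)
  moreover have "0 < ?s / (2 * e) * e powr p" using e sphere_area_pos[of ?n] by simp
  ultimately show ?thesis unfolding fQ_def f\<psi>_def by (simp only: mult_le_cancel_left_pos)
qed

lemma limit_inequality:
  fixes f g :: "real \<Rightarrow> real"
  assumes "continuous_on {0..1} f" "continuous_on {0..1} g" "\<And>e. 0 < e \<Longrightarrow> f e \<le> g e"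
  shows "f 0 \<le> g 0"
proof -
  have lim: "(\<lambda>n. 1 / real (Suc n)) \<longlonglongrightarrow> 0" by (rule LIMSEQ_Suc[OF lim_1_over_n])
  have mem: "\<forall>\<^sub>F n in sequentially. 1 / real (Suc n) \<in> {0..1}" by simp
  have "(\<lambda>n. f (1 / real (Suc n))) \<longlonglongrightarrow> f 0" "(\<lambda>n. g (1 / real (Suc n))) \<longlonglongrightarrow> g 0"
    using continuous_on_tendsto_compose[OF assms(1) lim _ mem] continuous_on_tendsto_compose[OF assms(2) lim _ mem] by auto
  then show ?thesis by (rule LIMSEQ_le) (use assms(3) in auto)
qed

text \<open>The limit e -> 0 removes the shift 2 e ln a, which is why the optimal constant is the
  same for all a. As c > 0 keeps t away from 0, the integrands are jointly continuous up to e =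
  0.\<close>

lemma unscaled_inequality:
  assumes k: "2 \<le> k" "k < CARD('n)" and p: "p = real CARD('n) / real k" and R: "0 < R" and a: "1 \<le> a"
    and C: "0 \<le> C" "\<And>u g. u \<in> (W0_rad k p R :: (real ^ 'n \<Rightarrow> real) set) \<Longrightarrow> has_W0_nabla k p R u g \<Longrightarrow>
          ennreal C * log_weight_integral p a R u \<le> Lp_energy p R g"
    and \<psi>: "smooth_real \<psi>" "supported c d \<psi>" "0 < c"
  shows "C * 2 powr p * integral {c..d} (\<lambda>t. \<bar>\<psi> t\<bar> powr p / t powr p)
    \<le> (2 * \<bar>\<Prod>j=2..k. step_const CARD('n) j\<bar>) powr p * integral {c..d} (\<lambda>t. \<bar>deriv \<psi> t\<bar> powr p)"
proof -
  let ?\<kappa> = "2 * \<bar>\<Prod>j=2..k. step_const CARD('n) j\<bar>"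
  have p1: "1 < p" using k p by simp
  have la: "0 \<le> ln a" using a by simp
  from nabla_scaled[OF \<psi>(1,2) k(1), where 'n = 'n and L = "ln (R\<^sup>2)"]
  obtain Q where Qall: "scale_family c d Q \<and> (\<forall>t. \<bar>Q 0 t\<bar> = ?\<kappa> * \<bar>deriv \<psi> t\<bar>) \<and>
    (\<forall>e>0. \<forall>x :: real ^ 'n. x \<noteq> 0 \<longrightarrow> norm (nabla k (log_scaled \<psi> e (ln (R\<^sup>2))) x)
      = norm x powr (- real k) * (e * \<bar>Q e ((- e) * ln (x \<bullet> x) + e * ln (R\<^sup>2))\<bar>))" by (elim exE)
  note Q = conjunct1[OF Qall] and Q0 = spec[OF conjunct1[OF conjunct2[OF Qall]]]
    and nab = mp[OF spec[OF mp[OF spec[OF conjunct2[OF conjunct2[OF Qall]]]]]]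
  have "C * 2 powr p * integral {c..d} (\<lambda>t. \<bar>\<psi> t\<bar> powr p / (2 * 0 * ln a + t) powr p) \<le> integral {c..d} (\<lambda>t. \<bar>Q 0 t\<bar> powr p)"
  proof (rule limit_inequality[where f = "\<lambda>e. C * 2 powr p * integral {c..d} (\<lambda>t. \<bar>\<psi> t\<bar> powr p / (2 * e * ln a + t) powr p)"
        and g = "\<lambda>e. integral {c..d} (\<lambda>t. \<bar>Q e t\<bar> powr p)"])
    have "continuous_on ({0..1} \<times> cbox c d) (\<lambda>(e, t). \<bar>Q e t\<bar> powr p)"
      using scale_family_continuous[OF Q] p1 unfolding case_prod_beta
      by (intro continuous_on_powr' continuous_intros) auto
    then show "continuous_on {0..1} (\<lambda>e. integral {c..d} (\<lambda>t. \<bar>Q e t\<bar> powr p))"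
      using integral_continuous_on_param[of "{0..1}" c d "\<lambda>e t. \<bar>Q e t\<bar> powr p"] by simp
    have "continuous_on ({0..1} \<times> cbox c d) (\<lambda>(e, t). \<bar>\<psi> t\<bar> powr p / (2 * e * ln a + t) powr p)"
    proof -
      have "0 < 2 * e * ln a + t" if "0 \<le> e" "c \<le> t" for e t
        using that la \<psi>(3) by (intro add_nonneg_pos) auto
      moreover have "continuous_on ({0..1} \<times> cbox c d) (\<lambda>z. \<psi> (snd z))"
        by (rule continuous_on_compose2[OF smooth_real_continuous[OF \<psi>(1), of UNIV]]) (auto intro: continuous_intros)
      ultimately show ?thesis using p1 unfolding case_prod_beta
        by (intro continuous_on_divide continuous_on_powr' continuous_intros) (auto intro: less_imp_le, force)
    qed
    then have "continuous_on {0..1} (\<lambda>e. integral {c..d} (\<lambda>t. \<bar>\<psi> t\<bar> powr p / (2 * e * ln a + t) powr p))"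
      using integral_continuous_on_param[of "{0..1}" c d "\<lambda>e t. \<bar>\<psi> t\<bar> powr p / (2 * e * ln a + t) powr p"] by simp
    then show "continuous_on {0..1} (\<lambda>e. C * 2 powr p * integral {c..d} (\<lambda>t. \<bar>\<psi> t\<bar> powr p / (2 * e * ln a + t) powr p))"
      by (intro continuous_intros)
    show "C * 2 powr p * integral {c..d} (\<lambda>t. \<bar>\<psi> t\<bar> powr p / (2 * e * ln a + t) powr p) \<le> integral {c..d} (\<lambda>t. \<bar>Q e t\<bar> powr p)"
      if "0 < e" for e
      by (rule scaled_inequality[OF k p R a C \<psi> Q nab that])
  qed
  also have "(\<lambda>t. \<bar>Q 0 t\<bar> powr p) = (\<lambda>t. ?\<kappa> powr p * \<bar>deriv \<psi> t\<bar> powr p)"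
    unfolding Q0 by (simp add: powr_mult)
  finally show ?thesis by simp
qed

text \<open>The substitution s = \<eta> ln t, carried out with extended nonnegative integrals; both
  real integrals are nonnegative, so the equality can be read back.\<close>

lemma integral_log_subst:
  fixes F :: "real \<Rightarrow> real"
  assumes F: "continuous_on UNIV F" "\<And>s. 0 \<le> F s" "supported 0 1 F" and \<eta>: "0 < \<eta>"
    and f: "\<And>t. f t = (if 0 < t then F (\<eta> * ln t) * (1 / t) else 0)"
  shows "integral {exp 0..exp (1 / \<eta>)} f = 1 / \<eta> * integral {0..1} F"
proof -
  have [measurable]: "F \<in> borel_measurable borel" using F(1) by (rule borel_measurable_continuous_onI)
  have cF: "continuous_on {0..1} F" using F(1) by (rule continuous_on_subset) simp
  have pos: "0 < t" if "t \<in> {exp 0..exp (1 / \<eta>)}" for t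
    using that less_le_trans[OF exp_gt_zero] by auto
  have "continuous_on {exp 0..exp (1 / \<eta>)} (\<lambda>t. F (\<eta> * ln t) * (1 / t))"
    by (intro continuous_intros continuous_on_compose2[OF F(1)]) (use pos in force)+
  then have c: "continuous_on {exp 0..exp (1 / \<eta>)} f"
    by (rule continuous_on_eq) (simp add: f pos)
  have supp: "supported (exp 0) (exp (1 / \<eta>)) f"
    unfolding supported_def
  proof (intro allI impI)
    fix t assume t: "t \<notin> {exp 0..exp (1 / \<eta>)}"
    have "\<eta> * ln t \<notin> {0..1}" if "0 < t"
    proof -
      have "ln t < 0 \<or> 1 / \<eta> < ln t" using t that by (metis atLeastAtMost_iff exp_le_cancel_iff exp_ln not_le)
      then show ?thesis using \<eta> by (auto simp: field_simps mult_less_0_iff not_le)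
    qed
    then show "f t = 0" using F(3) by (simp add: f supported_def)
  qed
  have "ennreal (integral {exp 0..exp (1 / \<eta>)} f) = (\<integral>\<^sup>+t. ennreal (f t) \<partial>lborel)"
    by (rule nn_integral_supported[OF c _ supp, symmetric]) (simp add: f F(2))
  also have "\<dots> = (\<integral>\<^sup>+t. ennreal (F (0 + \<eta> * ln t)) * (ennreal (1 / t) * indicator {0<..} t) \<partial>lborel)"
    by (intro nn_integral_cong) (auto simp: f indicator_def F(2) simp flip: ennreal_mult)
  also have "\<dots> = ennreal (1 / \<bar>\<eta>\<bar>) * (\<integral>\<^sup>+s. ennreal (F s) \<partial>lborel)"
    by (rule nn_integral_log_affine_subst) (use \<eta> in auto)
  also have "(\<integral>\<^sup>+s. ennreal (F s) \<partial>lborel) = ennreal (integral {0..1} F)"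
    by (rule nn_integral_supported[OF cF F(2,3)])
  finally have "ennreal (integral {exp 0..exp (1 / \<eta>)} f) = ennreal (1 / \<eta> * integral {0..1} F)"
    using \<eta> by (simp flip: ennreal_mult')
  moreover have "0 \<le> integral {exp 0..exp (1 / \<eta>)} f"
    by (intro integral_nonneg integrable_continuous_real c) (simp add: f F(2))
  moreover have "0 \<le> integral {0..1} F"
    by (intro integral_nonneg integrable_continuous_real cF F(2))
  ultimately show ?thesis using \<eta> by (subst (asm) ennreal_inj) auto
qed

text \<open>The exponent \<beta> = 1 - 1/p makes both (|\<psi>|/t)^p and |\<psi>'|^p equal to 1/t
  times a function of \<eta> ln t. So both integrals carry the same factor 1/\<eta>, while the
  derivative of the cutoff enters with a factor \<eta> and drops out in the limit, leaving the ratio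
  \<beta>^p.\<close>

lemma optimal_constant:
  assumes k: "2 \<le> k" "k < CARD('n)" and p: "p = real CARD('n) / real k" and R: "0 < R" and a: "1 \<le> a"
    and C: "\<And>u g. u \<in> (W0_rad k p R :: (real ^ 'n \<Rightarrow> real) set) \<Longrightarrow> has_W0_nabla k p R u g \<Longrightarrow>
          ennreal C * log_weight_integral p a R u \<le> Lp_energy p R g"
  shows "C \<le> Hardy_const CARD('n) p k powr p"
\<comment> \<open>\<open>ennreal\<close> sends a negative C to 0, so the rescaling is done for C >=
  0; a negative C lies below the nonnegative bound directly.\<close>
proof (cases "0 \<le> C")
  case False
  then show ?thesis by (meson le_less_linear order_trans powr_ge_zero less_imp_le)
next
  case C0: True
  have p1: "1 < p" using k p by simp
  define \<beta> where "\<beta> = 1 - 1 / p"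
  have \<beta>: "0 < \<beta>" "(\<beta> - 1) * p = - 1" using p1 by (auto simp: \<beta>_def)
  define \<kappa> where "\<kappa> = 2 * \<bar>\<Prod>j=2..k. step_const CARD('n) j\<bar>"
  have \<kappa>0: "0 \<le> \<kappa>" by (simp add: \<kappa>_def)
  define B where "B = integral {0..1} (\<lambda>s. bump s powr p)"
  define D where "D \<eta> = integral {0..1} (\<lambda>s. \<bar>\<beta> * bump s + \<eta> * deriv bump s\<bar> powr p)" for \<eta>
  have contb: "continuous_on S bump" "continuous_on S (deriv bump)" for S
    using smooth_real_continuous smooth_bump smooth_real_deriv_smooth by blast+
  have cB: "continuous_on S (\<lambda>s. bump s powr p)" for S
    using p1 bump_nonneg by (intro continuous_on_powr' continuous_intros contb) auto
  have cD: "continuous_on S (\<lambda>s. \<bar>\<beta> * bump s + \<eta> * deriv bump s\<bar> powr p)" for \<eta> S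
    using p1 by (intro continuous_on_powr' continuous_intros contb) auto
  have ineq: "C * 2 powr p * B \<le> \<kappa> powr p * D \<eta>" if \<eta>: "0 < \<eta>" for \<eta>
  proof -
    define A where "A s = bump (\<eta> * s + 0)" for s
    have A: "smooth_real A" unfolding A_def by (rule smooth_real_affine[OF smooth_bump])
    have supA: "supported 0 (1 / \<eta>) A"
      unfolding supported_def A_def
    proof (intro allI impI)
      fix s assume "s \<notin> {0..1 / \<eta>}"
      then have "\<eta> * s + 0 \<notin> {0..1}" using \<eta> by (auto simp: field_simps zero_le_mult_iff)
      then show "bump (\<eta> * s + 0) = 0" using supported_bump by (simp add: supported_def)
    qed
    have dA: "deriv A = (\<lambda>s. \<eta> * deriv bump (\<eta> * s + 0))" unfolding A_def by (rule deriv_affine[OF smooth_bump])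
    \<comment> \<open>Since the bump lives on [0,1], the support lies in [1, exp(1/\<eta>)], at
      positive distance from 0 as \<open>unscaled_inequality\<close> requires.\<close>
    define \<psi> where "\<psi> = log_profile \<beta> A"
    have \<psi>: "smooth_real \<psi>" "supported (exp 0) (exp (1 / \<eta>)) \<psi>"
      unfolding \<psi>_def by (rule smooth_log_profile[OF A supA], rule log_profile_supported[OF supA])
    have d\<psi>: "deriv \<psi> = log_profile (\<beta> - 1) (\<lambda>s. \<beta> * A s + deriv A s)"
      unfolding \<psi>_def by (rule deriv_log_profile[OF smooth_real_deriv[OF A] supA])
    have pw: "(t powr (\<beta> - 1)) powr p = 1 / t" if "0 < t" for t
      using that \<beta> by (simp add: powr_powr powr_minus divide_inverse)
    have I\<psi>: "integral {exp 0..exp (1 / \<eta>)} (\<lambda>t. \<bar>\<psi> t\<bar> powr p / t powr p) = 1 / \<eta> * B"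
      unfolding B_def
    proof (rule integral_log_subst[OF _ _ _ \<eta>])
      fix t :: real
      show "\<bar>\<psi> t\<bar> powr p / t powr p = (if 0 < t then bump (\<eta> * ln t) powr p * (1 / t) else 0)"
      proof (cases "0 < t")
        case True
        have "\<psi> t = t powr (\<beta> - 1) * t * bump (\<eta> * ln t)" using True by (simp add: \<psi>_def log_profile_def A_def powr_diff)
        then have "\<bar>\<psi> t\<bar> powr p = (t powr (\<beta> - 1)) powr p * t powr p * bump (\<eta> * ln t) powr p"
          using True bump_nonneg by (simp add: abs_mult powr_mult)
        then have "\<bar>\<psi> t\<bar> powr p / t powr p = bump (\<eta> * ln t) powr p * (1 / t)" unfolding pw[OF True] using True by simp
        then show ?thesis using True by simp
      qed (simp add: \<psi>_def log_profile_def)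
    qed (use cB supported_bump in \<open>auto simp: supported_def\<close>)
    have I\<psi>': "integral {exp 0..exp (1 / \<eta>)} (\<lambda>t. \<bar>deriv \<psi> t\<bar> powr p) = 1 / \<eta> * D \<eta>"
      unfolding D_def
    proof (rule integral_log_subst[OF _ _ _ \<eta>])
      fix t :: real
      show "\<bar>deriv \<psi> t\<bar> powr p = (if 0 < t then \<bar>\<beta> * bump (\<eta> * ln t) + \<eta> * deriv bump (\<eta> * ln t)\<bar> powr p * (1 / t) else 0)"
      proof (cases "0 < t")
        case True
        have "deriv \<psi> t = t powr (\<beta> - 1) * (\<beta> * bump (\<eta> * ln t) + \<eta> * deriv bump (\<eta> * ln t))"
          using True unfolding d\<psi> dA by (simp add: log_profile_def A_def)
        then have "\<bar>deriv \<psi> t\<bar> powr p = (t powr (\<beta> - 1)) powr p * \<bar>\<beta> * bump (\<eta> * ln t) + \<eta> * deriv bump (\<eta> * ln t)\<bar> powr p"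
          by (simp add: abs_mult powr_mult)
        then show ?thesis unfolding pw[OF True] using True by simp
      qed (simp add: d\<psi> log_profile_def)
    qed (use cD supported_bump supported_deriv[OF supported_bump] in \<open>auto simp: supported_def\<close>)
    have "C * 2 powr p * (1 / \<eta> * B) \<le> \<kappa> powr p * (1 / \<eta> * D \<eta>)"
      using unscaled_inequality[OF k p R a C0 C \<psi>] unfolding I\<psi> I\<psi>' \<kappa>_def by simp
    then have "1 / \<eta> * (C * 2 powr p * B) \<le> 1 / \<eta> * (\<kappa> powr p * D \<eta>)" by (simp add: mult_ac)
    then show ?thesis using \<eta> by (subst (asm) mult_le_cancel_left_pos) auto
  qed
  have "C * 2 powr p * B \<le> \<kappa> powr p * D 0"
  proof (rule limit_inequality[where f = "\<lambda>_. C * 2 powr p * B" and g = "\<lambda>\<eta>. \<kappa> powr p * D \<eta>"])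
    have "continuous_on ({0..1} \<times> cbox 0 1) (\<lambda>z. bump (snd z))" "continuous_on ({0..1} \<times> cbox 0 1) (\<lambda>z. deriv bump (snd z))"
      by (auto intro!: continuous_intros continuous_on_compose2[OF contb(1)[of UNIV]] continuous_on_compose2[OF contb(2)[of UNIV]])
    then have "continuous_on ({0..1} \<times> cbox 0 1) (\<lambda>(\<eta>, s). \<bar>\<beta> * bump s + \<eta> * deriv bump s\<bar> powr p)"
      using p1 unfolding case_prod_beta by (intro continuous_on_powr' continuous_intros) auto
    then have "continuous_on {0..1} D"
      using integral_continuous_on_param[of "{0..1}" 0 1 "\<lambda>\<eta> s. \<bar>\<beta> * bump s + \<eta> * deriv bump s\<bar> powr p"] by (simp add: D_def[abs_def])
    then show "continuous_on {0..1} (\<lambda>\<eta>. \<kappa> powr p * D \<eta>)" by (intro continuous_intros)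
  qed (use ineq in auto)
  also have "D 0 = \<beta> powr p * B"
    using \<beta> bump_nonneg by (simp add: D_def B_def abs_mult powr_mult)
  finally have le: "C * 2 powr p * B \<le> \<kappa> powr p * (\<beta> powr p * B)" .
  have "0 < B"
  proof -
    have "0 \<le> B" unfolding B_def by (intro integral_nonneg integrable_continuous_real cB) simp
    moreover have "B \<noteq> 0"
      unfolding B_def using bump_pos[of "1/2"] by (subst integral_eq_0_iff[OF cB]) (auto intro!: bexI[of _ "1/2"])
    ultimately show ?thesis by simp
  qed
  moreover have "B * (C * 2 powr p) \<le> B * (\<kappa> powr p * \<beta> powr p)" using le by (simp add: mult_ac)
  ultimately have "C * 2 powr p \<le> \<kappa> powr p * \<beta> powr p" by (subst (asm) mult_le_cancel_left_pos) auto
  then have "C \<le> \<kappa> powr p * \<beta> powr p / 2 powr p" by (simp add: field_simps)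
  also have "\<dots> = (\<kappa> * \<beta> / 2) powr p" using \<kappa>0 \<beta> by (simp add: powr_mult powr_divide)
  also have "\<kappa> * \<beta> / 2 = Hardy_const CARD('n) p k"
  proof -
    have "0 < (\<Prod>j=2..k. step_const CARD('n) j)" using k by (intro prod_pos) (auto intro!: step_const_pos)
    then show ?thesis by (simp add: \<kappa>_def \<beta>_def Hardy_const_def)
  qed
  finally show ?thesis .
qed

theorem corollary1:
  fixes k m :: nat and p R a K :: real
  assumes "2 \<le> k" and "k < CARD('n::finite)"
    and "1 \<le> m" and "k = 2 * m \<or> k = 2 * m + 1"
    and "p = real CARD('n) / real k"
    and "0 < R" and "1 \<le> a"
    and "K = rellich_const CARD('n) k m p"
  shows
    "(\<forall>u \<in> (W0_rad k p R :: (real ^ 'n \<Rightarrow> real) set). \<forall>g. has_W0_nabla k p R u g \<longrightarrow>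
        ennreal K * log_weight_integral p a R u \<le> Lp_energy p R g) \<and>
     (\<forall>C :: real.
        (\<forall>u \<in> (W0_rad k p R :: (real ^ 'n \<Rightarrow> real) set). \<forall>g. has_W0_nabla k p R u g \<longrightarrow>
          ennreal C * log_weight_integral p a R u \<le> Lp_energy p R g) \<longrightarrow> C \<le> K) \<and>
     (\<forall>u \<in> (W0_rad k p R :: (real ^ 'n \<Rightarrow> real) set). \<forall>g. has_W0_nabla k p R u g \<longrightarrow>
        \<not> (AE x in lebesgue_on (ball 0 R). u x = 0) \<longrightarrow>
        ennreal K * log_weight_integral p a R u \<noteq> Lp_energy p R g)"
proof -
  have K: "K = Hardy_const (real CARD('n)) p k powr p"
    unfolding assms(8) using assms by (intro rellich_const_eq) auto
  note R = critical_Rellich[OF assms(1,2,5,6,7)]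
  show ?thesis
    unfolding K
  proof (intro conjI ballI allI impI)
    fix C assume "\<forall>u \<in> (W0_rad k p R :: (real ^ 'n \<Rightarrow> real) set). \<forall>g. has_W0_nabla k p R u g \<longrightarrow>
          ennreal C * log_weight_integral p a R u \<le> Lp_energy p R g"
    then show "C \<le> Hardy_const (real CARD('n)) p k powr p"
      using assms by (intro optimal_constant[where R = R and a = a]) auto
  next
    fix u :: "real ^ 'n \<Rightarrow> real" and g
    assume "u \<in> W0_rad k p R" "has_W0_nabla k p R u g" "\<not> (AE x in lebesgue_on (ball 0 R). u x = 0)"
    from R(2)[OF this] show "ennreal (Hardy_const (real CARD('n)) p k powr p) * log_weight_integral p a R u \<noteq> Lp_energy p R g"
      by (rule less_imp_neq)
  qed (rule R(1))
qed

end
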